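(* Let $X$ be a simplicial set, let $q,p,n\ge0$ be integers, and let $\alpha\in N^n(X)$ be a cocycle. Then, as cochains in $N^*(X)$, $$\sum_\ell\binom{q-\ell}{q-2\ell}Sq^{2n-p-\ell}Sq^{n-q+\ell}(\alpha)+\sum_\ell\binom{p-\ell}{p-2\ell}Sq^{2n-q-\ell}Sq^{n-p+\ell}(\alpha)$$ $$=d\Big(\bar J_\Psi(x_p\times x_q)(\alpha)+N_{p,q,n}(\alpha)+\bar J_\Psi(x_q\times x_p)(\alpha)+N_{q,p,n}(\alpha)+\bar J_{(23)}(x_q\times x_p)(\alpha)\Big).$$ Here the first sum is over integers $\ell$ with $0\le\ell\le q/2$, $p-q+2\ell\ge0$, the second over integers $\ell$ with $0\le\ell\le p/2$, $q-p+2\ell\ge0$; the explicit chain homotopies $\bar J_\Psi$, $\bar J_{(23)}$ and the action of $N_*(B\Sigma_4)$ on cochains are defined in the context; and $$N_{q,p,n}(\alpha)=\sum_{\ell,a}\binom{p-\ell-a}{p-2\ell}\binom{p-\ell+a}{p-2\ell}\;Sq^{n-p+\ell+a}(\alpha)\smile_{q-p+2\ell+1}Sq^{n-p+\ell-a}(\alpha),$$ summed over $\ell,a\in\frac12\mathbb{Z}$ with $0<a\le\ell\le p/2$, $a\equiv\ell\pmod{\mathbb{Z}}$, $q-p+2\ell\ge0$, with $N_{p,q,n}(\alpha)$ obtained by exchanging $p$ and $q$.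
   Context: **Chains.** All coefficients are $\mathbb{F}_2$. $N_*(X)$ is the normalized chain complex of a simplicial set $X$ (chains modulo degenerate simplices, boundary = sum of faces); $N^*(X)$ is its dual with coboundary $d$, graded here in non-negative degrees. Binomial coefficients are mod $2$, with $\binom AB=0$ unless $0\le B\le A$. **Classifying spaces.** $(EG)_k=G^{k+1}$, faces delete and degeneracies repeat entries, $g(g_0,\dots,g_k)=(gg_0,\dots,gg_k)$, $BG=G\backslash EG$; $N_*(BG)=N_*(EG)_G$ (coinvariants). For a subgroup $H\subset G$, regard $N_*(EH)\subset N_*(EG)$, $N_*(BH)\subset N_*(BG)$. The join $*:N_j(EG)\otimes N_k(EG)\to N_{j+k+1}(EG)$ is the bilinear extension of concatenation of tuples. For $\Sigma_2=\{1,T\}$: $\tilde x_k=(1,T,1,\dots,T^k)\in N_k(E\Sigma_2)$, and $x_k\in N_k(B\Sigma_2)$ is its image. **EZ and AW.** $EZ:N_*(Y)\otimes N_*(Z)\to N_*(Y\times Z)$ is the Eilenberg–Zilber shuffle map: on $\Delta^k\times\Delta^m$ it sends the tensor of top simplices to the sum of all $(k+m)$-simplices given by maximal chains in the product poset. It is associative, so defined for several factors. $AW:N_*(Y\times Z)\to N_*(Y)\otimes N_*(Z)$ is $AW(u,v)=\sum_i(\text{front }i\text{-face of }u)\otimes(\text{complementary back face of }v)$, and $AW_\Delta:N_*(Y)\to N_*(Y)\otimes N_*(Y)$ is $AW_\Delta(u)=AW(u,u)$. **Steenrod's map.** $\widetilde{AW}_\Delta:N_*(E\Sigma_2)\otimes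 N_*(Y)\to N_*(Y)\otimes N_*(Y)$ is, for a simplex $u:\Delta^N\to Y$, $$\widetilde{AW}_\Delta(\tilde x_m\otimes u)=\sum_{0\le k_1<\cdots<k_{m+1}\le N}u(I_{odd})\otimes u(I_{even}),$$ with $I_1=\{0,\dots,k_1\}$, $I_s=\{k_{s-1},\dots,k_s\}$ for $2\le s\le m+1$, $I_{m+2}=\{k_{m+1},\dots,N\}$, $I_{odd},I_{even}$ the unions of the odd- and even-indexed intervals and $u(I)$ the face spanned by $I$; and $\widetilde{AW}_\Delta(T\tilde x_m\otimes u)$ is obtained by switching tensor factors. The product $\smile_m$ is defined by $\langle\beta\smile_m\gamma,u\rangle=\langle\beta\otimes\gamma,\widetilde{AW}_\Delta(\tilde x_m\otimes u)\rangle$. For a cocycle $\beta$ of degree $i$, $Sq^k(\beta)=\beta\smile_{i-k}\beta$ as a cochain (zero if $k>i$). **Groups.** Permutations multiply as composed functions. In $\Sigma_4$ let $a=(13)(24)$, $b=(12)$, $c=(34)$ in cycle notation; $D_8=\langle a,b,c\rangle$ (order 8) and $V_4=\langle a,bc\rangle$. Identify $\Sigma_2\times\Sigma_2$ with $V_4$ by sending the generator of the first factor to $a$ and of the second to $bc$; so $E\Sigma_2\times E\Sigma_2=EV_4$, $B\Sigma_2\times B\Sigma_2=BV_4$. Put $\tilde x_q\times\tilde x_p=EZ(\tilde x_q\otimes\tilde x_p)\in N_*(EV_4)$ and $x_q\times x_p=EZ(x_q\otimes x_p)\in N_*(BV_4)$. The bijection $(T^{\epsilon_1},T^{\epsilon_2},T^{\epsilon_3})\mapsto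 c^{\epsilon_3}b^{\epsilon_2}a^{\epsilon_1}$ on vertices ($\epsilon_i\in\{0,1\}$) identifies the simplicial sets $E\Sigma_2\times E\Sigma_2\times E\Sigma_2=ED_8$. **The homotopies.** $\Phi=(\mathrm{Id}\otimes\widetilde{AW}_\Delta)\circ(AW_\Delta\otimes\mathrm{Id}):N_*(E\Sigma_2)^{\otimes2}\to N_*(E\Sigma_2)^{\otimes3}$, and $\Psi=EZ\circ\Phi\circ AW:N_*(EV_4)=N_*(E\Sigma_2\times E\Sigma_2)\to N_*(E\Sigma_2\times E\Sigma_2\times E\Sigma_2)=N_*(ED_8)$. Define $$J_\Psi(g_0,\dots,g_k)=\sum_{j=0}^k(g_0,\dots,g_j)*\Psi(g_j,\dots,g_k)\in N_{k+1}(ED_8),\qquad g_i\in V_4.$$ It is $V_4$-equivariant and induces $\bar J_\Psi:N_*(BV_4)\to N_{*+1}(BD_8)\subset N_{*+1}(B\Sigma_4)$. With $g=(23)\in\Sigma_4$ (cycle notation), define $$J_{(23)}(g_0,\dots,g_k)=\sum_{j=0}^k(g_0,\dots,g_j,g_jg^{-1},\dots,g_kg^{-1})\in N_{k+1}(E\Sigma_4),\qquad g_i\in\Sigma_4,$$ which is $\Sigma_4$-equivariant and induces $\bar J_{(23)}:N_*(B\Sigma_4)\to N_{*+1}(B\Sigma_4)$. **Action of $N_*(B\Sigma_4)$ on cochains.** Let $\mathcal S_r(k)$ be the $\mathbb{F}_2$-vector space on sequences $A=(A(1),\dots,A(r+k))$ in $\{1,\dots,r\}$, modulo non-surjective sequences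 and those with two equal consecutive entries. $A\in\mathcal S_r(k)$ acts on $\alpha_1\otimes\cdots\otimes\alpha_r$ (of total degree $k+N$) by $$\langle A(\alpha_1\otimes\cdots\otimes\alpha_r),u\rangle=\sum\prod_{\ell=1}^r\langle\alpha_\ell,u(I(\ell))\rangle,\qquad u:\Delta^N\to X,$$ the sum over all divisions of $\{0,\dots,N\}$ into $r+k$ non-empty intervals $I_1,\dots,I_{r+k}$, where $I_1$ starts at $0$, $I_{r+k}$ ends at $N$, the last point of each interval is the first point of the next, and $I_j\cap I_{j'}=\emptyset$ whenever $j\ne j'$ and $A(j)=A(j')$; $I(\ell)=\bigcup_{A(j)=\ell}I_j$. Evaluation on a face of the wrong dimension is $0$. Table reduction $TR:N_k(E\Sigma_r)\to\mathcal S_r(k)$ is $TR(\sigma_0,\dots,\sigma_k)=\sum_{\mathbf a}s_{\mathbf a}$ over tuples $\mathbf a=(a_0,\dots,a_k)$ of integers $\ge1$ with $\sum a_i=k+r$. Here $s_{\mathbf a}$ is formed from the table with rows $(\sigma_i(1),\dots,\sigma_i(r))$, $i=0,\dots,k$: write the first $a_0$ entries of row $0$, then delete all but the last of these values from all lower rows; append the first $a_1$ remaining entries of row $1$, then delete all but the last of these values from all lower rows; and so on through row $k$. For $y\in N_k(B\Sigma_4)$ and $\alpha\in N^n(X)$, $y(\alpha):=TR(\tilde y)(\alpha^{\otimes4})\in N^{4n-k}(X)$, where $\tilde y\in N_k(E\Sigma_4)$ is any lift of $y$ (the result is independent of the lift). *)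

theory Defs
  imports
    "HOL-Library.Z2"
    "HOL-Library.Poly_Mapping"
    "HOL-Library.Function_Algebras"
    "HOL-Combinatorics.Transposition"
    "HOL-Algebra.Generated_Groups"
    "HOL-Algebra.Sym_Groups"
begin

section \<open>Simplicial sets\<close>

text \<open>
  A monotone map \<open>\<theta> : [m] \<rightarrow> [n]\<close> is the sorted list \<open>[\<theta> 0, \<dots>, \<theta> m]\<close> of its values.
\<close>

definition Delta :: "nat \<Rightarrow> nat \<Rightarrow> nat list set" where
  "Delta m n = {\<theta>. length \<theta> = Suc m \<and> sorted \<theta> \<and> set \<theta> \<subseteq> {..n}}"

text \<open>
  A simplicial set is a contravariant functor on the simplex category: \<open>act X n \<theta> u\<close> is the
  simplex \<open>u \<circ> \<theta>\<close>, where \<open>u\<close> is an \<open>n\<close>-simplex, viewed as a map from the standard simplex.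
\<close>

record 'a sset =
  cells :: "nat \<Rightarrow> 'a set"
  act :: "nat \<Rightarrow> nat list \<Rightarrow> 'a \<Rightarrow> 'a"

locale simplicial_set =
  fixes X :: "'a sset"
  assumes act_closed: "u \<in> cells X n \<Longrightarrow> \<theta> \<in> Delta m n \<Longrightarrow> act X n \<theta> u \<in> cells X m"
    and act_id: "u \<in> cells X n \<Longrightarrow> act X n [0..<Suc n] u = u"
    and act_comp: "u \<in> cells X n \<Longrightarrow> \<theta> \<in> Delta m n \<Longrightarrow> \<eta> \<in> Delta k m \<Longrightarrow>
      act X m \<eta> (act X n \<theta> u) = act X n (map ((!) \<theta>) \<eta>) u"

text \<open>The list \<open>[0, \<dots>, i, i, \<dots>, k - 1]\<close> is the degeneracy operator \<open>s\<^sub>i\<close> from dimension \<open>k - 1\<close>.\<close>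

definition degenerate :: "'a sset \<Rightarrow> nat \<Rightarrow> 'a \<Rightarrow> bool" where
  "degenerate X k u \<longleftrightarrow>
    (\<exists>i v. i < k \<and> v \<in> cells X (k - 1) \<and> u = act X (k - 1) ([0..<Suc i] @ [i..<k]) v)"

definition prod_sset :: "'a sset \<Rightarrow> 'b sset \<Rightarrow> ('a \<times> 'b) sset" (infixr "\<times>\<^sub>s" 80) where
  "Y \<times>\<^sub>s Z = \<lparr>cells = (\<lambda>n. cells Y n \<times> cells Z n),
              act = (\<lambda>n \<theta> (u, v). (act Y n \<theta> u, act Z n \<theta> v))\<rparr>"


section \<open>Normalized chains\<close>

text \<open>
  An element of \<open>N\<^sub>*(X)\<close> is an \<open>\<F>\<^sub>2\<close>-combination of pairs \<open>(k, u)\<close>, where \<open>u\<close> is a nondegenerate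
  \<open>k\<close>-simplex; these form a basis of chains modulo degenerate simplices. Tensor products are
  spanned by tuples of such pairs.
\<close>

type_synonym 'a chain = "(nat \<times> 'a) \<Rightarrow>\<^sub>0 bit"

definition chains :: "'a sset \<Rightarrow> 'a chain set" where
  "chains X = {c. \<forall>(k, u) \<in> Poly_Mapping.keys c. u \<in> cells X k \<and> \<not> degenerate X k u}"

text \<open>The class of a \<open>k\<close>-simplex in the normalized chains.\<close>

definition cls :: "'a sset \<Rightarrow> nat \<Rightarrow> 'a \<Rightarrow> 'a chain" where
  "cls X k u = (if degenerate X k u then 0 else Poly_Mapping.single (k, u) 1)"

text \<open>
  The linear extension of a map given on basis elements. All coefficients on
  \<open>Poly_Mapping.keys c\<close> equal \<open>1\<close>, so they need not be written.
\<close>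

definition lin :: "('x \<Rightarrow> ('y \<Rightarrow>\<^sub>0 bit)) \<Rightarrow> ('x \<Rightarrow>\<^sub>0 bit) \<Rightarrow> ('y \<Rightarrow>\<^sub>0 bit)" where
  "lin f c = (\<Sum>x \<in> Poly_Mapping.keys c. f x)"

definition tensor :: "('x \<Rightarrow>\<^sub>0 bit) \<Rightarrow> ('y \<Rightarrow>\<^sub>0 bit) \<Rightarrow> ('x \<times> 'y \<Rightarrow>\<^sub>0 bit)" where
  "tensor c d = lin (\<lambda>x. lin (\<lambda>y. Poly_Mapping.single (x, y) 1) d) c"

definition switch :: "('x \<times> 'y \<Rightarrow>\<^sub>0 bit) \<Rightarrow> ('y \<times> 'x \<Rightarrow>\<^sub>0 bit)" where
  "switch = lin (\<lambda>(x, y). Poly_Mapping.single (y, x) 1)"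

text \<open>The chain map into \<open>N\<^sub>*(Y)\<close> induced by a map \<open>f\<close> of simplicial sets.\<close>

definition push :: "('a \<Rightarrow> 'b) \<Rightarrow> 'b sset \<Rightarrow> 'a chain \<Rightarrow> 'b chain" where
  "push f Y = lin (\<lambda>(k, u). cls Y k (f u))"


section \<open>Eilenberg--Zilber, Alexander--Whitney and Steenrod's map\<close>

text \<open>
  Maximal chains in \<open>[k] \<times> [m]\<close>, given by their two lists of coordinates: they are the strictly
  increasing sequences of \<open>k + m + 1\<close> vertices.
\<close>

definition max_chains :: "nat \<Rightarrow> nat \<Rightarrow> (nat list \<times> nat list) set" where
  "max_chains k m =
    {(\<theta>, \<eta>). \<theta> \<in> Delta (k + m) k \<and> \<eta> \<in> Delta (k + m) m \<and> distinct (zip \<theta> \<eta>)}"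

definition EZ :: "'a sset \<Rightarrow> 'b sset \<Rightarrow> (nat \<times> 'a) \<times> (nat \<times> 'b) \<Rightarrow> ('a \<times> 'b) chain" where
  "EZ Y Z = (\<lambda>((k, u), (m, v)).
    \<Sum>(\<theta>, \<eta>) \<in> max_chains k m. cls (Y \<times>\<^sub>s Z) (k + m) (act Y k \<theta> u, act Z m \<eta> v))"

definition AW :: "'a sset \<Rightarrow> 'b sset \<Rightarrow> nat \<times> ('a \<times> 'b) \<Rightarrow> ((nat \<times> 'a) \<times> (nat \<times> 'b)) \<Rightarrow>\<^sub>0 bit" where
  "AW Y Z = (\<lambda>(n, (u, v)).
    \<Sum>i\<le>n. tensor (cls Y i (act Y n [0..<Suc i] u)) (cls Z (n - i) (act Z n [i..<Suc n] v)))"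

definition AW_diag :: "'a sset \<Rightarrow> nat \<times> 'a \<Rightarrow> ((nat \<times> 'a) \<times> (nat \<times> 'a)) \<Rightarrow>\<^sub>0 bit" where
  "AW_diag Y = (\<lambda>(n, u). AW Y Y (n, (u, u)))"

text \<open>\<open>u(I)\<close> is the face of \<open>u\<close> spanned by a set \<open>I\<close> of vertices; its dimension is \<open>card I - 1\<close>.\<close>

definition face :: "'a sset \<Rightarrow> nat \<Rightarrow> 'a \<Rightarrow> nat set \<Rightarrow> 'a" where
  "face X N u I = act X N (sorted_list_of_set I) u"

text \<open>
  For \<open>ks = [k\<^sub>1, \<dots>, k\<^sub>m\<^sub>+\<^sub>1]\<close>, the interval \<open>I\<^sub>s\<close> is \<open>{\<kappa>\<^sub>s\<^sub>-\<^sub>1, \<dots>, \<kappa>\<^sub>s}\<close> with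
  \<open>\<kappa> = [0, k\<^sub>1, \<dots>, k\<^sub>m\<^sub>+\<^sub>1, N]\<close>.
\<close>

definition steenrod_part :: "nat \<Rightarrow> nat list \<Rightarrow> (nat \<Rightarrow> bool) \<Rightarrow> nat set" where
  "steenrod_part N ks P =
    (let \<kappa> = 0 # ks @ [N] in \<Union>s \<in> {s \<in> {1..Suc (length ks)}. P s}. {\<kappa> ! (s - 1) .. \<kappa> ! s})"

text \<open>The value of Steenrod's map on the tensor of the generator in degree \<open>m\<close> with \<open>u\<close>.\<close>

definition steenrod_gen :: "'a sset \<Rightarrow> nat \<Rightarrow> nat \<times> 'a \<Rightarrow> ((nat \<times> 'a) \<times> (nat \<times> 'a)) \<Rightarrow>\<^sub>0 bit" where
  "steenrod_gen X m = (\<lambda>(N, u).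
    \<Sum>ks \<in> {ks. length ks = Suc m \<and> sorted_wrt (<) ks \<and> set ks \<subseteq> {..N}}.
      (let I = steenrod_part N ks odd; J = steenrod_part N ks even
       in tensor (cls X (card I - 1) (face X N u I)) (cls X (card J - 1) (face X N u J))))"


section \<open>Cochains\<close>

text \<open>
  A cochain of degree \<open>n\<close> is a function on the simplices of all dimensions which vanishes on
  degenerate simplices and outside dimension \<open>n\<close>. Degrees are thereby carried by the functions
  themselves, and there are no nonzero cochains of negative degree.
\<close>

type_synonym 'a cochain = "nat \<Rightarrow> 'a \<Rightarrow> bit"

definition cochains :: "'a sset \<Rightarrow> nat \<Rightarrow> 'a cochain set" where
  "cochains X n =
    {\<alpha>. \<forall>k. \<forall>u \<in> cells X k. k \<noteq> n \<or> degenerate X k u \<longrightarrow> \<alpha> k u = 0}"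

definition coboundary :: "'a sset \<Rightarrow> 'a cochain \<Rightarrow> 'a cochain" where
  "coboundary X \<beta> N u =
    (if N = 0 then 0 else \<Sum>i\<le>N. \<beta> (N - 1) (face X N u ({..N} - {i})))"

definition cocycles :: "'a sset \<Rightarrow> nat \<Rightarrow> 'a cochain set" where
  "cocycles X n = {\<alpha> \<in> cochains X n. \<forall>N. \<forall>u \<in> cells X N. coboundary X \<alpha> N u = 0}"

text \<open>Equality in \<open>N\<^sup>*(X)\<close>; values outside \<open>cells X\<close> are irrelevant.\<close>

definition cochain_eq :: "'a sset \<Rightarrow> 'a cochain \<Rightarrow> 'a cochain \<Rightarrow> bool" where
  "cochain_eq X \<beta> \<gamma> \<longleftrightarrow> (\<forall>N. \<forall>u \<in> cells X N. \<beta> N u = \<gamma> N u)"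

definition scale :: "bit \<Rightarrow> 'a cochain \<Rightarrow> 'a cochain" where
  "scale t \<beta> = (\<lambda>N u. t * \<beta> N u)"

definition cup :: "'a sset \<Rightarrow> nat \<Rightarrow> 'a cochain \<Rightarrow> 'a cochain \<Rightarrow> 'a cochain" where
  "cup X m \<beta> \<gamma> N u =
    (\<Sum>((i, v), (j, w)) \<in> Poly_Mapping.keys (steenrod_gen X m (N, u)). \<beta> i v * \<gamma> j w)"

text \<open>\<open>Sq X i k \<beta>\<close> is \<open>Sq\<^sup>k(\<beta>)\<close> for a cocycle \<open>\<beta>\<close> of degree \<open>i\<close>.\<close>

definition Sq :: "'a sset \<Rightarrow> int \<Rightarrow> int \<Rightarrow> 'a cochain \<Rightarrow> 'a cochain" where
  "Sq X i k \<beta> = (if k > i then 0 else cup X (nat (i - k)) \<beta> \<beta>)"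


section \<open>Classifying spaces\<close>

definition EG :: "('g, 'm) monoid_scheme \<Rightarrow> 'g list sset" where
  "EG G = \<lparr>cells = (\<lambda>k. {gs. length gs = Suc k \<and> set gs \<subseteq> carrier G}),
           act = (\<lambda>n \<theta> gs. map ((!) gs) \<theta>)\<rparr>"

definition translate :: "('g, 'm) monoid_scheme \<Rightarrow> 'g \<Rightarrow> 'g list \<Rightarrow> 'g list" where
  "translate G g gs = map (\<lambda>h. g \<otimes>\<^bsub>G\<^esub> h) gs"

definition orbit_of :: "('g, 'm) monoid_scheme \<Rightarrow> 'g list \<Rightarrow> 'g list set" where
  "orbit_of G gs = (\<lambda>g. translate G g gs) ` carrier G"

definition BG :: "('g, 'm) monoid_scheme \<Rightarrow> 'g list set sset" where
  "BG G = \<lparr>cells = (\<lambda>k. orbit_of G ` cells (EG G) k),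
           act = (\<lambda>n \<theta> \<omega>. act (EG G) n \<theta> ` \<omega>)\<rparr>"

definition proj :: "('g, 'm) monoid_scheme \<Rightarrow> 'g list chain \<Rightarrow> 'g list set chain" where
  "proj G = push (orbit_of G) (BG G)"

text \<open>
  Some lift of a chain to \<open>N\<^sub>*(EG)\<close>. It is only used in constructions whose result does not
  depend on the lift.
\<close>

definition lift_chain :: "('g, 'm) monoid_scheme \<Rightarrow> 'g list set chain \<Rightarrow> 'g list chain" where
  "lift_chain G y = (SOME c. c \<in> chains (EG G) \<and> proj G c = y)"

text \<open>
  The inclusion into \<open>N\<^sub>*(BG)\<close> of \<open>N\<^sub>*(BH)\<close> for a subgroup \<open>H\<close>: an \<open>H\<close>-orbit is sent to the
  \<open>G\<close>-orbit containing it.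
\<close>

definition incl_BG :: "('g, 'm) monoid_scheme \<Rightarrow> 'g list set chain \<Rightarrow> 'g list set chain" where
  "incl_BG G = push (\<lambda>\<omega>. \<Union> (orbit_of G ` \<omega>)) (BG G)"

definition join :: "('g, 'm) monoid_scheme \<Rightarrow> 'g list chain \<Rightarrow> 'g list chain \<Rightarrow> 'g list chain" where
  "join G c d = lin (\<lambda>((j, us), (k, vs)). cls (EG G) (j + k + 1) (us @ vs)) (tensor c d)"


section \<open>The groups\<close>

type_synonym perm = "nat \<Rightarrow> nat"

abbreviation S2 :: "perm monoid" where "S2 \<equiv> sym_group 2"
abbreviation S4 :: "perm monoid" where "S4 \<equiv> sym_group 4"

definition pT :: perm where "pT = Transposition.transpose 1 2"
definition pa :: perm where "pa = Transposition.transpose 1 3 \<circ> Transposition.transpose 2 4"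
definition pb :: perm where "pb = Transposition.transpose 1 2"
definition pc :: perm where "pc = Transposition.transpose 3 4"
definition p23 :: perm where "p23 = Transposition.transpose 2 3"

definition D8 :: "perm monoid" where
  "D8 = S4\<lparr>carrier := generate S4 {pa, pb, pc}\<rparr>"

definition V4 :: "perm monoid" where
  "V4 = S4\<lparr>carrier := generate S4 {pa, pb \<circ> pc}\<rparr>"

definition xt :: "nat \<Rightarrow> perm list" where
  "xt k = map (\<lambda>i. pT ^^ i) [0..<Suc k]"

definition x_B :: "nat \<Rightarrow> perm list set chain" where
  "x_B k = proj S2 (cls (EG S2) k (xt k))"

text \<open>Steenrod's map; the only nondegenerate simplices of \<open>E\<Sigma>\<^sub>2\<close> are \<open>xt m\<close> and \<open>T \<cdot> xt m\<close>.\<close>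

definition AW_tilde ::
    "'a sset \<Rightarrow> (nat \<times> perm list) \<times> (nat \<times> 'a) \<Rightarrow> ((nat \<times> 'a) \<times> (nat \<times> 'a)) \<Rightarrow>\<^sub>0 bit" where
  "AW_tilde Y = (\<lambda>((m, w), z).
    if w = xt m then steenrod_gen Y m z
    else if w = translate S2 pT (xt m) then switch (steenrod_gen Y m z)
    else 0)"

text \<open>
  The identifications of vertices \<open>(T\<^sup>e, T\<^sup>f) \<mapsto> a\<^sup>e (bc)\<^sup>f\<close> and
  \<open>(T\<^sup>e, T\<^sup>f, T\<^sup>g) \<mapsto> c\<^sup>g b\<^sup>f a\<^sup>e\<close>.
\<close>

definition if_T :: "perm \<Rightarrow> perm \<Rightarrow> perm" where
  "if_T s h = (if s = pT then h else id)"

definition vertex_V4 :: "perm \<times> perm \<Rightarrow> perm" where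
  "vertex_V4 = (\<lambda>(s, t). if_T s pa \<circ> if_T t (pb \<circ> pc))"

definition vertex_D8 :: "perm \<times> perm \<times> perm \<Rightarrow> perm" where
  "vertex_D8 = (\<lambda>(s, t, w). if_T w pc \<circ> if_T t pb \<circ> if_T s pa)"

definition to_EV4 :: "perm list \<times> perm list \<Rightarrow> perm list" where
  "to_EV4 = (\<lambda>(us, vs). map vertex_V4 (zip us vs))"

definition from_EV4 :: "perm list \<Rightarrow> perm list \<times> perm list" where
  "from_EV4 gs =
    (let st = map (inv_into (carrier S2 \<times> carrier S2) vertex_V4) gs in (map fst st, map snd st))"

definition to_ED8 :: "perm list \<times> perm list \<times> perm list \<Rightarrow> perm list" where
  "to_ED8 = (\<lambda>(us, vs, ws). map vertex_D8 (zip us (zip vs ws)))"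

text \<open>
  \<open>x\<^sub>q \<times> x\<^sub>p\<close> in \<open>N\<^sub>*(BV\<^sub>4)\<close>: a pair of \<open>\<Sigma>\<^sub>2\<close>-orbits is identified with the \<open>V\<^sub>4\<close>-orbit consisting
  of all pairs of representatives.
\<close>

definition x_cross :: "nat \<Rightarrow> nat \<Rightarrow> perm list set chain" where
  "x_cross q p = push (\<lambda>(\<omega>, \<omega>'). to_EV4 ` (\<omega> \<times> \<omega>')) (BG V4)
    (lin (EZ (BG S2) (BG S2)) (tensor (x_B q) (x_B p)))"


section \<open>The homotopies\<close>

abbreviation ES2 :: "perm list sset" where "ES2 \<equiv> EG S2"

definition EZ3 :: "(nat \<times> perm list) \<times> (nat \<times> perm list) \<times> (nat \<times> perm list)
    \<Rightarrow> (perm list \<times> perm list \<times> perm list) chain" where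
  "EZ3 = (\<lambda>(x, yz). lin (\<lambda>w. EZ ES2 (ES2 \<times>\<^sub>s ES2) (x, w)) (EZ ES2 ES2 yz))"

definition Phi :: "(nat \<times> perm list) \<times> (nat \<times> perm list)
    \<Rightarrow> ((nat \<times> perm list) \<times> (nat \<times> perm list) \<times> (nat \<times> perm list)) \<Rightarrow>\<^sub>0 bit" where
  "Phi = (\<lambda>(x, y).
    lin (\<lambda>(x', x''). tensor (Poly_Mapping.single x' 1) (AW_tilde ES2 (x'', y))) (AW_diag ES2 x))"

definition Psi :: "perm list chain \<Rightarrow> perm list chain" where
  "Psi c = push to_ED8 (EG D8)
    (lin EZ3 (lin Phi (lin (AW ES2 ES2) (push from_EV4 (ES2 \<times>\<^sub>s ES2) c))))"

definition J_Psi :: "nat \<times> perm list \<Rightarrow> perm list chain" where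
  "J_Psi = (\<lambda>(k, gs).
    \<Sum>j\<le>k. join D8 (cls (EG D8) j (take (Suc j) gs)) (Psi (cls (EG V4) (k - j) (drop j gs))))"

definition J_23 :: "nat \<times> perm list \<Rightarrow> perm list chain" where
  "J_23 = (\<lambda>(k, gs).
    \<Sum>j\<le>k. cls (EG S4) (k + 1)
      (take (Suc j) gs @ map (\<lambda>h. h \<otimes>\<^bsub>S4\<^esub> m_inv S4 p23) (drop j gs)))"

definition J_Psi_bar :: "perm list set chain \<Rightarrow> perm list set chain" where
  "J_Psi_bar y = proj D8 (lin J_Psi (lift_chain V4 y))"

definition J_23_bar :: "perm list set chain \<Rightarrow> perm list set chain" where
  "J_23_bar y = proj S4 (lin J_23 (lift_chain S4 y))"


section \<open>Surjection sequences and table reduction\<close>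

definition surj_cls :: "nat \<Rightarrow> nat list \<Rightarrow> nat list \<Rightarrow>\<^sub>0 bit" where
  "surj_cls r A =
    (if set A = {1..r} \<and> distinct_adj A then Poly_Mapping.single A 1 else 0)"

text \<open>
  The \<open>j\<close>-th interval of a division \<open>ks\<close> is \<open>{ks ! j .. ks ! Suc j}\<close>; indices start at \<open>0\<close>, so
  that it carries the label \<open>A ! j\<close>.
\<close>

definition divisions :: "nat list \<Rightarrow> nat \<Rightarrow> nat list set" where
  "divisions A N = {ks. length ks = Suc (length A) \<and> sorted ks \<and> hd ks = 0 \<and> last ks = N \<and>
    (\<forall>i < length A. \<forall>j < length A. i \<noteq> j \<and> A ! i = A ! j \<longrightarrow>
      {ks ! i .. ks ! Suc i} \<inter> {ks ! j .. ks ! Suc j} = {})}"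

definition surj_act :: "'a sset \<Rightarrow> nat \<Rightarrow> nat list \<Rightarrow> (nat \<Rightarrow> 'a cochain) \<Rightarrow> 'a cochain" where
  "surj_act X r A \<alpha> N u =
    (\<Sum>ks \<in> divisions A N. \<Prod>l \<in> {1..r}.
      (let I = (\<Union>j \<in> {j. j < length A \<and> A ! j = l}. {ks ! j .. ks ! Suc j})
       in \<alpha> l (card I - 1) (face X N u I)))"

fun table_seq :: "nat list list \<Rightarrow> nat list \<Rightarrow> nat list" where
  "table_seq (row # rows) (a # as) =
    (let w = take a row
     in w @ table_seq (map (filter (\<lambda>v. v \<notin> set (butlast w))) rows) as)"
| "table_seq _ _ = []"

definition TR :: "nat \<Rightarrow> nat \<times> perm list \<Rightarrow> nat list \<Rightarrow>\<^sub>0 bit" where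
  "TR r = (\<lambda>(k, \<sigma>s).
    \<Sum>as \<in> {as. length as = Suc k \<and> (\<forall>a \<in> set as. 1 \<le> a) \<and> sum_list as = k + r}.
      surj_cls r (table_seq (map (\<lambda>\<sigma>. map \<sigma> [1..<Suc r]) \<sigma>s) as))"

text \<open>\<open>BS4_act X y \<alpha>\<close> is \<open>y(\<alpha>)\<close>.\<close>

definition BS4_act :: "'a sset \<Rightarrow> perm list set chain \<Rightarrow> 'a cochain \<Rightarrow> 'a cochain" where
  "BS4_act X y \<alpha> =
    (\<Sum>A \<in> Poly_Mapping.keys (lin (TR 4) (lift_chain S4 y)). surj_act X 4 A (\<lambda>_. \<alpha>))"


section \<open>The two sides of the relation\<close>

definition bin :: "int \<Rightarrow> int \<Rightarrow> bit" where
  "bin A B = (if 0 \<le> B \<and> B \<le> A then of_nat (nat A choose nat B) else 0)"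

definition adem_sum :: "'a sset \<Rightarrow> int \<Rightarrow> int \<Rightarrow> int \<Rightarrow> 'a cochain \<Rightarrow> 'a cochain" where
  "adem_sum X q p n \<alpha> =
    (\<Sum>l \<in> {l. 0 \<le> l \<and> 2 * l \<le> q \<and> p - q + 2 * l \<ge> 0}.
      scale (bin (q - l) (q - 2 * l))
        (Sq X (2 * n - q + l) (2 * n - p - l) (Sq X n (n - q + l) \<alpha>)))"

text \<open>
  The indices \<open>\<ell>, a \<in> \<onehalf>\<int>\<close> are represented by the integers \<open>L = 2\<ell>\<close> and \<open>A = 2a\<close>, so that
  \<open>\<ell> + a\<close> and \<open>\<ell> - a\<close> are the integers \<open>(L + A) div 2\<close> and \<open>(L - A) div 2\<close>.
\<close>

definition N_cochain :: "'a sset \<Rightarrow> int \<Rightarrow> int \<Rightarrow> int \<Rightarrow> 'a cochain \<Rightarrow> 'a cochain" where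
  "N_cochain X q p n \<alpha> =
    (\<Sum>(L, A) \<in> {(L, A). 0 < A \<and> A \<le> L \<and> L \<le> p \<and> even (L - A) \<and> q - p + L \<ge> 0}.
      scale (bin (p - (L + A) div 2) (p - L) * bin (p - (L - A) div 2) (p - L))
        (cup X (nat (q - p + L + 1))
          (Sq X n (n - p + (L + A) div 2) \<alpha>)
          (Sq X n (n - p + (L - A) div 2) \<alpha>)))"

end

theory Submission
  imports Defs
begin

text \<open>
  Evaluating the cochain \<open>TR(g\<^sub>0, \<dots>, g\<^sub>k)(\<alpha>\<^sup>\<otimes>\<^sup>4)\<close> at a simplex \<open>u\<close> gives a functional on vertex sequences, and
  since \<open>\<alpha>\<close> is a cocycle, its coboundary in \<open>u\<close> is its boundary in the \<open>g\<^sub>i\<close>. The homotopy \<open>J\<^sub>\<Psi>\<close> connects the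
  inclusion of \<open>V\<^sub>4\<close> with \<open>\<Psi>\<close>, and \<open>J\<^sub>(\<^sub>2\<^sub>3\<^sub>)\<close> connects the identity with right multiplication by \<open>(23)\<close>, which
  exchanges \<open>x\<^sub>q \<times> x\<^sub>p\<close> and \<open>x\<^sub>p \<times> x\<^sub>q\<close>. As the boundary of \<open>x\<^sub>q \<times> x\<^sub>p\<close> vanishes in the coinvariants, the coboundary of
  the three homotopies is the value of \<open>\<Psi>(x\<^sub>q \<times> x\<^sub>p) + \<Psi>(x\<^sub>p \<times> x\<^sub>q)\<close> on \<open>\<alpha>\<close>.

  Because \<open>AW \<circ> EZ\<close> is the identity, \<open>\<Psi>(x\<^sub>q \<times> x\<^sub>p)\<close> is the image under \<open>EZ\<close> of \<open>\<Phi>(x\<^sub>q \<otimes> x\<^sub>p)\<close>, that is, the sum over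
  \<open>i \<le> q\<close> and \<open>j + k = p + m\<close>, where \<open>m = q - i\<close>, of \<open>(j choose m) (k choose m) x\<^sub>i \<times> x\<^sub>j \<times> x\<^sub>k\<close>. Table reduction of such a
  product is an operadic composite, so it acts as \<open>(\<alpha> \<smile>\<^sub>j \<alpha>) \<smile>\<^sub>i (\<alpha> \<smile>\<^sub>k \<alpha>)\<close>. The terms with \<open>j = k\<close> form the Adem sum,
  and those for \<open>(j, k)\<close> and \<open>(k, j)\<close> add up to the coboundary of \<open>(\<alpha> \<smile>\<^sub>j \<alpha>) \<smile>\<^sub>i\<^sub>+\<^sub>1 (\<alpha> \<smile>\<^sub>k \<alpha>)\<close>, a term of \<open>N\<^sub>q\<^sub>,\<^sub>p\<^sub>,\<^sub>n\<close>.
\<close>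

text \<open>Elements of \<open>D8\<close> preserve the partition of {1,2,3,4} into {1,2} and {3,4}:
  in the row of c^t b^s a^r the bits s and t order the letters inside the blocks and r orders the
  blocks. In the coordinates (r, s, t) the subgroup \<open>V4\<close> is the diagonal of all (e, f,
  f). The map \<open>Psi\<close> replaces this diagonal by Steenrod's refinement of it, which
  separates the two inner coordinates; only then does table reduction become an iterated cup
  product. Left multiplication is invisible in the coinvariants, and conjugation by (23) exchanges a
  and bc. This is why right multiplication by (23) exchanges the two factors. The coefficients (j
  choose m)(k choose m) count, mod 2, the divisions of an alternating sequence whose two parts
  alternate again. For j = k a bit equals its square, so one binomial coefficient remains, the one
  in the Adem relation. Functionals are defined on all lists, including the empty and the degenerate
  ones. The price is an augmented boundary: corrections appear at lists of length one, and some
  chain map formulas ask for the value 0 at \<open>[]\<close>.\<close>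

lemma bit_add_self: "(a::bit) + a = 0"
  by (cases a) simp_all

text \<open>Sums and products of bits have to keep their ring form, since the cancellations below
  are ring identities in characteristic 2.\<close>

declare add_bit_eq_xor [simp del] mult_bit_eq_and [simp del]

lemma bit_add_left_self: "(a::bit) + (a + b) = b"
  by (simp add: bit_add_self flip: add.assoc)

lemmas bit_cancel = bit_add_self bit_add_left_self add.assoc add.commute add.left_commute

section \<open>Vertex sequences, lattice paths and tables\<close>

fun faces :: "'a list \<Rightarrow> 'a list list" where
  "faces [] = []"
| "faces (x # xs) = xs # map ((#) x) (faces xs)"

text \<open>A one-element list has the face \<open>[]\<close>, so \<open>bd f [x] = f []\<close>:
  this is dual to the augmented boundary.\<close>

definition bd :: "('a list \<Rightarrow> bit) \<Rightarrow> 'a list \<Rightarrow> bit" where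
  "bd f xs = (\<Sum>ys\<leftarrow>faces xs. f ys)"

text \<open>
  Chains on \<open>EG\<close> are studied through functionals on vertex sequences. By linearity over \<open>\<F>\<^sub>2\<close> such
  a functional descends to normalized chains iff it is \<open>normal\<close>; \<open>bd\<close> is the dual of the boundary.
\<close>

definition normal :: "('a list \<Rightarrow> bit) \<Rightarrow> bool" where
  "normal f \<longleftrightarrow> (\<forall>xs. \<not> distinct_adj xs \<longrightarrow> f xs = 0)"

lemma normalD: "normal f \<Longrightarrow> \<not> distinct_adj xs \<Longrightarrow> f xs = 0"
  by (simp add: normal_def)

lemma not_distinct_adj_Cons: "\<not> distinct_adj xs \<Longrightarrow> \<not> distinct_adj (x # xs)"
  by (cases xs) auto

lemma normal_Cons: "normal f \<Longrightarrow> normal (\<lambda>xs. f (x # xs))"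
  by (auto simp: normal_def not_distinct_adj_Cons)

lemma bd_Nil [simp]: "bd f [] = 0"
  by (simp add: bd_def)

lemma bd_Cons [simp]: "bd f (x # xs) = f xs + bd (\<lambda>ys. f (x # ys)) xs"
  by (simp add: bd_def o_def)

lemma bd_zero [simp]: "bd (\<lambda>_. 0) xs = 0"
  by (induction xs) auto

lemma bd_add: "bd (\<lambda>ys. f ys + g ys) xs = bd f xs + bd g xs"
  by (induction xs arbitrary: f g) (simp_all add: add.assoc add.commute add.left_commute)

lemma bd_mult_right: "bd (\<lambda>ys. f ys * c) xs = bd f xs * c"
  by (induction xs arbitrary: f) (simp_all add: algebra_simps)

lemma bd_sum_list: "bd (\<lambda>ys. \<Sum>a\<leftarrow>as. f a ys) xs = (\<Sum>a\<leftarrow>as. bd (f a) xs)"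
  by (induction as) (simp_all add: bd_add)

lemma bd_cong: "(\<And>ys. ys \<in> set (faces xs) \<Longrightarrow> f ys = g ys) \<Longrightarrow> bd f xs = bd g xs"
  unfolding bd_def by (metis map_cong)

lemma faces_map: "faces (map h xs) = map (map h) (faces xs)"
  by (induction xs) auto

lemma bd_map: "bd f (map h xs) = bd (\<lambda>ys. f (map h ys)) xs"
  by (simp add: bd_def faces_map o_def)

lemma length_faces: "ys \<in> set (faces xs) \<Longrightarrow> length xs = Suc (length ys)"
  by (induction xs arbitrary: ys) auto

lemma set_faces: "ys \<in> set (faces xs) \<Longrightarrow> set ys \<subseteq> set xs"
  by (induction xs arbitrary: ys) fastforce+

lemma sorted_faces: "ys \<in> set (faces xs) \<Longrightarrow> sorted xs \<Longrightarrow> sorted ys"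
  by (induction xs arbitrary: ys) (fastforce dest: set_faces)+

lemma bd_if_Nil: "bd (\<lambda>ys. if ys = [] \<and> P then c else 0) xs = (if length xs = 1 \<and> P then c else 0)"
  by (cases xs) auto

text \<open>
  The maximal chains of a grid whose two sides are labelled by the lists. Read with \<open>A\<close> as a word and
  \<open>L\<close> as vertices, these are also the divisions of \<open>L\<close> into intervals labelled by the letters of \<open>A\<close>,
  so that Eilenberg--Zilber maps and surjection operations are instances of one construction.
\<close>

fun shuf :: "'a list \<Rightarrow> 'b list \<Rightarrow> ('a \<times> 'b) list list" where
  "shuf [] L = []"
| "shuf A [] = []"
| "shuf (x # xs) (y # ys) = map ((#) (x, y))
     ((if xs = [] \<and> ys = [] then [[]] else []) @ shuf xs (y # ys) @ shuf (x # xs) ys)"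

lemma shuf_Nil_right [simp]: "shuf A [] = []"
  by (cases A) auto

declare shuf.simps(3) [simp del]

lemma sum_shuf_Cons:
  "(\<Sum>p\<leftarrow>shuf (x # xs) (y # ys). f p) = (if xs = [] \<and> ys = [] then f [(x, y)] else 0)
    + (\<Sum>p\<leftarrow>shuf xs (y # ys). f ((x, y) # p)) + (\<Sum>p\<leftarrow>shuf (x # xs) ys. f ((x, y) # p))"
  by (simp add: shuf.simps(3) o_def)

lemma set_shuf_Cons:
  "set (shuf (x # xs) (y # ys)) = (#) (x, y) `
     ((if xs = [] \<and> ys = [] then {[]} else {}) \<union> set (shuf xs (y # ys)) \<union> set (shuf (x # xs) ys))"
  by (auto simp add: shuf.simps(3))

text \<open>The Leibniz rule for the Eilenberg-Zilber map. Deleting the corner of a path cancels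
  against the path that goes round the other side of the same square; deleting a vertex on a
  straight piece is a face of one factor. For two single vertices the left side is the augmentation,
  while the right side loses it because \<open>shuf\<close> is empty on \<open>[]\<close>; hence the
  last summand.\<close>

lemma shuf_bd:
  "(\<Sum>p\<leftarrow>shuf A L. bd f p) = bd (\<lambda>A. \<Sum>p\<leftarrow>shuf A L. f p) A + bd (\<lambda>L. \<Sum>p\<leftarrow>shuf A L. f p) L
    + (if length A = 1 \<and> length L = 1 then f [] else 0)"
proof (induction A L arbitrary: f rule: shuf.induct)
  case (3 x xs y ys)
  show ?case
    by (simp add: sum_shuf_Cons[where f = "bd f"] sum_list_addf 3 bd_add)
       (cases xs; cases ys; simp add: sum_shuf_Cons bd_add bd_if_Nil bit_cancel)
qed simp_all

lemma shuf_not_Nil: "p \<in> set (shuf A L) \<Longrightarrow> p \<noteq> []"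
  by (cases A; cases L) (auto simp: set_shuf_Cons)

lemma shuf_hd: "p \<in> set (shuf A L) \<Longrightarrow> hd p = (hd A, hd L)"
  by (cases A; cases L) (auto simp: set_shuf_Cons)

text \<open>A step of a lattice path changes the position in one side only. Where it crosses between
  two equal neighbours of that side, the path repeats an entry.\<close>

lemma shuf_distinct_adj:
  "p \<in> set (shuf A L) \<Longrightarrow> distinct_adj p \<Longrightarrow> distinct_adj A \<and> distinct_adj L"
proof (induction A L arbitrary: p rule: shuf.induct)
  case (3 x xs y ys)
  from 3(3) obtain q where p: "p = (x, y) # q"
    and q: "(xs = [] \<and> ys = [] \<and> q = []) \<or> q \<in> set (shuf xs (y # ys)) \<or> q \<in> set (shuf (x # xs) ys)"
    by (auto simp: set_shuf_Cons split: if_splits)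
  have dq: "distinct_adj q"
    using 3(4) not_distinct_adj_Cons[of q] by (auto simp: p)
  from q consider "xs = [] \<and> ys = [] \<and> q = []" | "q \<in> set (shuf xs (y # ys))" | "q \<in> set (shuf (x # xs) ys)"
    by blast
  then show ?case
  proof cases
    case 2
    then have "hd q = (hd xs, y)" "q \<noteq> []" "xs \<noteq> []"
      using shuf_hd shuf_not_Nil by fastforce+
    then show ?thesis
      using 3(1)[OF 2 dq] 3(4) p by (cases q; cases xs) auto
  next
    case 3
    then have "hd q = (x, hd ys)" "q \<noteq> []" "ys \<noteq> []"
      using shuf_hd shuf_not_Nil by fastforce+
    then show ?thesis
      using "3.IH"(2)[OF 3 dq] \<open>distinct_adj p\<close> p by (cases q; cases ys) auto
  qed auto
qed auto

lemma normal_shuf: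
  assumes "normal f"
  shows "normal (\<lambda>A. \<Sum>p\<leftarrow>shuf A L. f p)" "normal (\<lambda>L. \<Sum>p\<leftarrow>shuf A L. f p)"
proof -
  have "(\<Sum>p\<leftarrow>shuf A L. f p) = 0" if "\<not> distinct_adj A \<or> \<not> distinct_adj L" for A L
    using that shuf_distinct_adj[of _ A L] normalD[OF assms]
    by (metis (mono_tags, lifting) map_eq_conv sum_list_0)
  then show "normal (\<lambda>A. \<Sum>p\<leftarrow>shuf A L. f p)" "normal (\<lambda>L. \<Sum>p\<leftarrow>shuf A L. f p)"
    by (auto simp: normal_def)
qed

lemma shuf_map: "shuf (map g A) (map h L) = map (map (map_prod g h)) (shuf A L)"
  by (induction A L rule: shuf.induct) (auto simp: shuf.simps(3))

lemma sum_shuf_swap: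
  fixes f :: "_ \<Rightarrow> 'c::comm_monoid_add"
  shows "(\<Sum>p\<leftarrow>shuf A L. f p) = (\<Sum>p\<leftarrow>shuf L A. f (map prod.swap p))"
  by (induction A L arbitrary: f rule: shuf.induct) (simp_all add: sum_shuf_Cons add.assoc add.commute add.left_commute)

lemma length_shuf: "p \<in> set (shuf A L) \<Longrightarrow> Suc (length p) = length A + length L"
  by (induction A L arbitrary: p rule: shuf.induct) (auto simp: set_shuf_Cons split: if_splits)

lemma shuf_ConsE:
  assumes "p \<in> set (shuf (x # xs) (y # ys))"
  obtains q where "p = (x, y) # q"
    "xs = [] \<and> ys = [] \<and> q = [] \<or> q \<in> set (shuf xs (y # ys)) \<or> q \<in> set (shuf (x # xs) ys)"
  using assms by (auto simp: set_shuf_Cons split: if_splits)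

lemma fst_snd_shuf: "p \<in> set (shuf A L) \<Longrightarrow> fst ` set p = set A \<and> snd ` set p = set L"
proof (induction A L arbitrary: p rule: shuf.induct)
  case (3 x xs y ys)
  from 3(3) obtain q where "p = (x, y) # q" and
    "xs = [] \<and> ys = [] \<and> q = [] \<or> q \<in> set (shuf xs (y # ys)) \<or> q \<in> set (shuf (x # xs) ys)"
    by (rule shuf_ConsE)
  then show ?case
    using 3(1)[of q] 3(2)[of q] by (elim disjE) auto
qed simp_all

lemmas fst_shuf = fst_snd_shuf[THEN conjunct1] and snd_shuf = fst_snd_shuf[THEN conjunct2]

lemma sorted_snd_shuf: "p \<in> set (shuf A L) \<Longrightarrow> sorted L \<Longrightarrow> sorted (map snd p)"
proof (induction A L arbitrary: p rule: shuf.induct)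
  case (3 x xs y ys)
  then show ?case
    using snd_shuf[of _ xs "y # ys"] snd_shuf[of _ "x # xs" ys]
    by (fastforce simp: set_shuf_Cons split: if_splits)
qed simp_all

text \<open>For a path read as a division into labelled intervals this is the vertex list of I(l).
  An endpoint shared by neighbouring intervals stands in the path once for each of them, so
  intervals with equal label that meet show up as a repeated vertex.\<close>

definition coll :: "'a \<Rightarrow> ('a \<times> 'b) list \<Rightarrow> 'b list" where
  "coll l p = map snd (filter (\<lambda>z. fst z = l) p)"

lemma coll_Nil [simp]: "coll l [] = []"
  by (simp add: coll_def)

lemma coll_Cons [simp]: "coll l ((k, v) # p) = (if k = l then v # coll l p else coll l p)"
  by (simp add: coll_def)

lemma coll_eq_Nil: "coll l p = [] \<longleftrightarrow> l \<notin> fst ` set p"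
  by (auto simp: coll_def filter_empty_conv)

lemma set_coll: "set (coll l p) \<subseteq> snd ` set p"
  by (auto simp: coll_def)

lemma sorted_coll: "sorted (map snd p) \<Longrightarrow> sorted (coll l p)"
  by (simp add: coll_def sorted_filter)

text \<open>Equal neighbours carry the same label and remain neighbours when the entries with that
  label are collected.\<close>

lemma coll_not_distinct_adj: "\<not> distinct_adj p \<Longrightarrow> \<exists>l \<in> fst ` set p. \<not> distinct_adj (coll l p)"
proof (induction p)
  case (Cons z p)
  show ?case
  proof (cases "distinct_adj p")
    case True
    then obtain q where "p = z # q"
      using Cons.prems by (cases p) auto
    then show ?thesis
      by (cases z) auto
  next
    case False
    then obtain l where "l \<in> fst ` set p" "\<not> distinct_adj (coll l p)"
      using Cons.IH by blast
    then show ?thesis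
      using not_distinct_adj_Cons[of "coll l p"] by (intro bexI[of _ l]) (cases z; auto)+
  qed
qed simp

text \<open>Deleting an entry of the path deletes an entry from exactly one of the collected
  lists.\<close>

lemma bd_coll:
  assumes "finite Ls" "fst ` set p \<subseteq> Ls"
  shows "bd (\<lambda>p. G (\<lambda>l. coll l p)) p = (\<Sum>l\<in>Ls. bd (\<lambda>c. G ((\<lambda>l. coll l p)(l := c))) (coll l p))"
  using assms(2)
proof (induction p arbitrary: G)
  case (Cons z p)
  obtain k v where z: "z = (k, v)"
    by fastforce
  have k: "k \<in> Ls"
    using Cons.prems z by auto
  let ?t = "\<lambda>l. coll l p"
  let ?G = "\<lambda>t. G (t(k := v # t k))"
  have eq: "(\<lambda>l. coll l ((k, v) # q)) = (\<lambda>l. coll l q)(k := v # coll k q)" for q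
    by auto
  have "bd (\<lambda>p. G (\<lambda>l. coll l p)) (z # p) = G ?t + bd (\<lambda>p. ?G (\<lambda>l. coll l p)) p"
    by (simp add: z eq del: coll_Cons)
  also have "bd (\<lambda>p. ?G (\<lambda>l. coll l p)) p = (\<Sum>l\<in>Ls. bd (\<lambda>c. ?G (?t(l := c))) (?t l))"
    using Cons.prems by (intro Cons.IH) auto
  also have "\<dots> = bd (\<lambda>c. ?G (?t(k := c))) (?t k) + (\<Sum>l\<in>Ls - {k}. bd (\<lambda>c. ?G (?t(l := c))) (?t l))"
    using k assms(1) by (rule sum.remove[rotated])
  also have "(\<Sum>l\<in>Ls - {k}. bd (\<lambda>c. ?G (?t(l := c))) (?t l))
      = (\<Sum>l\<in>Ls - {k}. bd (\<lambda>c. G ((\<lambda>l. coll l (z # p))(l := c))) (coll l (z # p)))"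
    unfolding z eq by (intro sum.cong refl) (auto simp: fun_upd_twist)
  also have "G ?t + (bd (\<lambda>c. ?G (?t(k := c))) (?t k) + \<dots>) =
     (\<Sum>l\<in>Ls. bd (\<lambda>c. G ((\<lambda>l. coll l (z # p))(l := c))) (coll l (z # p)))"
    unfolding z eq sum.remove[OF assms(1) k] by (simp add: add.assoc fun_upd_idem)
  finally show ?case .
qed simp

lemma bd_prod_coll:
  assumes "finite Ls" "fst ` set p \<subseteq> Ls" "\<And>l c. l \<in> Ls \<Longrightarrow> bd (\<phi> l) c = 0"
  shows "bd (\<lambda>p. \<Prod>l\<in>Ls. \<phi> l (coll l p)) p = 0"
proof -
  have "bd (\<lambda>c. \<Prod>k\<in>Ls. \<phi> k (((\<lambda>l. coll l p)(l := c)) k)) (coll l p) = 0" if "l \<in> Ls" for l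
  proof -
    have "(\<Prod>k\<in>Ls. \<phi> k (((\<lambda>l. coll l p)(l := c)) k)) = \<phi> l c * (\<Prod>k\<in>Ls - {l}. \<phi> k (coll k p))" for c
      by (subst prod.remove[OF assms(1) that]) (auto intro!: prod.cong arg_cong2[where f = "(*)"])
    then show ?thesis
      using assms(3)[OF that] by (simp add: bd_mult_right)
  qed
  then show ?thesis
    by (subst bd_coll[OF assms(1,2), of "\<lambda>t. \<Prod>l\<in>Ls. \<phi> l (t l)"]) simp
qed

text \<open>
  Table reduction without bookkeeping of the numbers \<open>a\<^sub>i\<close>: the letter \<open>x\<close> is either the last one read
  in its row, or it is not and is deleted from the lower rows.
\<close>

function (sequential) tabs :: "'a list list \<Rightarrow> 'a list list" where
  "tabs [] = []"
| "tabs ([] # T) = (if T = [] then [[]] else [])"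
| "tabs ((x # r) # T) = map ((#) x) (tabs T @ tabs (r # map (removeAll x) T))"
  by pat_completeness auto
termination
proof (relation "measure (\<lambda>T. \<Sum>r\<leftarrow>T. Suc (length r))", goal_cases)
  case (3 x r T)
  have "(\<Sum>r\<leftarrow>map (removeAll x) T. Suc (length r)) \<le> (\<Sum>r\<leftarrow>T. Suc (length r))"
    by (simp add: o_def sum_list_mono length_removeAll_less_eq)
  then show ?case
    by (simp add: o_def)
qed simp_all

declare tabs.simps(3) [simp del]

lemma sum_tabs_Cons:
  "(\<Sum>w\<leftarrow>tabs ((x # r) # T). f w) =
    (\<Sum>w\<leftarrow>tabs T. f (x # w)) + (\<Sum>w\<leftarrow>tabs (r # map (removeAll x) T). f (x # w))"
  by (simp add: tabs.simps(3) o_def)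

lemma set_tabs_Cons:
  "set (tabs ((x # r) # T)) = (#) x ` (set (tabs T) \<union> set (tabs (r # map (removeAll x) T)))"
  by (auto simp: tabs.simps(3))

text \<open>Table reduction is a chain map up to the last sum: faces of words are matched with
  deletions of rows. In the last sum one value is missing from all rows, so its words are not
  surjective and vanish in the surjection complex.\<close>

lemma tabs_bd:
  assumes "\<And>r. r \<in> set T \<Longrightarrow> distinct r \<and> set r = S" "finite S"
  shows "(\<Sum>w\<leftarrow>tabs T. bd f w) = bd (\<lambda>T. \<Sum>w\<leftarrow>tabs T. f w) T
    + (\<Sum>x\<in>S. \<Sum>w\<leftarrow>tabs (map (removeAll x) T). f w)"
  using assms
proof (induction T arbitrary: f S rule: tabs.induct)
  case (2 T)
  then have S: "S = {}"
    by force
  then have "T = replicate (length T) []"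
    using 2(1) by (intro replicate_eqI) auto
  then obtain n where n: "T = replicate n []"
    by blast
  have z: "bd (\<lambda>U. \<Sum>w\<leftarrow>tabs ([] # U). f w) (replicate n []) = (if n = 1 then f [] else 0)" for n
    using bd_if_Nil[of True "f []" "replicate n []"] by (simp add: if_distrib[of "\<lambda>x. sum_list (map f x)"] cong: if_cong)
  have "(\<Sum>w\<leftarrow>tabs (replicate n []). f w) = (if n = 1 then f [] else 0)" for n
    by (cases n) auto
  then show ?case
    using z by (simp add: S n)
next
  case (3 x r T)
  have dr: "distinct r" "x \<notin> set r" and S: "S = insert x (set r)"
    using "3.prems"(1)[of "x # r"] by auto
  have T: "distinct s" "set s = S" if "s \<in> set T" for s
    using "3.prems" that by auto
  let ?g = "\<lambda>w. f (x # w)"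
  have IH1: "(\<Sum>w\<leftarrow>tabs T. bd ?g w) = bd (\<lambda>T. \<Sum>w\<leftarrow>tabs T. ?g w) T
    + (\<Sum>x\<in>S. \<Sum>w\<leftarrow>tabs (map (removeAll x) T). ?g w)"
    using "3.prems" by (intro "3.IH"(1)) auto
  have IH2: "(\<Sum>w\<leftarrow>tabs (r # map (removeAll x) T). bd ?g w) =
    bd (\<lambda>T. \<Sum>w\<leftarrow>tabs T. ?g w) (r # map (removeAll x) T)
    + (\<Sum>y\<in>set r. \<Sum>w\<leftarrow>tabs (map (removeAll y) (r # map (removeAll x) T)). ?g w)"
    using dr T S by (intro "3.IH"(2)) (auto simp: distinct_removeAll)
  have rem: "removeAll x (x # r) = r"
    using dr by simp
  have "(\<Sum>y\<in>S. \<Sum>w\<leftarrow>tabs (map (removeAll y) ((x # r) # T)). f w) =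
     (\<Sum>w\<leftarrow>tabs (r # map (removeAll x) T). f w) +
     (\<Sum>y\<in>set r. \<Sum>w\<leftarrow>tabs ((x # removeAll y r) # map (removeAll y) T). f w)"
    unfolding S using dr by (subst sum.insert) (auto intro!: sum.cong)
  also have "(\<Sum>y\<in>set r. \<Sum>w\<leftarrow>tabs ((x # removeAll y r) # map (removeAll y) T). f w) =
     (\<Sum>y\<in>set r. \<Sum>w\<leftarrow>tabs (map (removeAll y) T). ?g w) +
     (\<Sum>y\<in>set r. \<Sum>w\<leftarrow>tabs (map (removeAll y) (r # map (removeAll x) T)). ?g w)"
    by (simp add: sum_tabs_Cons sum.distrib o_def removeAll_commute)
  finally have R: "(\<Sum>y\<in>S. \<Sum>w\<leftarrow>tabs (map (removeAll y) ((x # r) # T)). f w) =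
     (\<Sum>w\<leftarrow>tabs (r # map (removeAll x) T). f w) +
     ((\<Sum>y\<in>set r. \<Sum>w\<leftarrow>tabs (map (removeAll y) T). ?g w) +
     (\<Sum>y\<in>set r. \<Sum>w\<leftarrow>tabs (map (removeAll y) (r # map (removeAll x) T)). ?g w))" .
  have S1: "(\<Sum>y\<in>S. \<Sum>w\<leftarrow>tabs (map (removeAll y) T). ?g w) = (\<Sum>w\<leftarrow>tabs (map (removeAll x) T). ?g w) +
      (\<Sum>y\<in>set r. \<Sum>w\<leftarrow>tabs (map (removeAll y) T). ?g w)"
    unfolding S using dr by (subst sum.insert) auto
  show ?case
    unfolding R
    by (simp add: sum_tabs_Cons[where f = "bd f"] sum_list_addf IH1 IH2 S1 bd_add)
       (simp add: sum_tabs_Cons bd_add bd_map bit_cancel)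
qed simp

lemma tabs_hd: "w \<in> set (tabs ((x # r) # T)) \<Longrightarrow> \<exists>v. w = x # v"
  by (auto simp: set_tabs_Cons)

text \<open>The last letter read from a row survives in the rows below. If the next row is equal,
  what remains of it begins with this very letter, and the word repeats it.\<close>

lemma tabs_distinct_adj:
  "w \<in> set (tabs T) \<Longrightarrow> distinct_adj w \<Longrightarrow> (\<And>r. r \<in> set T \<Longrightarrow> distinct r) \<Longrightarrow> distinct_adj T"
proof (induction T arbitrary: w rule: tabs.induct)
  case (3 x r T)
  from 3(3) obtain v where w: "w = x # v" and v: "v \<in> set (tabs T) \<or> v \<in> set (tabs (r # map (removeAll x) T))"
    by (auto simp: set_tabs_Cons)
  have dv: "distinct_adj v"
    using 3(4) not_distinct_adj_Cons[of v] by (auto simp: w)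
  have dr: "distinct r" "x \<notin> set r" "\<And>s. s \<in> set T \<Longrightarrow> distinct s"
    using "3.prems"(3)[of "x # r"] "3.prems"(3) by auto
  from v show ?case
  proof
    assume vT: "v \<in> set (tabs T)"
    then have "distinct_adj T"
      using "3.IH"(1)[OF vT dv] dr by simp
    moreover have "T = (x # r) # U \<Longrightarrow> False" for U
      using vT tabs_hd[of v x r U] "3.prems"(2) w by auto
    ultimately show ?thesis
      by (cases T) auto
  next
    assume vT: "v \<in> set (tabs (r # map (removeAll x) T))"
    have *: "distinct_adj (r # map (removeAll x) T)"
      by (rule "3.IH"(2)[OF vT dv]) (use dr in \<open>auto simp: distinct_removeAll\<close>)
    then have "distinct_adj (map (removeAll x) T)"
      by (cases T) auto
    then have "distinct_adj T"
      by (rule distinct_adj_mapD)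
    moreover have "T = (x # r) # U \<Longrightarrow> False" for U
      using * dr by simp
    ultimately show ?thesis
      by (cases T) auto
  qed
qed (auto split: if_splits)

declare One_nat_def [simp del]

section \<open>The homotopies on functionals\<close>

definition D2 :: "('a list \<Rightarrow> 'b list \<Rightarrow> bit) \<Rightarrow> 'a list \<Rightarrow> 'b list \<Rightarrow> bit" where
  "D2 g a b = bd (\<lambda>a. g a b) a + bd (g a) b"

definition normal2 :: "('a list \<Rightarrow> 'b list \<Rightarrow> bit) \<Rightarrow> bool" where
  "normal2 g \<longleftrightarrow> (\<forall>a b. \<not> distinct_adj a \<or> \<not> distinct_adj b \<longrightarrow> g a b = 0)"

lemma bd_coll2:
  assumes "fst ` set p \<subseteq> {1, 2 :: nat}"
  shows "bd (\<lambda>p. G (coll 1 p) (coll 2 p)) p = D2 G (coll 1 p) (coll 2 p)"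
  using bd_coll[OF _ assms, of "\<lambda>t. G (t 1) (t 2)"] by (simp add: D2_def)

text \<open>The dual of the Alexander-Whitney diagonal: the sum over all vertices of
  \<open>L\<close> of \<open>g\<close> at the front and the back face, the chosen vertex belonging
  to both.\<close>

fun cut :: "('a list \<Rightarrow> 'a list \<Rightarrow> bit) \<Rightarrow> 'a list \<Rightarrow> bit" where
  "cut g [] = 0"
| "cut g (x # xs) = g [x] (x # xs) + cut (\<lambda>a. g (x # a)) xs"

lemma cut_zero [simp]: "cut (\<lambda>_ _. 0) L = 0"
  by (induction L) simp_all

lemma cut_add: "cut (\<lambda>a b. g a b + h a b) L = cut g L + cut h L"
  by (induction L arbitrary: g h) (simp_all add: bit_cancel)

lemma cut_bd_param: "cut (\<lambda>a b. bd (g a b) y) L = bd (\<lambda>y. cut (\<lambda>a b. g a b y) L) y"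
  by (induction L arbitrary: g) (simp_all add: bd_add)

lemma cut_cong:
  "(\<And>a b. a \<noteq> [] \<Longrightarrow> b \<noteq> [] \<Longrightarrow> length a + length b = Suc (length L) \<Longrightarrow> g a b = h a b) \<Longrightarrow> cut g L = cut h L"
proof (induction L arbitrary: g h)
  case (Cons x L)
  have "cut (\<lambda>a. g (x # a)) L = cut (\<lambda>a. h (x # a)) L"
    by (rule Cons.IH) (simp add: Cons.prems)
  then show ?case
    by (simp add: Cons.prems)
qed simp

lemma cut_map: "cut g (map f L) = cut (\<lambda>a b. g (map f a) (map f b)) L"
  by (induction L arbitrary: g) simp_all

text \<open>Inner deletions at the cut vertex cancel between consecutive cuts. The two outer ones
  remain because the boundary is augmented: a front or back face consisting of one vertex has the
  face \<open>[]\<close>.\<close>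

lemma cut_bd: "cut (D2 g) L = bd (cut g) L + (if L = [] then 0 else g [] L + g L [])"
proof (induction L arbitrary: g)
  case (Cons x xs)
  have "cut (\<lambda>a. D2 g (x # a)) xs = cut g xs + cut (D2 (\<lambda>a. g (x # a))) xs"
    by (simp add: D2_def[abs_def] cut_add add.assoc)
  then show ?case
    by (cases "xs = []") (simp_all add: Cons.IH D2_def[of g "[x]"] bd_add bit_cancel)
qed simp

text \<open>The cut vertex lies on both sides, so two equal neighbours always stand together on one
  of them.\<close>

lemma normal_cut: "normal2 g \<Longrightarrow> normal (cut g)"
proof -
  have "cut g L = 0" if "\<not> distinct_adj L" "normal2 g" for L :: "'a list" and g
    using that
  proof (induction L arbitrary: g)
    case (Cons x xs)
    have n: "normal2 (\<lambda>a. g (x # a))"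
      using Cons.prems(2) not_distinct_adj_Cons[of _ x] unfolding normal2_def by blast
    have 0: "g [x] (x # xs) = 0"
      using Cons.prems by (simp add: normal2_def)
    show ?case
    proof (cases "distinct_adj xs")
      case False
      then show ?thesis
        using Cons.IH[OF False n] 0 by simp
    next
      case True
      then obtain ys where xs: "xs = x # ys"
        using Cons.prems(1) by (cases xs) auto
      have z: "g (x # x # zs) b = 0" for zs b
        using Cons.prems(2) by (simp add: normal2_def)
      then have "(\<lambda>a. g (x # x # a)) = (\<lambda>_ _. 0)"
        by (intro ext)
      then show ?thesis
        using 0 by (simp add: xs z)
    qed
  qed simp
  then show "normal2 g \<Longrightarrow> normal (cut g)"
    by (simp add: normal_def)
qed

definition row2 :: "bool \<Rightarrow> nat list" where
  "row2 b = (if b then [2, 1] else [1, 2])"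

text \<open>
  Steenrod's map is table reduction for \<open>\<Sigma>\<^sub>2\<close>, which gives it the same shape as the action of
  \<open>N\<^sub>*(B\<Sigma>\<^sub>4)\<close>. The bit \<open>True\<close> stands for \<open>T\<close>.
\<close>

definition sq :: "('a list \<Rightarrow> 'a list \<Rightarrow> bit) \<Rightarrow> bool list \<Rightarrow> 'a list \<Rightarrow> bit" where
  "sq G x ys = (\<Sum>w\<leftarrow>tabs (map row2 x). \<Sum>r\<leftarrow>shuf w ys. G (coll 1 r) (coll 2 r))"

lemma set_tabs: "w \<in> set (tabs T) \<Longrightarrow> set w \<subseteq> (\<Union>r\<in>set T. set r)"
proof (induction T arbitrary: w rule: tabs.induct)
  case (3 x r T)
  then obtain v where v: "w = x # v" "v \<in> set (tabs T) \<or> v \<in> set (tabs (r # map (removeAll x) T))"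
    by (auto simp: set_tabs_Cons)
  then have "set v \<subseteq> set r \<union> (\<Union>r\<in>set T. set r)"
    using 3(1)[of v] 3(2)[of v] by fastforce
  then show ?case
    using v(1) by auto
qed (auto split: if_splits)

lemma length_tabs:
  "w \<in> set (tabs T) \<Longrightarrow> (\<And>r. r \<in> set T \<Longrightarrow> distinct r \<and> set r = S) \<Longrightarrow> Suc (length w) = length T + card S"
proof (induction T arbitrary: w S rule: tabs.induct)
  case (3 x r T)
  have dr: "distinct r" "x \<notin> set r" and S: "S = insert x (set r)"
    using "3.prems"(2)[of "x # r"] by auto
  from 3(3) obtain v where w: "w = x # v" and v: "v \<in> set (tabs T) \<or> v \<in> set (tabs (r # map (removeAll x) T))"
    by (auto simp: set_tabs_Cons)
  from v show ?case
  proof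
    assume "v \<in> set (tabs T)"
    from 3(1)[OF this] 3(4) w show ?thesis
      by simp
  next
    assume *: "v \<in> set (tabs (r # map (removeAll x) T))"
    have "Suc (length v) = length (r # map (removeAll x) T) + card (set r)"
      using 3(4) S dr by (intro 3(2)[OF *]) (auto simp: distinct_removeAll)
    then show ?thesis
      using w S dr by simp
  qed
qed (auto split: if_splits)

lemma tabs_map:
  assumes "inj f"
  shows "tabs (map (map f) T) = map (map f) (tabs T)"
proof (induction T rule: tabs.induct)
  case (3 x r T)
  have "map (removeAll (f x)) (map (map f) T) = map (map f) (map (removeAll x) T)"
    by (simp add: map_removeAll_inj[OF assms])
  then show ?case
    using 3 by (simp add: tabs.simps(3) del: map_map) (simp add: o_def)
qed auto

lemma sq_Nil [simp]: "sq G [] ys = 0" "sq G x [] = 0"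
  by (simp_all add: sq_def)

lemma sq_add: "sq (\<lambda>a b. G a b + H a b) x ys = sq G x ys + sq H x ys"
  by (simp add: sq_def sum_list_addf)

lemma sq_zero [simp]: "sq (\<lambda>_ _. 0) x ys = 0"
  by (simp add: sq_def)

lemma sq_bd_param: "sq (\<lambda>a b. bd (\<lambda>y. G y a b) y) x ys = bd (\<lambda>y. sq (G y) x ys) y"
  by (simp add: sq_def bd_sum_list)

text \<open>Combines the chain map properties of \<open>tabs\<close> and \<open>shuf\<close> with
  the product rule for \<open>coll\<close>. The two hypotheses remove the words in which a letter is
  missing, since that letter collects \<open>[]\<close>.\<close>

lemma sq_bd:
  assumes "\<And>b. G [] b = 0" "\<And>a. G a [] = 0"
  shows "sq (D2 G) x ys = bd (\<lambda>x. sq G x ys) x + bd (sq G x) ys"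
proof -
  let ?f = "\<lambda>r. G (coll 1 r) (coll 2 r)"
  let ?S = "\<lambda>w ys. \<Sum>r\<leftarrow>shuf w ys. ?f r"
  have rows: "distinct r \<and> set r = {1, 2}" if "r \<in> set (map row2 x)" for r
    using that by (auto simp: row2_def)
  have "sq (D2 G) x ys = (\<Sum>w\<leftarrow>tabs (map row2 x). bd (\<lambda>w. ?S w ys) w + bd (?S w) ys)"
    unfolding sq_def
  proof (intro arg_cong[where f = sum_list] map_cong refl)
    fix w assume w: "w \<in> set (tabs (map row2 x))"
    then have sw: "set w \<subseteq> {1, 2}"
      using set_tabs[OF w] rows by blast
    have "(\<Sum>r\<leftarrow>shuf w ys. D2 G (coll 1 r) (coll 2 r)) = (\<Sum>r\<leftarrow>shuf w ys. bd ?f r)"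
      using sw by (intro arg_cong[where f = sum_list] map_cong refl bd_coll2[symmetric]) (simp add: fst_shuf)
    then show "(\<Sum>r\<leftarrow>shuf w ys. D2 G (coll 1 r) (coll 2 r)) = bd (\<lambda>w. ?S w ys) w + bd (?S w) ys"
      by (simp add: shuf_bd assms)
  qed
  also have "\<dots> = (\<Sum>w\<leftarrow>tabs (map row2 x). bd (\<lambda>w. ?S w ys) w) + bd (sq G x) ys"
    by (simp add: sum_list_addf bd_sum_list sq_def[abs_def])
  also have "(\<Sum>w\<leftarrow>tabs (map row2 x). bd (\<lambda>w. ?S w ys) w) = bd (\<lambda>T. \<Sum>w\<leftarrow>tabs T. ?S w ys) (map row2 x)
     + (\<Sum>l\<in>{1, 2}. \<Sum>w\<leftarrow>tabs (map (removeAll l) (map row2 x)). ?S w ys)"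
    by (intro tabs_bd rows) auto
  also have "(\<Sum>l\<in>{1, 2}. \<Sum>w\<leftarrow>tabs (map (removeAll l) (map row2 x)). ?S w ys) = 0"
  proof (intro sum.neutral ballI)
    fix l :: nat assume l: "l \<in> {1, 2}"
    have "?S w ys = 0" if w: "w \<in> set (tabs (map (removeAll l) (map row2 x)))" for w
    proof -
      have "l \<notin> set w"
        using set_tabs[OF w] by auto
      then have "?f r = 0" if "r \<in> set (shuf w ys)" for r
        using fst_shuf[OF that] l assms by (auto simp: coll_eq_Nil[THEN iffD2])
      then show ?thesis
        by (metis (mono_tags, lifting) map_eq_conv sum_list_0)
    qed
    then show "(\<Sum>w\<leftarrow>tabs (map (removeAll l) (map row2 x)). ?S w ys) = 0"
      by (metis (mono_tags, lifting) map_eq_conv sum_list_0)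
  qed
  finally show ?thesis
    by (simp add: bd_map sq_def[abs_def])
qed

lemma coll2_not_distinct_adj:
  assumes "\<not> distinct_adj r" "fst ` set r \<subseteq> {1, 2 :: nat}"
  shows "\<not> distinct_adj (coll 1 r) \<or> \<not> distinct_adj (coll 2 r)"
  using coll_not_distinct_adj[OF assms(1)] assms(2) by auto

lemma sum_list_eq_0: "(\<And>x. x \<in> set xs \<Longrightarrow> f x = 0) \<Longrightarrow> (\<Sum>x\<leftarrow>xs. f x) = (0 :: 'a :: monoid_add)"
  by (metis (mono_tags, lifting) map_eq_conv sum_list_0)

lemma sum_list_cong: "(\<And>x. x \<in> set xs \<Longrightarrow> f x = g x) \<Longrightarrow> (\<Sum>x\<leftarrow>xs. f x) = (\<Sum>x\<leftarrow>xs. g x)"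
  by (metis map_cong)

lemma set_tabs_row2: "w \<in> set (tabs (map row2 x)) \<Longrightarrow> set w \<subseteq> {1, 2}"
  by (drule set_tabs) (auto simp: row2_def split: if_splits)

lemma normal2_sq:
  assumes "normal2 G"
  shows "normal2 (sq G)"
proof -
  have 0: "G (coll 1 r) (coll 2 r) = 0"
    if "w \<in> set (tabs (map row2 x))" "r \<in> set (shuf w ys)" "\<not> distinct_adj r" for w x r and ys :: "'a list"
    using coll2_not_distinct_adj[OF that(3)] set_tabs_row2[OF that(1)] fst_shuf[OF that(2)] assms
    by (auto simp: normal2_def)
  have dr: "distinct r" if "r \<in> set (map row2 x)" for r x
    using that by (auto simp: row2_def)
  have inj: "inj row2"
    by (auto simp: inj_def row2_def split: if_splits)
  have "distinct_adj x \<and> distinct_adj ys"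
    if "w \<in> set (tabs (map row2 x))" "r \<in> set (shuf w ys)" "distinct_adj r" for w x r and ys :: "'a list"
    using shuf_distinct_adj[OF that(2,3)] tabs_distinct_adj[OF that(1) _ dr[of _ x]] distinct_adj_mapD[of row2 x] by blast
  with 0 show ?thesis
    unfolding normal2_def sq_def by (intro allI impI sum_list_eq_0) blast
qed

lemma coll_map_prod: "coll l (map (map_prod id u) r) = map u (coll l r)"
  by (induction r) auto

lemma sq_map: "sq G x (map u ys) = sq (\<lambda>a b. G (map u a) (map u b)) x ys"
proof -
  have "shuf w (map u ys) = map (map (map_prod id u)) (shuf w ys)" for w :: "nat list"
    using shuf_map[of id w u ys] by simp
  then show ?thesis
    by (simp add: sq_def o_def coll_map_prod)
qed

lemma coll_map_inj: "inj f \<Longrightarrow> coll (f l) (map (map_prod f id) r) = coll l r"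
  by (induction r) (auto simp: inj_eq)

text \<open>Acting by T on the vertices of the first argument exchanges the letters 1 and 2 in every
  row, hence in every word, and so exchanges the two tensor factors.\<close>

lemma sq_Not: "sq G (map Not x) ys = sq (\<lambda>a b. G b a) x ys"
proof -
  let ?t = "Transposition.transpose 1 (2::nat)"
  have "map row2 (map Not x) = map (map ?t) (map row2 x)"
    by (simp add: row2_def)
  then have T: "tabs (map row2 (map Not x)) = map (map ?t) (tabs (map row2 x))"
    by (simp only: tabs_map[OF inj_transpose])
  have c: "coll 1 (map (map_prod ?t id) r) = coll 2 r" "coll 2 (map (map_prod ?t id) r) = coll 1 r"
    for r :: "(nat \<times> 'a) list"
    using coll_map_inj[OF inj_transpose[of 1 2], of 2 r] coll_map_inj[OF inj_transpose[of 1 2], of 1 r] by simp_all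
  show ?thesis
    unfolding sq_def T using shuf_map[of ?t _ id ys] by (simp add: o_def c[unfolded o_def])
qed

section \<open>The threefold product and the chain maps \<Phi> and \<Psi> on functionals\<close>

definition ez3 :: "(('a \<times> 'b \<times> 'c) list \<Rightarrow> bit) \<Rightarrow> 'a list \<Rightarrow> 'b list \<Rightarrow> 'c list \<Rightarrow> bit" where
  "ez3 h x y z = (\<Sum>s\<leftarrow>shuf y z. \<Sum>t\<leftarrow>shuf x s. h t)"

lemma ez3_Nil [simp]: "ez3 h [] y z = 0" "ez3 h x [] z = 0" "ez3 h x y [] = 0"
  by (simp_all add: ez3_def)

lemma ez3_add: "ez3 (\<lambda>t. f t + g t) x y z = ez3 f x y z + ez3 g x y z"
  by (simp add: ez3_def sum_list_addf)

lemma ez3_zero [simp]: "ez3 (\<lambda>_. 0) x y z = 0"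
  by (simp add: ez3_def)

lemma ez3_bd:
  assumes "h [] = 0"
  shows "ez3 (bd h) x y z = bd (\<lambda>x. ez3 h x y z) x + D2 (ez3 h x) y z"
  by (simp add: ez3_def[abs_def] D2_def shuf_bd assms sum_list_addf bd_sum_list cong: if_cong)

lemma ez3_map: "ez3 h (map a x) (map b y) (map c z) = ez3 (\<lambda>t. h (map (map_prod a (map_prod b c)) t)) x y z"
  by (simp add: ez3_def shuf_map o_def)

lemma ez3_swap: "ez3 h x z y = ez3 (\<lambda>t. h (map (map_prod id prod.swap) t)) x y z"
proof -
  have "ez3 h x z y = (\<Sum>s\<leftarrow>shuf y z. \<Sum>t\<leftarrow>shuf (map id x) (map prod.swap s). h t)"
    unfolding ez3_def by (subst sum_shuf_swap) simp
  then show ?thesis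
    by (simp only: shuf_map ez3_def) (simp add: o_def)
qed

lemma normal_ez3:
  assumes "normal h"
  shows "normal (\<lambda>x. ez3 h x y z)" "normal2 (ez3 h x)"
proof -
  have "ez3 h x y z = 0" if "\<not> distinct_adj x \<or> \<not> distinct_adj y \<or> \<not> distinct_adj z" for x y z
    unfolding ez3_def
    by (intro sum_list_eq_0 normalD[OF assms]) (use that in \<open>blast dest: shuf_distinct_adj\<close>)
  then show "normal (\<lambda>x. ez3 h x y z)" "normal2 (ez3 h x)"
    by (auto simp: normal_def normal2_def)
qed

text \<open>The functional \<open>h\<close> on triples of vertices, pulled back along \<Phi>
  followed by the threefold Eilenberg-Zilber map; \<open>psi\<close> is its pullback along
  \<Psi>.\<close>

definition phi :: "((bool \<times> 'b \<times> 'b) list \<Rightarrow> bit) \<Rightarrow> bool list \<Rightarrow> 'b list \<Rightarrow> bit" where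
  "phi h xs ys = cut (\<lambda>x x'. sq (ez3 h x) x' ys) xs"

definition psi :: "((bool \<times> 'b \<times> 'b) list \<Rightarrow> bit) \<Rightarrow> (bool \<times> 'b) list \<Rightarrow> bit" where
  "psi h W = cut (\<lambda>U V. phi h (map fst U) (map snd V)) W"

lemma phi_Nil [simp]: "phi h [] ys = 0" "phi h xs [] = 0"
  by (simp_all add: phi_def)

lemma phi_bd:
  assumes "h [] = 0"
  shows "phi (bd h) xs ys = D2 (phi h) xs ys"
proof -
  let ?g = "\<lambda>x x'. sq (ez3 h x) x' ys"
  have *: "sq (ez3 (bd h) x) x' ys = D2 ?g x x' + bd (sq (ez3 h x) x') ys" for x x'
  proof -
    have "sq (ez3 (bd h) x) x' ys = sq (\<lambda>a b. bd (\<lambda>x. ez3 h x a b) x + D2 (ez3 h x) a b) x' ys"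
      using ez3_bd[of h, OF assms] by presburger
    then show ?thesis
      by (simp add: sq_add sq_bd_param sq_bd add.assoc) (simp add: D2_def add.assoc)
  qed
  have "ez3 h [] = (\<lambda>_ _. 0)"
    by (intro ext) simp
  then show ?thesis
    unfolding phi_def * cut_add cut_bd D2_def[of "\<lambda>xs ys. cut (\<lambda>x x'. sq (ez3 h x) x' ys) xs"] cut_bd_param
    by simp
qed

lemma psi_bd:
  assumes "h [] = 0"
  shows "psi (bd h) W = bd (psi h) W"
proof -
  let ?g = "\<lambda>U V. phi h (map fst U) (map snd V)"
  have "phi (bd h) (map fst U) (map snd V) = D2 ?g U V" for U V :: "(bool \<times> 'a) list"
    by (simp add: phi_bd[of h, OF assms] D2_def bd_map)
  then show ?thesis
    by (simp add: psi_def[abs_def] cut_bd)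
qed

lemma length_coll2: "fst ` set r \<subseteq> {1, 2 :: nat} \<Longrightarrow> length (coll 1 r) + length (coll 2 r) = length r"
  by (induction r) auto

lemma psi_cong:
  assumes "\<And>t. length t = length W \<Longrightarrow> h t = h' t"
  shows "psi h W = psi h' W"
  unfolding psi_def phi_def sq_def ez3_def
proof (intro cut_cong sum_list_cong assms, unfold length_map)
  fix U V :: "(bool \<times> 'a) list" and x x' w r s t
  assume *: "U \<noteq> []" "V \<noteq> []" "length U + length V = Suc (length W)"
    "x \<noteq> []" "x' \<noteq> []" "length x + length x' = Suc (length U)"
    "w \<in> set (tabs (map row2 x'))" "r \<in> set (shuf w (map snd V))"
    "s \<in> set (shuf (coll 1 r) (coll 2 r))" "t \<in> set (shuf x s)"
  have "Suc (length w) = length (map row2 x') + card {1::nat, 2}"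
    by (intro length_tabs *) (auto simp: row2_def)
  moreover have "length (coll 1 r) + length (coll 2 r) = length r"
    using fst_shuf[OF *(8)] set_tabs_row2[OF *(7)] by (intro length_coll2) auto
  ultimately show "length t = length W"
    using * length_shuf[OF *(8)] length_shuf[OF *(9)] length_shuf[OF *(10)] by simp
qed

text \<open>The homotopy applies \<open>psi\<close> to functionals \<open>f (i w # M)\<close> of M,
  which need not vanish at \<open>[]\<close>. As \<Psi> preserves degrees, the value at
  \<open>[]\<close> does not enter for lists of length at least 2 and may be set to 0.\<close>

lemma psi_bd_ge_2:
  assumes "length W \<ge> 2"
  shows "psi (bd h) W = bd (psi h) W"
proof -
  define h0 where "h0 t = (if t = [] then 0 else h t)" for t
  have "bd h t = bd h0 t" if "length t \<ge> 2" for t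
    using that by (intro bd_cong) (auto simp: h0_def dest: length_faces)
  then have "psi (bd h) W = psi (bd h0) W"
    using assms by (intro psi_cong) simp
  also have "\<dots> = bd (psi h0) W"
    by (intro psi_bd) (simp add: h0_def)
  also have "\<dots> = bd (psi h) W"
    using assms by (intro bd_cong psi_cong) (auto simp: h0_def dest: length_faces)
  finally show ?thesis .
qed

text \<open>On vertices \<Psi> is the inclusion of \<open>V4\<close> into \<open>D8\<close>; in
  particular it preserves the augmentation, as the homotopy requires.\<close>

lemma psi_single: "psi h [(e, f)] = h [(e, f, f)]"
  by (simp add: psi_def phi_def sq_def row2_def tabs.simps(3) sum_shuf_Cons ez3_def)

lemma psi_add: "psi (\<lambda>t. f t + g t) W = psi f W + psi g W"
  by (simp add: psi_def phi_def ez3_add[abs_def] sq_add cut_add)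

lemma psi_zero [simp]: "psi (\<lambda>_. 0) W = 0"
  by (simp add: psi_def phi_def ez3_zero[abs_def] del: ez3_zero)

lemma normal2_phi: "normal h \<Longrightarrow> normal2 (phi h)"
proof -
  assume h: "normal h"
  have n: "normal2 (\<lambda>x x'. sq (ez3 h x) x' ys)" for ys
  proof -
    have "ez3 h x = (\<lambda>_ _. 0)" if "\<not> distinct_adj x" for x
      by (intro ext normalD[OF normal_ez3(1)[OF h] that])
    then show ?thesis
      using normal2_sq[OF normal_ez3(2)[OF h]] by (auto simp: normal2_def)
  qed
  have "sq (ez3 h x) x' ys = 0" if "\<not> distinct_adj ys" for x x' ys
    using normal2_sq[OF normal_ez3(2)[OF h]] that by (auto simp: normal2_def)
  then show ?thesis
    using normalD[OF normal_cut[OF n]] by (auto simp: normal2_def phi_def)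
qed

lemma normal_psi:
  assumes "normal h"
  shows "normal (psi h)"
proof -
  have "normal2 (\<lambda>U V. phi h (map fst U) (map snd V))"
    using normal2_phi[OF assms] by (auto simp: normal2_def dest: distinct_adj_mapD)
  then show ?thesis
    unfolding psi_def[abs_def] by (rule normal_cut)
qed

lemma psi_map_snd: "psi h (map (map_prod id u) W) = psi (\<lambda>t. h (map (map_prod id (map_prod u u)) t)) W"
proof -
  have "phi h x (map u y) = phi (\<lambda>t. h (map (map_prod id (map_prod u u)) t)) x y" for x y
    using ez3_map[of h id _ u _ u] by (simp add: phi_def sq_map)
  moreover have "map fst (map (map_prod id u) a) = map fst a" "map snd (map (map_prod id u) a) = map u (map snd a)"
    for a :: "(bool \<times> _) list"
    by simp_all
  ultimately show ?thesis
    by (simp only: psi_def cut_map)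
qed

text \<open>Equivariance under the generator a, which flips the first coordinate and, by a c^t b^s =
  b^t c^s a, exchanges the other two.\<close>

lemma psi_map_Not:
  fixes W :: "(bool \<times> 'a) list"
  shows "psi h (map (map_prod Not id) W) = psi (\<lambda>t. h (map (map_prod Not prod.swap) t)) W"
proof -
  have "ez3 h (map Not x) b a = ez3 (\<lambda>t. h (map (map_prod Not prod.swap) t)) x a b" for x and a b :: "'a list"
  proof -
    have "ez3 h (map Not x) b a = ez3 h (map Not x) (map id b) (map id a)"
      by simp
    also have "\<dots> = ez3 (\<lambda>t. h (map (map_prod Not id) t)) x b a"
      unfolding ez3_map by (simp add: prod.map_id0)
    also have "\<dots> = ez3 (\<lambda>t. h (map (map_prod Not prod.swap) t)) x a b"
      unfolding ez3_swap[of _ _ b a] by (simp add: o_def map_prod_def case_prod_unfold)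
    finally show ?thesis .
  qed
  then have "phi h (map Not x) y = phi (\<lambda>t. h (map (map_prod Not prod.swap) t)) x y" for x y
    by (simp add: phi_def cut_map sq_Not)
  moreover have "map fst (map (map_prod Not id) a) = map Not (map fst a)" "map snd (map (map_prod Not id) a) = map snd a"
    for a :: "(bool \<times> 'a) list"
    by simp_all
  ultimately show ?thesis
    by (simp only: psi_def cut_map)
qed

text \<open>The dual of the sum of the joins (i g_0, ..., i g_j) * P(g_j, ..., g_k). Both homotopies
  are instances: P is \<Psi> or right multiplication by (23).\<close>

fun J :: "('a \<Rightarrow> 'b) \<Rightarrow> (('b list \<Rightarrow> bit) \<Rightarrow> 'a list \<Rightarrow> bit) \<Rightarrow> ('b list \<Rightarrow> bit) \<Rightarrow> 'a list \<Rightarrow> bit" where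
  "J i P f [] = 0"
| "J i P f (w # ws) = P (\<lambda>M. f (i w # M)) (w # ws) + J i P (\<lambda>M. f (i w # M)) ws"

text \<open>Deleting the last vertex of the front in one join cancels against deleting the first
  vertex of the argument of P in the preceding join. What survives of these are the two ends: P
  itself, and the inclusion, which arises from the augmentation of P at the last vertex
  (\<open>P_single\<close>).\<close>

lemma J_bd:
  assumes P_add: "\<And>f g W. P (\<lambda>t. f t + g t) W = P f W + P g W"
    and P_bd: "\<And>h W. length W \<ge> 2 \<Longrightarrow> P (bd h) W = bd (P h) W"
    and P_single: "\<And>h w. P (bd h) [w] = h []"
    and "W \<noteq> []"
  shows "J i P (bd f) W = f (map i W) + P f W + bd (J i P f) W"
  using \<open>W \<noteq> []\<close>
proof (induction W arbitrary: f)
  case (Cons w ws)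
  let ?fw = "\<lambda>M. f (i w # M)"
  have J_add: "J i P (\<lambda>t. f t + g t) W = J i P f W + J i P g W" for f g W
    by (induction W arbitrary: f g) (simp_all add: P_add bit_cancel)
  have "J i P (bd f) (w # ws) = P f (w # ws) + P (bd ?fw) (w # ws) + J i P f ws + J i P (bd ?fw) ws"
    by (simp add: P_add J_add add.assoc)
  moreover have "bd (J i P f) (w # ws) = J i P f ws + bd (\<lambda>v. P ?fw (w # v)) ws + bd (J i P ?fw) ws"
    by (simp add: bd_add add.assoc)
  ultimately show ?case
  proof (cases "ws = []")
    case True
    then show ?thesis
      using P_single[of ?fw w] by (simp add: P_add[of f "bd ?fw"] bit_cancel)
  next
    case False
    then have "P (bd ?fw) (w # ws) = P ?fw ws + bd (\<lambda>v. P ?fw (w # v)) ws"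
      by (subst P_bd) (cases ws; simp)+
    moreover note Cons.IH[OF False, of ?fw]
    ultimately show ?thesis
      by (simp add: P_add J_add bd_add bit_cancel)
  qed
qed simp

lemma normal_J:
  assumes "\<And>h. normal h \<Longrightarrow> normal (P h)" "\<And>W. P (\<lambda>_. 0) W = 0" "normal f"
  shows "normal (J i P f)"
proof -
  have J0: "J i P (\<lambda>_. 0) W = 0" for W
    by (induction W) (simp_all add: assms(2))
  have "J i P f W = 0" if "\<not> distinct_adj W" "normal f" for f W
    using that
  proof (induction W arbitrary: f)
    case (Cons w ws)
    have P0: "P (\<lambda>M. f (i w # M)) (w # ws) = 0"
      using assms(1)[OF normal_Cons[OF Cons.prems(2)]] Cons.prems(1) by (simp add: normalD)
    show ?case
    proof (cases "distinct_adj ws")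
      case False
      then show ?thesis
        using Cons.IH[OF False normal_Cons[OF Cons.prems(2)]] P0 by simp
    next
      case True
      then obtain vs where ws: "ws = w # vs"
        using Cons.prems(1) by (cases ws) auto
      have z: "(\<lambda>M. f (i w # i w # M)) = (\<lambda>_. 0)"
        using Cons.prems(2) by (auto simp: normal_def)
      show ?thesis
        using P0 by (simp add: ws z assms(2) J0)
    qed
  qed simp
  then show ?thesis
    using assms(3) by (simp add: normal_def)
qed

lemma J_map:
  assumes "\<And>h W. P h (map n W) = P (\<lambda>t. h (map m t)) W" "\<And>w. i (n w) = m (i w)"
  shows "J i P f (map n W) = J i P (\<lambda>t. f (map m t)) W"
proof (induction W arbitrary: f)
  case (Cons w ws)
  then show ?case
    using assms(1)[of _ "w # ws"] by (simp add: assms(2))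
qed simp

section \<open>Alternating sequences and binomial coefficients\<close>

fun alt :: "'a \<Rightarrow> 'a \<Rightarrow> nat \<Rightarrow> 'a list" where
  "alt x y 0 = []"
| "alt x y (Suc k) = x # alt y x k"

lemma length_alt [simp]: "length (alt x y k) = k"
  by (induction k arbitrary: x y) auto

lemma alt_eq_Nil [simp]: "alt x y k = [] \<longleftrightarrow> k = 0"
  by (cases k) auto

lemma map_alt: "map f (alt x y k) = alt (f x) (f y) k"
  by (induction k arbitrary: x y) auto

lemma set_alt: "set (alt x y (Suc (Suc k))) = {x, y}"
proof -
  have "set (alt x y k) \<subseteq> {x, y}"
    by (induction k arbitrary: x y) auto
  then show ?thesis
    by auto
qed

lemma take_alt: "i \<le> k \<Longrightarrow> take i (alt x y k) = alt x y i"
proof (induction i arbitrary: x y k)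
  case (Suc i)
  then show ?case
    by (cases k) auto
qed simp

lemma drop_alt: "drop i (alt x y k) = (if even i then alt x y (k - i) else alt y x (k - i))"
proof (induction i arbitrary: x y k)
  case (Suc i)
  then show ?case
    by (cases k) auto
qed simp

lemma distinct_adj_bool_alt:
  fixes a :: "bool list"
  assumes "distinct_adj (s # a)"
  shows "s # a = alt s (\<not> s) (Suc (length a))"
  using assms
proof (induction a arbitrary: s)
  case (Cons t a)
  then have "t = (\<not> s)" "distinct_adj (t # a)"
    by auto
  then show ?case
    using Cons.IH[of t] by simp
qed simp

text \<open>Deleting an inner entry of an alternating list brings two equal entries together, so
  only the two outer faces count.\<close>

lemma normal_bd_alt:
  "normal f \<Longrightarrow> bd f (alt x y (Suc (Suc k))) = f (alt y x (Suc k)) + f (alt x y (Suc k))"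
proof (induction k arbitrary: f x y)
  case (Suc k)
  have "f (x # x # ys) = 0" for ys
    using Suc.prems by (simp add: normal_def)
  then show ?case
    using Suc.IH[OF normal_Cons[OF Suc.prems], of x y x] by simp
qed simp

abbreviation xb :: "nat \<Rightarrow> bool list" where
  "xb q \<equiv> alt False True (Suc q)"

text \<open>The two outer faces of an alternating list of bits are negations of each other. By
  invariance of \<open>g\<close> they contribute equally and cancel mod 2: the cross product is a
  cycle in the coinvariants.\<close>

lemma cross_bd:
  assumes "normal g" "g [] = 0"
    and inv: "\<And>W. g (map (map_prod Not id) W) = g W" "\<And>W. g (map (map_prod id Not) W) = g W"
  shows "(\<Sum>W\<leftarrow>shuf (xb q) (xb p). bd g W) = 0"
proof -
  let ?S = "\<lambda>A L. \<Sum>W\<leftarrow>shuf A L. g W"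
  have 1: "?S (map Not A) L = ?S A L" for A L
    using shuf_map[of Not A id L] by (simp add: o_def inv)
  have 2: "?S A (map Not L) = ?S A L" for A L
    using shuf_map[of id A Not L] by (simp add: o_def inv)
  have a: "alt True False k = map Not (alt False True k)" for k
    by (simp add: map_alt)
  have "bd (\<lambda>A. ?S A L) (xb q) = 0" for L
  proof (cases q)
    case (Suc m)
    show ?thesis
      unfolding Suc normal_bd_alt[OF normal_shuf(1)[OF assms(1)]] a[of "Suc m"] 1 by (rule bit_add_self)
  qed simp
  moreover have "bd (?S A) (xb p) = 0" for A
  proof (cases p)
    case (Suc m)
    show ?thesis
      unfolding Suc normal_bd_alt[OF normal_shuf(2)[OF assms(1)]] a[of "Suc m"] 2 by (rule bit_add_self)
  qed simp
  ultimately show ?thesis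
    by (simp only: shuf_bd assms(2)) simp
qed

text \<open>As soon as \<open>A\<close> has two entries, every path takes a step along
  \<open>A\<close>, and its projection to \<open>B\<close> repeats a vertex there.\<close>

lemma sum_shuf_snd:
  assumes "normal k" "B \<noteq> []"
  shows "(\<Sum>W\<leftarrow>shuf A B. k (map snd W)) = (if length A = 1 then k B else 0)"
  using assms
proof (induction A B arbitrary: k rule: shuf.induct)
  case (3 x xs y ys)
  have n: "normal (\<lambda>v. k (y # v))"
    by (rule normal_Cons[OF 3(3)])
  have 0: "k (y # y # v) = 0" for v
    using 3(3) by (simp add: normal_def)
  show ?case
    using 3(1)[OF n] 3(2)[OF n] by (cases "ys = []") (auto simp: sum_shuf_Cons 0)
qed simp_all

text \<open>This is AW after EZ being the identity on normalized chains. A nonzero summand has a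
  front moving only along \<open>A\<close> and a back moving only along \<open>B\<close>, which
  leaves the path along \<open>A\<close> and then \<open>B\<close>, cut at its corner.\<close>

lemma sum_shuf_cut:
  assumes "normal2 g" "A \<noteq> []" "B \<noteq> []"
  shows "(\<Sum>W\<leftarrow>shuf A B. cut (\<lambda>U V. g (map fst U) (map snd V)) W) = g A B"
  using assms
proof (induction A B arbitrary: g rule: shuf.induct)
  case (3 x xs y ys)
  have n1: "normal (\<lambda>v. g [x] (y # v))"
    using 3(3) normal_Cons[of "g [x]" y] by (simp add: normal2_def normal_def)
  have n2: "normal2 (\<lambda>a. g (x # a))"
    using 3(3) not_distinct_adj_Cons[of _ x] unfolding normal2_def by blast
  have 0: "g [x] (y # y # v) = 0" "g (x # x # a) b = 0" for v a b
    using 3(3) by (simp_all add: normal2_def)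
  note s = sum_shuf_snd[OF n1] and IH = 3(1)[OF n2] 3(2)[OF n2]
  show ?case
    using IH by (cases "xs = []"; cases "ys = []") (simp_all add: sum_shuf_Cons sum_list_addf s 0)
qed simp_all

lemma sum_shuf_psi:
  assumes "normal h" "A \<noteq> []" "B \<noteq> []"
  shows "(\<Sum>W\<leftarrow>shuf A B. psi h W) = phi h A B"
  unfolding psi_def by (rule sum_shuf_cut[OF normal2_phi[OF assms(1)] assms(2,3)])

text \<open>Here \<open>f\<close> gives the rows of a block, \<open>ys\<close> its alternating
  vertices, and \<open>fs\<close> the only word of the resulting table that counts. The second rule
  describes a block in which one of the two letters has already been deleted.\<close>

inductive block_word :: "(bool \<Rightarrow> 'a list) \<Rightarrow> bool list \<Rightarrow> 'a list \<Rightarrow> bool" where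
  full: "a \<noteq> b \<Longrightarrow> block_word (\<lambda>t. if t = s then [a, b] else [b, a]) (alt s (\<not> s) (Suc m)) (alt a b (Suc (Suc m)))"
| one: "block_word (\<lambda>_. [a]) [s] [a]"

lemma normal_tabs:
  assumes "normal G" "\<And>t. distinct (f t)"
  shows "normal (\<lambda>T. \<Sum>w\<leftarrow>tabs (map f T). G w)"
  unfolding normal_def
proof (intro allI impI sum_list_eq_0 normalD[OF assms(1)])
  fix T w assume *: "\<not> distinct_adj T" "w \<in> set (tabs (map f T))"
  show "\<not> distinct_adj w"
  proof
    assume "distinct_adj w"
    then have "distinct_adj (map f T)"
      using *(2) assms(2) by (intro tabs_distinct_adj[of w]) auto
    with * distinct_adj_mapD show False
      by blast
  qed
qed

text \<open>If the first letter is not the last one read in its row, it is deleted everywhere below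
  and all remaining rows are the constant row \<open>[b]\<close>, which is degenerate. So each row
  but the last supplies a single letter.\<close>

lemma tabs_block_word:
  assumes "block_word f ys fs" "normal G"
  shows "(\<Sum>w\<leftarrow>tabs (map f ys). G w) = G fs"
  using assms
proof (cases rule: block_word.cases)
  case (full a b s m)
  have "(\<Sum>w\<leftarrow>tabs (map (\<lambda>t. if t = s then [a, b] else [b, a]) (alt s (\<not> s) (Suc m))). G w) = G (alt a b (Suc (Suc m)))"
    using full(4) assms(2)
  proof (induction m arbitrary: G a b s)
    case (Suc m)
    let ?f = "\<lambda>t. if t = s then [a, b] else [b, a]"
    let ?ys = "alt (\<not> s) s (Suc m)"
    have n: "normal (\<lambda>w. G (a # w))"
      by (rule normal_Cons[OF Suc.prems(2)])
    have f: "?f = (\<lambda>t. if t = (\<not> s) then [b, a] else [a, b])"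
      by auto
    have r: "map (removeAll a) (map ?f ?ys) = map (\<lambda>_. [b]) ?ys"
      using Suc.prems(1) by simp
    have Z: "(\<Sum>w\<leftarrow>tabs (map (\<lambda>u. u) ([b] # map (\<lambda>_. [b]) ?ys)). G (a # w)) = 0"
    proof (intro sum_list_eq_0 normalD[OF n] notI)
      fix w assume "w \<in> set (tabs (map (\<lambda>u. u) ([b] # map (\<lambda>_. [b]) ?ys)))" "distinct_adj w"
      then have "distinct_adj (map (\<lambda>u. u) ([b] # map (\<lambda>_. [b]) ?ys))"
        by (rule tabs_distinct_adj) auto
      then show False
        by simp
    qed
    have M: "(\<Sum>w\<leftarrow>tabs (map ?f ?ys). G (a # w)) = G (a # alt b a (Suc (Suc m)))"
      unfolding f using Suc.IH[of b a "\<lambda>w. G (a # w)" "\<not> s"] Suc.prems n by simp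
    have e: "map ?f (alt s (\<not> s) (Suc (Suc m))) = [a, b] # map ?f ?ys"
      by simp
    show ?case
      unfolding e sum_tabs_Cons[where x = a and r = "[b]"] r M Z[unfolded list.map_ident] by simp
  qed (simp add: tabs.simps(3))
  then show ?thesis
    using full by simp
next
  case (one a s)
  then show ?thesis
    by (simp add: tabs.simps(3))
qed

section \<open>Counting alternating divisions mod 2\<close>

definition ch :: "nat \<Rightarrow> nat \<Rightarrow> bit" where
  "ch n k = of_nat (n choose k)"

text \<open>The number mod 2 of compositions of k into w positive parts, that is (k - 1 choose w -
  1) with the convention that it is 1 for k = w = 0.\<close>

definition ch' :: "nat \<Rightarrow> nat \<Rightarrow> bit" where
  "ch' k w = (if w = 0 then of_bool (k = 0) else if k = 0 then 0 else ch (k - 1) (w - 1))"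

lemma ch_simps [simp]: "ch n 0 = 1" "ch 0 (Suc k) = 0" "ch (Suc n) (Suc k) = ch n k + ch n (Suc k)"
  by (simp_all add: ch_def)

lemma ch_eq_0: "n < k \<Longrightarrow> ch n k = 0"
  by (simp add: ch_def binomial_eq_0)

text \<open>Divisions of an alternating list of n + 1 bits beginning with s into w + 1 intervals
  labelled x, y, x, ..., both parts alternating. The bit u stands for the last vertex that y has
  collected earlier, so that the count can be continued from the middle of a division.\<close>

definition alt_count :: "nat \<Rightarrow> nat \<Rightarrow> bool \<Rightarrow> bool \<Rightarrow> nat \<Rightarrow> nat \<Rightarrow> 'a \<Rightarrow> 'a \<Rightarrow> bit" where
  "alt_count w n u s j k x y = (\<Sum>r\<leftarrow>shuf (alt x y (Suc w)) (alt s (\<not> s) (Suc n)).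
     of_bool (distinct_adj (coll x r) \<and> distinct_adj (u # coll y r)
       \<and> length (coll x r) = Suc j \<and> length (coll y r) = k))"

lemma coll_shuf_hd:
  assumes "r \<in> set (shuf (x # A) (v # L))"
  shows "\<exists>c. coll x r = v # c" "y \<noteq> x \<Longrightarrow> \<exists>q. r = (x, v) # q"
  using assms by (auto simp: set_shuf_Cons)

text \<open>After the first vertex either x goes on, or y takes over and collects s again, which is
  impossible for u = s. In the second case x and y exchange roles, and s is now the last vertex of
  both.\<close>

lemma alt_count_rec:
  assumes "x \<noteq> y"
  shows "alt_count w n u s j k x y = of_bool (w = 0 \<and> n = 0 \<and> j = 0 \<and> k = 0)
    + (if n = 0 \<or> j = 0 then 0 else alt_count w (n - 1) u (\<not> s) (j - 1) k x y)
    + (if w = 0 \<or> k = 0 \<or> u = s then 0 else alt_count (w - 1) n s s (k - 1) j y x)"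
proof -
  have L: "(\<Sum>r\<leftarrow>shuf (alt x y (Suc w)) (alt (\<not> s) s n).
     of_bool (distinct_adj (s # coll x r) \<and> distinct_adj (u # coll y r)
       \<and> Suc (length (coll x r)) = Suc j \<and> length (coll y r) = k))
     = (if n = 0 \<or> j = 0 then 0 else alt_count w (n - 1) u (\<not> s) (j - 1) k x y)"
  proof (cases n)
    case (Suc n')
    have "of_bool (distinct_adj (s # coll x r) \<and> distinct_adj (u # coll y r)
       \<and> Suc (length (coll x r)) = Suc j \<and> length (coll y r) = k) =
       (if j = 0 then 0 else of_bool (distinct_adj (coll x r) \<and> distinct_adj (u # coll y r)
       \<and> length (coll x r) = Suc (j - 1) \<and> length (coll y r) = k) :: bit)"
      if "r \<in> set (shuf (alt x y (Suc w)) (alt (\<not> s) s n))" for r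
      using coll_shuf_hd(1)[of r x "alt y x w" "\<not> s" "alt s (\<not> s) n'"] that Suc by (cases j) auto
    then show ?thesis
      unfolding Suc alt_count_def
      by (cases "j = 0") (auto intro!: sum_list_cong sum_list_eq_0 simp del: alt.simps)
  qed simp
  have W: "(\<Sum>r\<leftarrow>shuf (alt y x w) (alt s (\<not> s) (Suc n)).
     of_bool (distinct_adj (s # coll x r) \<and> distinct_adj (u # coll y r)
       \<and> Suc (length (coll x r)) = Suc j \<and> length (coll y r) = k))
     = (if w = 0 \<or> k = 0 \<or> u = s then 0 else alt_count (w - 1) n s s (k - 1) j y x)"
  proof (cases w)
    case (Suc w')
    have "of_bool (distinct_adj (s # coll x r) \<and> distinct_adj (u # coll y r)
       \<and> Suc (length (coll x r)) = Suc j \<and> length (coll y r) = k) =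
       (if k = 0 \<or> u = s then 0 else of_bool (distinct_adj (coll y r) \<and> distinct_adj (s # coll x r)
       \<and> length (coll y r) = Suc (k - 1) \<and> length (coll x r) = j) :: bit)"
      if "r \<in> set (shuf (alt y x w) (alt s (\<not> s) (Suc n)))" for r
      using coll_shuf_hd(1)[of r y "alt x y w'" s "alt (\<not> s) s n"] that Suc by (cases k) auto
    then show ?thesis
      unfolding Suc alt_count_def
      by (cases "k = 0 \<or> u = s") (auto intro!: sum_list_cong sum_list_eq_0 simp del: alt.simps)
  qed simp
  have B: "(if alt y x w = [] \<and> alt (\<not> s) s n = [] then
      of_bool (distinct_adj (coll x [(x, s)]) \<and> distinct_adj (u # coll y [(x, s)])
       \<and> length (coll x [(x, s)]) = Suc j \<and> length (coll y [(x, s)]) = k) else 0)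
     = (of_bool (w = 0 \<and> n = 0 \<and> j = 0 \<and> k = 0) :: bit)"
    using assms by auto
  have c: "coll x ((x, s) # r) = s # coll x r" "coll y ((x, s) # r) = coll y r" for r
    using assms by auto
  have "alt_count w n u s j k x y = (if alt y x w = [] \<and> alt (\<not> s) s n = [] then
      of_bool (distinct_adj (coll x [(x, s)]) \<and> distinct_adj (u # coll y [(x, s)])
       \<and> length (coll x [(x, s)]) = Suc j \<and> length (coll y [(x, s)]) = k) else 0)
    + (\<Sum>r\<leftarrow>shuf (alt y x w) (alt s (\<not> s) (Suc n)).
     of_bool (distinct_adj (s # coll x r) \<and> distinct_adj (u # coll y r)
       \<and> Suc (length (coll x r)) = Suc j \<and> length (coll y r) = k))
    + (\<Sum>r\<leftarrow>shuf (alt x y (Suc w)) (alt (\<not> s) s n).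
     of_bool (distinct_adj (s # coll x r) \<and> distinct_adj (u # coll y r)
       \<and> Suc (length (coll x r)) = Suc j \<and> length (coll y r) = k))"
    unfolding alt_count_def alt.simps(2) sum_shuf_Cons c by (simp only: list.size(4) add_Suc_right add_0_right not_not)
  then show ?thesis
    unfolding B L W by (simp only: add.assoc add.commute add.left_commute)
qed

text \<open>An identity of parities, not of numbers: for w = 1 there is a single cut, and
  alternation prescribes the parity of its position, which is what (j choose 1) or (j + 1 choose 1)
  records.\<close>

lemma alt_count_eq:
  assumes "x \<noteq> y"
  shows "alt_count w n u s j k x y =
    (if j + k = n + w then (if u = s then ch j w else ch (Suc j) w) * ch' k w else 0)"
  using assms
proof (induction "n + w" arbitrary: w n u s j k x y rule: less_induct)
  case less
  have A: "n \<noteq> 0 \<Longrightarrow> j \<noteq> 0 \<Longrightarrow> alt_count w (n - 1) u (\<not> s) (j - 1) k x y =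
     (if j + k = n + w then (if u \<noteq> s then ch (j - 1) w else ch j w) * ch' k w else 0)" for u s
    by (subst less.hyps) (use less.prems in auto)
  have B: "w \<noteq> 0 \<Longrightarrow> k \<noteq> 0 \<Longrightarrow> alt_count (w - 1) n s s (k - 1) j y x =
     (if j + k = n + w then ch (k - 1) (w - 1) * ch' j (w - 1) else 0)" for s
    by (subst less.hyps) (use less.prems in auto)
  have R: "alt_count w n u s j k x y = of_bool (w = 0 \<and> n = 0 \<and> j = 0 \<and> k = 0)
    + (if n = 0 \<or> j = 0 then 0
       else if j + k = n + w then (if u \<noteq> s then ch (j - 1) w else ch j w) * ch' k w else 0)
    + (if w = 0 \<or> k = 0 \<or> u = s then 0
       else if j + k = n + w then ch (k - 1) (w - 1) * ch' j (w - 1) else 0)"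
    unfolding alt_count_rec[OF less.prems, of w n u s j k]
    by (intro arg_cong2[where f = "(+)"] refl if_cong) (simp_all only: A B de_Morgan_disj simp_thms)
  show ?case
  proof (cases "j + k = n + w")
    case False
    then show ?thesis
      unfolding R by auto
  next
    case eq: True
    show ?thesis
    proof (cases w)
      case 0
      then show ?thesis
        using eq unfolding R by (cases "n = 0") (auto simp: ch'_def)
    next
      case w: (Suc w')
      show ?thesis
      proof (cases k)
        case 0
        then show ?thesis
          using eq w unfolding R by (auto simp: ch'_def)
      next
        case k: (Suc k')
        show ?thesis
        proof (cases "k' < w'")
          case True
          then have "ch k' w' = 0"
            by (rule ch_eq_0)
          then show ?thesis
            using eq w k unfolding R by (auto simp: ch'_def)
        next
          case False
          then have jn: "n = 0 \<Longrightarrow> j = 0"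
            using eq w k by auto
          \<comment> \<open>Pascal's rule twice; the middle term occurs two times and vanishes mod
            2.\<close>
          have "ch (Suc j) w = (if j = 0 then 0 else ch (j - 1) w) + ch' j w'"
            unfolding w ch'_def by (cases j; cases w'; simp add: bit_cancel)
          then show ?thesis
            using eq jn w k unfolding R
            by (cases "u = s"; cases "j = 0") (auto simp: ch'_def algebra_simps)
        qed
      qed
    qed
  qed
qed

text \<open>Extending the first interval vertex by vertex reduces the count to
  \<open>alt_count\<close> with u = s. The contributions \<open>ch' j m\<close> for the different
  lengths of that interval add up to (j choose m) by Pascal's rule.\<close>

lemma sum_of_bool_alt:
  assumes "x \<noteq> y"
  shows "(\<Sum>r\<leftarrow>shuf (alt x y (Suc (Suc m))) (alt s (\<not> s) (Suc n)).
     of_bool (distinct_adj (coll x r) \<and> distinct_adj (coll y r)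
       \<and> length (coll x r) = Suc j \<and> length (coll y r) = Suc k)) =
    (if j + k = n + m then ch j m * ch k m else 0)"
proof (induction n arbitrary: s j)
  have W: "(\<Sum>r\<leftarrow>shuf (alt y x (Suc m)) (alt s (\<not> s) (Suc n)).
     of_bool (distinct_adj (s # coll x r) \<and> distinct_adj (coll y r)
       \<and> Suc (length (coll x r)) = Suc j \<and> length (coll y r) = Suc k)) =
     (if j + k = n + m then ch k m * ch' j m else 0)" for s n j
    using alt_count_eq[of y x m n s s k j] assms unfolding alt_count_def
    by (simp add: conj_commute conj_left_commute add.commute)
  have c: "coll x ((x, s) # r) = s # coll x r" "coll y ((x, s) # r) = coll y r" for r s
    using assms by auto
  have R: "(\<Sum>r\<leftarrow>shuf (alt x y (Suc (Suc m))) (alt s (\<not> s) (Suc n)).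
     of_bool (distinct_adj (coll x r) \<and> distinct_adj (coll y r)
       \<and> length (coll x r) = Suc j \<and> length (coll y r) = Suc k)) =
     (if j + k = n + m then ch k m * ch' j m else 0) +
     (\<Sum>r\<leftarrow>shuf (alt x y (Suc (Suc m))) (alt (\<not> s) s n).
     of_bool (distinct_adj (s # coll x r) \<and> distinct_adj (coll y r)
       \<and> Suc (length (coll x r)) = Suc j \<and> length (coll y r) = Suc k))" for s n j
    unfolding alt.simps(2)[of x y "Suc m"] alt.simps(2)[of s "\<not> s" n] sum_shuf_Cons c
    by (simp only: W[where s = s and n = n and j = j, unfolded alt.simps(2)[of s "\<not> s" n]] alt_eq_Nil nat.distinct simp_thms if_False add_0_left list.size(4) add_0_right add_Suc_right)
  {
    case 0
    then show ?case
      unfolding R by (cases m) (auto simp: ch'_def ch_eq_0 not_less_eq)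
  next
    case (Suc n)
    have "of_bool (distinct_adj (s # coll x r) \<and> distinct_adj (coll y r)
       \<and> Suc (length (coll x r)) = Suc j \<and> length (coll y r) = Suc k) =
       (if j = 0 then 0 else of_bool (distinct_adj (coll x r) \<and> distinct_adj (coll y r)
       \<and> length (coll x r) = Suc (j - 1) \<and> length (coll y r) = Suc k) :: bit)"
      if "r \<in> set (shuf (alt x y (Suc (Suc m))) (alt (\<not> s) s (Suc n)))" for r
      using coll_shuf_hd(1)[of r x "alt y x (Suc m)" "\<not> s" "alt s (\<not> s) n"] that by (cases j) auto
    then have "(\<Sum>r\<leftarrow>shuf (alt x y (Suc (Suc m))) (alt (\<not> s) s (Suc n)).
     of_bool (distinct_adj (s # coll x r) \<and> distinct_adj (coll y r)
       \<and> Suc (length (coll x r)) = Suc j \<and> length (coll y r) = Suc k)) =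
       (if j = 0 then 0 else if j - 1 + k = n + m then ch (j - 1) m * ch k m else (0::bit))"
      using Suc.IH[of "j - 1" "\<not> s"]
      by (cases "j = 0") (auto intro!: sum_list_eq_0 simp del: alt.simps cong: map_cong)
    then show ?case
      unfolding R by (cases j; cases m) (auto simp: ch'_def algebra_simps)
  }
qed

text \<open>The shape of a normalized functional that is invariant under flipping either argument:
  an alternating list of bits is determined up to negation by its length.\<close>

definition two_len :: "(nat \<Rightarrow> nat \<Rightarrow> bit) \<Rightarrow> bool list \<Rightarrow> bool list \<Rightarrow> bit" where
  "two_len F a b = (if distinct_adj a \<and> distinct_adj b then F (length a - 1) (length b - 1) else 0)"

lemma sum_list_sum: "(\<Sum>x\<leftarrow>xs. \<Sum>i\<in>I. f x i) = (\<Sum>i\<in>I. \<Sum>x\<leftarrow>xs. f x i :: 'a::comm_monoid_add)"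
  by (induction xs) (simp_all add: sum.distrib)

lemma sum_alt_two_len:
  assumes "x \<noteq> y"
  shows "(\<Sum>r\<leftarrow>shuf (alt x y (Suc (Suc m))) (xb p). two_len F (coll x r) (coll y r)) =
    (\<Sum>j\<le>p + m. ch j m * ch (p + m - j) m * F j (p + m - j))"
proof -
  let ?M = "p + m"
  let ?c = "\<lambda>r j k. of_bool (distinct_adj (coll x r) \<and> distinct_adj (coll y r)
       \<and> length (coll x r) = Suc j \<and> length (coll y r) = Suc k) :: bit"
  have *: "two_len F (coll x r) (coll y r) = (\<Sum>j\<le>?M. \<Sum>k\<le>?M. ?c r j k * F j k)"
    if r: "r \<in> set (shuf (alt x y (Suc (Suc m))) (xb p))" for r
  proof -
    have ne: "coll x r \<noteq> []" "coll y r \<noteq> []"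
      using fst_shuf[OF r] set_alt[of x y m] by (simp_all add: coll_eq_Nil del: alt.simps)
    have "length (coll x r) + length (coll y r) = length r"
    proof -
      have "fst ` set r = {x, y}"
        using fst_shuf[OF r] set_alt[of x y m] by simp
      then have "\<forall>z\<in>set r. fst z = x \<or> fst z = y"
        by auto
      then show ?thesis
        using assms by (induction r) auto
    qed
    moreover have "length r = Suc (Suc ?M)"
      using length_shuf[OF r] by simp
    ultimately have l: "length (coll x r) - 1 \<le> ?M" "length (coll y r) - 1 \<le> ?M"
      using ne[folded length_greater_0_conv] by linarith+
    let ?j = "length (coll x r) - 1" and ?k = "length (coll y r) - 1"
    have cc: "?c r j k = (if distinct_adj (coll x r) \<and> distinct_adj (coll y r) then
        (if j = ?j then (if k = ?k then 1 else 0) else 0) else 0)" for j k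
      using ne by (cases "coll x r"; cases "coll y r") auto
    have mult_delta: "(if b then 1 else 0) * a = (if b then a else 0)" for b and a :: bit
      by simp
    have "(\<Sum>k\<le>?M. ?c r j k * F j k) = (if j = ?j then two_len F (coll x r) (coll y r) else 0)" for j
      unfolding cc two_len_def using l
      by (cases "distinct_adj (coll x r)"; cases "distinct_adj (coll y r)"; cases "j = ?j") (simp_all add: mult_delta)
    then show ?thesis
      using l by simp
  qed
  have gen: "(\<Sum>r\<leftarrow>R. \<Sum>j\<le>?M. \<Sum>k\<le>?M. c r j k * F j k) =
      (\<Sum>j\<le>?M. \<Sum>k\<le>?M. (\<Sum>r\<leftarrow>R. c r j k) * F j k)" for R and c :: "('a \<times> bool) list \<Rightarrow> nat \<Rightarrow> nat \<Rightarrow> bit"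
    by (simp add: sum_list_sum sum_list_mult_const)
  have "(\<Sum>r\<leftarrow>shuf (alt x y (Suc (Suc m))) (xb p). two_len F (coll x r) (coll y r)) =
     (\<Sum>r\<leftarrow>shuf (alt x y (Suc (Suc m))) (xb p). \<Sum>j\<le>?M. \<Sum>k\<le>?M. ?c r j k * F j k)"
    using * by (rule sum_list_cong)
  also have "\<dots> = (\<Sum>j\<le>?M. \<Sum>k\<le>?M. (\<Sum>r\<leftarrow>shuf (alt x y (Suc (Suc m))) (xb p). ?c r j k) * F j k)"
    by (rule gen)
  also have "\<dots> = (\<Sum>j\<le>?M. \<Sum>k\<le>?M. (if j + k = p + m then ch j m * ch k m else 0) * F j k)"
    using sum_of_bool_alt[OF assms, where m = m and s = False and n = p] by simp
  also have "\<dots> = (\<Sum>j\<le>?M. ch j m * ch (?M - j) m * F j (?M - j))"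
  proof (intro sum.cong refl)
    fix j assume "j \<in> {..?M}"
    then have "(if j + k = p + m then ch j m * ch k m else 0) * F j k =
      (if k = ?M - j then ch j m * ch (?M - j) m * F j (?M - j) else 0)" for k
      by auto
    then show "(\<Sum>k\<le>?M. (if j + k = p + m then ch j m * ch k m else 0) * F j k) = ch j m * ch (?M - j) m * F j (?M - j)"
      by simp
  qed
  finally show ?thesis .
qed

lemma cut_sum: "cut g L = (\<Sum>i<length L. g (take (Suc i) L) (drop i L))"
proof (induction L arbitrary: g)
  case (Cons x L)
  then show ?case
    by (simp add: sum.lessThan_Suc_shift del: sum.lessThan_Suc)
qed simp

lemma row2_block_word: "block_word row2 (alt s (\<not> s) (Suc m)) (if s then alt 2 1 (Suc (Suc m)) else alt (1::nat) 2 (Suc (Suc m)))"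
proof -
  have *: "row2 = (\<lambda>t. if t = True then [2, 1] else [1, 2])" "row2 = (\<lambda>t. if t = False then [1, 2] else [2, 1])"
    by (auto simp: row2_def)
  then show ?thesis
    using block_word.full[of 2 "1::nat" True m, folded *(1)] block_word.full[of 1 "2::nat" False m, folded *(2)]
    by (cases s) (auto simp del: alt.simps)
qed

lemma sq_alt:
  assumes "normal2 G"
  shows "sq G (alt s (\<not> s) (Suc m)) ys =
    (\<Sum>r\<leftarrow>shuf (alt (1::nat) 2 (Suc (Suc m))) ys. if s then G (coll 2 r) (coll 1 r) else G (coll 1 r) (coll 2 r))"
proof -
  have F: "sq G (xb m) ys = (\<Sum>r\<leftarrow>shuf (alt (1::nat) 2 (Suc (Suc m))) ys. G (coll 1 r) (coll 2 r))"
    if "normal2 G" for G :: "'a list \<Rightarrow> 'a list \<Rightarrow> bit"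
  proof -
    let ?S = "\<lambda>w. \<Sum>r\<leftarrow>shuf w ys. if fst ` set r \<subseteq> {1, 2 :: nat} then G (coll 1 r) (coll 2 r) else 0"
    have n: "normal (\<lambda>r. if fst ` set r \<subseteq> {1, 2 :: nat} then G (coll 1 r) (coll 2 r) else 0)"
      using coll2_not_distinct_adj that unfolding normal_def normal2_def by auto
    have "sq G (xb m) ys = (\<Sum>w\<leftarrow>tabs (map row2 (xb m)). ?S w)"
      unfolding sq_def
    proof (intro sum_list_cong)
      fix w r assume "w \<in> set (tabs (map row2 (xb m)))" "r \<in> set (shuf w ys)"
      then have "fst ` set r \<subseteq> {1, 2}"
        using set_tabs_row2[of w "xb m"] fst_shuf[of r w ys] by simp
      then show "G (coll 1 r) (coll 2 r) = (if fst ` set r \<subseteq> {1, 2} then G (coll 1 r) (coll 2 r) else 0)"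
        by simp
    qed
    also have "\<dots> = ?S (alt (1::nat) 2 (Suc (Suc m)))"
      using tabs_block_word[OF row2_block_word[of False m] normal_shuf(1)[OF n]] by (simp del: alt.simps)
    also have "\<dots> = (\<Sum>r\<leftarrow>shuf (alt (1::nat) 2 (Suc (Suc m))) ys. G (coll 1 r) (coll 2 r))"
      using set_alt[of 1 "2::nat" m] by (intro sum_list_cong) (auto dest: fst_shuf simp del: alt.simps)
    finally show ?thesis .
  qed
  show ?thesis
  proof (cases s)
    case False
    then show ?thesis
      using F[OF assms] by simp
  next
    case True
    have "alt s (\<not> s) (Suc m) = map Not (xb m)"
      using True by (simp add: map_alt)
    moreover have "normal2 (\<lambda>a b. G b a)"
      using assms by (auto simp: normal2_def)
    ultimately show ?thesis
      using F[of "\<lambda>a b. G b a"] True by (simp add: sq_Not del: alt.simps)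
  qed
qed

lemma phi_alt:
  assumes h: "normal h"
    and inv: "\<And>t. h (map (map_prod id (map_prod Not id)) t) = h t" "\<And>t. h (map (map_prod id (map_prod id Not)) t) = h t"
  shows "phi h (xb q) (xb p) = (\<Sum>i\<le>q. \<Sum>j\<le>p + (q - i).
    ch j (q - i) * ch (p + (q - i) - j) (q - i) * ez3 h (xb i) (xb j) (xb (p + (q - i) - j)))"
proof -
  have e: "ez3 h x a b = two_len (\<lambda>j k. ez3 h x (xb j) (xb k)) a b" if "a \<noteq> []" "b \<noteq> []" for x a b
  proof -
    note ne = that
    show ?thesis
  proof (cases "distinct_adj a \<and> distinct_adj b")
    case True
    obtain u a' v b' where ab: "a = u # a'" "b = v # b'"
      using ne by (cases a; cases b) auto
    have 1: "ez3 h x (map Not y) z = ez3 h x y z" for y z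
      using ez3_map[of h id x Not y id z] by (simp add: inv)
    have 2: "ez3 h x y (map Not z) = ez3 h x y z" for y z
      using ez3_map[of h id x id y Not z] by (simp add: inv)
    have n: "map Not (alt s t k) = alt (\<not> s) (\<not> t) k" for s t k
      by (rule map_alt)
    have "ez3 h x a b = ez3 h x (alt u (\<not> u) (length a)) (alt v (\<not> v) (length b))"
      using True ab distinct_adj_bool_alt[of u a'] distinct_adj_bool_alt[of v b'] by auto
    also have "\<dots> = ez3 h x (xb (length a - 1)) (xb (length b - 1))"
      using that 1[of "xb (length a - 1)"] 2[of _ "xb (length b - 1)"] unfolding n
      by (cases u; cases v) (simp_all del: alt.simps)
    finally show ?thesis
      using True by (simp add: two_len_def)
  next
    case False
    then show ?thesis
      using normal_ez3(2)[OF h] by (auto simp: normal2_def two_len_def)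
  qed
  qed
  have sw: "two_len F b a = two_len (\<lambda>j k. F k j) a b" for F a b
    by (auto simp: two_len_def)
  let ?R = "\<lambda>i. \<Sum>j\<le>p + (q - i).
    ch j (q - i) * ch (p + (q - i) - j) (q - i) * ez3 h (xb i) (xb j) (xb (p + (q - i) - j))"
  have "sq (ez3 h (take (Suc i) (xb q))) (drop i (xb q)) (xb p) = ?R i" if "i \<le> q" for i
  proof -
    have tk: "take (Suc i) (xb q) = xb i"
      using that by (intro take_alt) simp
    have dr: "drop i (xb q) = alt (odd i) (\<not> odd i) (Suc (q - i))"
      using that by (simp add: drop_alt Suc_diff_le del: alt.simps)
    have ne: "coll 1 r \<noteq> []" "coll 2 r \<noteq> []" if "r \<in> set (shuf (alt (1::nat) 2 (Suc (Suc m))) ys)"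
      for r m and ys :: "bool list"
      using fst_shuf[OF that] set_alt[of 1 "2::nat" m] by (simp_all add: coll_eq_Nil del: alt.simps)
    let ?F = "\<lambda>j k. ez3 h (xb i) (xb j) (xb k)"
    have "sq (ez3 h (take (Suc i) (xb q))) (drop i (xb q)) (xb p) =
      (\<Sum>r\<leftarrow>shuf (alt (1::nat) 2 (Suc (Suc (q - i)))) (xb p). two_len (if odd i then (\<lambda>j k. ?F k j) else ?F) (coll 1 r) (coll 2 r))"
      unfolding tk dr sq_alt[OF normal_ez3(2)[OF h]]
    proof (intro sum_list_cong)
      fix r assume r: "r \<in> set (shuf (alt (1::nat) 2 (Suc (Suc (q - i)))) (xb p))"
      show "(if odd i then ez3 h (xb i) (coll 2 r) (coll 1 r) else ez3 h (xb i) (coll 1 r) (coll 2 r)) =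
        two_len (if odd i then (\<lambda>j k. ?F k j) else ?F) (coll 1 r) (coll 2 r)"
        using e[OF ne(2)[OF r] ne(1)[OF r], of "xb i"] e[OF ne(1)[OF r] ne(2)[OF r], of "xb i"]
          sw[of ?F "coll 2 r" "coll 1 r"] by (simp only: if_True if_False split: if_split) simp
    qed
    also have "\<dots> = (\<Sum>j\<le>p + (q - i). ch j (q - i) * ch (p + (q - i) - j) (q - i) *
        (if odd i then (\<lambda>j k. ?F k j) else ?F) j (p + (q - i) - j))"
      by (rule sum_alt_two_len) simp
    also have "\<dots> = ?R i"
    \<comment> \<open>For odd i the back face starts with T, so Steenrod's map switches its factors.
      The coefficient is symmetric in j and k, and reversing the summation undoes the
      switch.\<close>
    proof (cases "odd i")
      case True
      show ?thesis
        by (subst sum.atLeastAtMost_rev[of _ 0 "p + (q - i)", folded atMost_atLeast0])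
           (use True in \<open>auto intro!: sum.cong simp: mult.commute\<close>)
    qed simp
    finally show ?thesis .
  qed
  then show ?thesis
    unfolding phi_def cut_sum by (simp add: lessThan_Suc_atMost del: alt.simps(2) take_Suc_Cons)
qed

section \<open>Composed table reductions\<close>

text \<open>
  The terms of the operadic composite of an alternating word having \<open>n + 1\<close> letters with \<open>fs\<close> and \<open>os\<close>:
  the word switches \<open>n\<close> times between \<open>fs\<close> and \<open>os\<close>, and after an interruption each of them resumes
  with the letter it has written last.
\<close>

fun switch_words :: "nat \<Rightarrow> 'a list \<Rightarrow> 'a list \<Rightarrow> 'a list list" where
  "switch_words n [] os = []"
| "switch_words n (x # fs) os = map ((#) x) ((if n = 0 \<and> fs = [] \<and> length os = 1 then [[]] else [])
     @ switch_words n fs os @ (if n = 0 then [] else switch_words (n - 1) os (x # fs)))"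

declare switch_words.simps(2) [simp del]

lemma sum_switch_words_Cons:
  "(\<Sum>w\<leftarrow>switch_words n (x # fs) os. f w) = (if n = 0 \<and> fs = [] \<and> length os = 1 then f [x] else 0)
    + (\<Sum>w\<leftarrow>switch_words n fs os. f (x # w)) + (if n = 0 then 0 else \<Sum>w\<leftarrow>switch_words (n - 1) os (x # fs). f (x # w))"
  for f :: "'a list \<Rightarrow> bit"
  by (simp add: switch_words.simps(2) o_def add.assoc)

lemma switch_words_not_Nil: "w \<in> set (switch_words n fs os) \<Longrightarrow> w \<noteq> []"
  by (cases fs) (auto simp: switch_words.simps(2))

lemma switch_words_0: "switch_words 0 (x # fs) os = (if length os = 1 then [x # fs] else [])"
  by (induction fs arbitrary: x) (simp_all add: switch_words.simps(2))

text \<open>The continuations when the first letter of \<open>fs\<close> has just been written and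
  may go on. With no vertices left the division is complete exactly if no further letter is
  pending.\<close>

definition resume :: "'a list \<Rightarrow> 'b list \<Rightarrow> ('a \<times> 'b) list list" where
  "resume fs M = (if M = [] then if length fs = 1 then [[]] else [] else shuf fs M)"

lemma resume_Nil: "M \<noteq> [] \<Longrightarrow> resume [] M = []"
  by (simp add: resume_def)

lemma sum_resume_Cons:
  "(\<Sum>r\<leftarrow>resume (x # fs) (v # M). f r) =
    (\<Sum>r\<leftarrow>resume fs (v # M). f ((x, v) # r)) + (\<Sum>r\<leftarrow>resume (x # fs) M. f ((x, v) # r))"
  for f :: "_ \<Rightarrow> bit"
  by (simp add: resume_def sum_shuf_Cons add.commute)

lemma sum_list_swap:
  fixes f :: "_ \<Rightarrow> _ \<Rightarrow> 'c :: comm_monoid_add"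
  shows "(\<Sum>x\<leftarrow>xs. \<Sum>y\<leftarrow>ys. f x y) = (\<Sum>y\<leftarrow>ys. \<Sum>x\<leftarrow>xs. f x y)"
  by (induction xs) (simp_all add: sum_list_addf)

text \<open>Composition of surjections on divisions. After a pair of letter and vertex there are
  three ways on: the next letter of the same block at this vertex, a switch of blocks at this
  vertex, or the next vertex. A switch is a step of the outer word in x and y; changes of letter
  within a block belong to the inner divisions. The predicate \<open>P\<close> tells the two blocks
  apart.\<close>

lemma sum_switch_words_shuf:
  assumes "x \<noteq> y" "\<forall>l\<in>set fs. P l" "\<forall>l\<in>set os. \<not> P l"
  shows "(\<Sum>w\<leftarrow>switch_words n fs os. \<Sum>p\<leftarrow>shuf w L. g (filter (\<lambda>z. P (fst z)) p) (filter (\<lambda>z. \<not> P (fst z)) p)) =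
    (\<Sum>p\<leftarrow>shuf (alt x y (Suc n)) L. \<Sum>r\<leftarrow>resume fs (coll x p). \<Sum>s\<leftarrow>resume os (coll y p). (g r s :: bit))"
  using assms
proof (induction n fs os arbitrary: L g P x y rule: switch_words.induct)
  case (1 n os)
  have "coll x p \<noteq> []" if "p \<in> set (shuf (alt x y (Suc n)) L)" for p
    using fst_shuf[OF that] by (simp add: coll_eq_Nil)
  then have "(\<Sum>p\<leftarrow>shuf (alt x y (Suc n)) L. \<Sum>r\<leftarrow>resume [] (coll x p). \<Sum>s\<leftarrow>resume os (coll y p). g r s) = 0"
    by (intro sum_list_eq_0[where f = "\<lambda>p. \<Sum>r\<leftarrow>resume [] (coll x p). _ p r"]) (simp add: resume_Nil del: alt.simps)
  then show ?case
    by simp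
next
  case (2 n a fs os)
  show ?case
  proof (induction L arbitrary: g)
    case (Cons v L)
    define h where "h = (\<lambda>r s. g ((a, v) # r) s)"
    define F where "F = (\<lambda>p. h (filter (\<lambda>z. P (fst z)) p) (filter (\<lambda>z. \<not> P (fst z)) p))"
    define S where "S = (\<lambda>p. \<Sum>r\<leftarrow>resume (a # fs) (coll x p). \<Sum>s\<leftarrow>resume os (coll y p). h r s)"
    define S' where "S' = (\<lambda>p. \<Sum>r\<leftarrow>resume fs (v # coll x p). \<Sum>s\<leftarrow>resume os (coll y p). h r s)"
    have a: "P a"
      using 2 by simp
    have E: "g (filter (\<lambda>z. P (fst z)) ((a, v) # p)) (filter (\<lambda>z. \<not> P (fst z)) ((a, v) # p)) = F p" for p
      using a by (simp add: F_def h_def)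
    have step: "(\<Sum>p\<leftarrow>shuf (a # w) (v # L). g (filter (\<lambda>z. P (fst z)) p) (filter (\<lambda>z. \<not> P (fst z)) p)) =
      (if w = [] \<and> L = [] then F [] else 0) + (\<Sum>p\<leftarrow>shuf w (v # L). F p) + (\<Sum>p\<leftarrow>shuf (a # w) L. F p)" for w
      unfolding sum_shuf_Cons E ..
    have IH1: "(\<Sum>w\<leftarrow>switch_words n fs os. \<Sum>p\<leftarrow>shuf w (v # L). F p) = (\<Sum>p\<leftarrow>shuf (alt x y (Suc n)) (v # L).
       \<Sum>r\<leftarrow>resume fs (coll x p). \<Sum>s\<leftarrow>resume os (coll y p). h r s)"
      unfolding F_def by (rule 2(1)) (use 2 in auto)
    \<comment> \<open>After a switch \<open>os\<close> is the active block, so the induction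
      hypothesis is used with \<open>P\<close> negated and the arguments of \<open>g\<close>
      exchanged.\<close>
    have IH2: "(\<Sum>w\<leftarrow>switch_words (n - 1) os (a # fs). \<Sum>p\<leftarrow>shuf w (v # L). F p) = (\<Sum>p\<leftarrow>shuf (alt y x n) (v # L). S p)"
      if "n \<noteq> 0"
    proof -
      have "(\<Sum>w\<leftarrow>switch_words (n - 1) os (a # fs). \<Sum>p\<leftarrow>shuf w (v # L). F p) = (\<Sum>p\<leftarrow>shuf (alt y x (Suc (n - 1))) (v # L).
         \<Sum>s\<leftarrow>resume os (coll y p). \<Sum>r\<leftarrow>resume (a # fs) (coll x p). h r s)"
        using 2(2)[OF that, of y x "\<lambda>l. \<not> P l" "\<lambda>s r. h r s" "v # L"] 2(3-5) by (simp add: F_def)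
      also have "\<dots> = (\<Sum>p\<leftarrow>shuf (alt y x n) (v # L). S p)"
        unfolding S_def Suc_diff_1[OF that[unfolded neq0_conv]] by (intro sum_list_cong sum_list_swap)
      finally show ?thesis .
    qed
    have IH3: "(\<Sum>w\<leftarrow>switch_words n (a # fs) os. \<Sum>p\<leftarrow>shuf w L. F p) = (\<Sum>p\<leftarrow>shuf (alt x y (Suc n)) L. S p)"
      unfolding F_def S_def by (rule Cons.IH)
    have z: "(\<Sum>w\<leftarrow>switch_words m A B. if w = [] \<and> L = [] then F [] else 0) = 0" for m A B
      using switch_words_not_Nil by (intro sum_list_eq_0) auto
    have "(\<Sum>w\<leftarrow>switch_words n (a # fs) os. \<Sum>p\<leftarrow>shuf w (v # L). g (filter (\<lambda>z. P (fst z)) p) (filter (\<lambda>z. \<not> P (fst z)) p)) =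
      (if n = 0 \<and> fs = [] \<and> length os = 1 \<and> L = [] then F [] else 0)
      + (\<Sum>w\<leftarrow>switch_words n fs os. \<Sum>p\<leftarrow>shuf w (v # L). F p)
      + (if n = 0 then 0 else \<Sum>w\<leftarrow>switch_words (n - 1) os (a # fs). \<Sum>p\<leftarrow>shuf w (v # L). F p)
      + (\<Sum>w\<leftarrow>switch_words n (a # fs) os. \<Sum>p\<leftarrow>shuf w L. F p)"
      unfolding sum_switch_words_Cons step sum_list_addf z by (auto simp: bit_cancel)
    also have "\<dots> = (if n = 0 \<and> fs = [] \<and> length os = 1 \<and> L = [] then F [] else 0)
      + (\<Sum>p\<leftarrow>shuf (alt x y (Suc n)) (v # L). \<Sum>r\<leftarrow>resume fs (coll x p). \<Sum>s\<leftarrow>resume os (coll y p). h r s)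
      + (\<Sum>p\<leftarrow>shuf (alt y x n) (v # L). S p) + (\<Sum>p\<leftarrow>shuf (alt x y (Suc n)) L. S p)"
      unfolding IH1 IH3 using IH2 by (cases "n = 0") auto
    also have "(if n = 0 \<and> fs = [] \<and> length os = 1 \<and> L = [] then F [] else 0) = (if n = 0 \<and> L = [] then S [] else 0)"
      by (auto simp: S_def F_def resume_def)
    also have "\<dots> + (\<Sum>p\<leftarrow>shuf (alt x y (Suc n)) (v # L). \<Sum>r\<leftarrow>resume fs (coll x p). \<Sum>s\<leftarrow>resume os (coll y p). h r s)
      + (\<Sum>p\<leftarrow>shuf (alt y x n) (v # L). S p) + (\<Sum>p\<leftarrow>shuf (alt x y (Suc n)) L. S p) =
      (\<Sum>p\<leftarrow>shuf (alt x y (Suc n)) (v # L). \<Sum>r\<leftarrow>resume (a # fs) (coll x p). \<Sum>s\<leftarrow>resume os (coll y p). g r s)"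
    proof -
      have c: "coll x ((x, v) # p) = v # coll x p" "coll y ((x, v) # p) = coll y p" for p
        using \<open>x \<noteq> y\<close> by auto
      show ?thesis
        unfolding alt.simps(2) sum_shuf_Cons c sum_resume_Cons alt_eq_Nil
        by (simp add: S_def h_def sum_list_addf add.assoc add.commute add.left_commute)
    qed
    finally show ?case .
  qed simp
qed

definition block_row :: "('c \<Rightarrow> 'a list) \<Rightarrow> ('d \<Rightarrow> 'a list) \<Rightarrow> bool \<times> 'c \<times> 'd \<Rightarrow> 'a list" where
  "block_row f g = (\<lambda>(r, s, t). if r then g t @ f s else f s @ g t)"

lemma block_row_simps [simp]: "block_row f g (False, s, t) = f s @ g t" "block_row f g (True, s, t) = g t @ f s"
  by (simp_all add: block_row_def)

lemma ez3_Cons: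
  "ez3 h (x # xs) (y # ys) (z # zs) = (if xs = [] \<and> ys = [] \<and> zs = [] then h [(x, y, z)] else 0)
    + ez3 (\<lambda>t. h ((x, y, z) # t)) xs (y # ys) (z # zs)
    + ez3 (\<lambda>t. h ((x, y, z) # t)) (x # xs) ys (z # zs)
    + ez3 (\<lambda>t. h ((x, y, z) # t)) (x # xs) (y # ys) zs"
proof -
  let ?k = "\<lambda>t. h ((x, y, z) # t)"
  have 1: "(\<Sum>t\<leftarrow>shuf (x # xs) ((y, z) # s). h t) = (if xs = [] \<and> s = [] then h [(x, y, z)] else 0)
     + (\<Sum>t\<leftarrow>shuf xs ((y, z) # s). ?k t) + (\<Sum>t\<leftarrow>shuf (x # xs) s. ?k t)" for s
    by (rule sum_shuf_Cons)
  have 0: "(\<Sum>s\<leftarrow>shuf A B. if xs = [] \<and> s = [] then c else 0) = (0::bit)" for A :: "'b list" and B :: "'c list" and c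
    using shuf_not_Nil by (intro sum_list_eq_0) auto
  show ?thesis
    by (simp add: ez3_def sum_shuf_Cons[of _ y ys z zs] 1 0 sum_list_addf bit_cancel)
qed

lemma ez3_cong_hd:
  assumes "\<And>t. f ((hd A, hd B, hd C) # t) = g ((hd A, hd B, hd C) # t)"
  shows "ez3 f A B C = ez3 g A B C"
proof -
  have "f t = g t" if "s \<in> set (shuf B C)" "t \<in> set (shuf A s)" for s t
    using shuf_hd[OF that(1)] shuf_hd[OF that(2)] shuf_not_Nil[OF that(2)] assms[of "tl t"] by (cases t) auto
  then show ?thesis
    unfolding ez3_def by (intro sum_list_cong) auto
qed

lemma ez3_Not_swap:
  fixes x :: "bool list"
  shows "ez3 h (map Not x) b a = ez3 (\<lambda>t. h (map (map_prod Not prod.swap) t)) x a b"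
proof -
  have "ez3 h (map Not x) b a = ez3 h (map Not x) (map id b) (map id a)"
    by simp
  also have "\<dots> = ez3 (\<lambda>t. h (map (map_prod Not id) t)) x b a"
    unfolding ez3_map by (simp add: prod.map_id0)
  also have "\<dots> = ez3 (\<lambda>t. h (map (map_prod Not prod.swap) t)) x a b"
    unfolding ez3_swap[of _ _ b a] by (simp add: o_def map_prod_def case_prod_unfold)
  finally show ?thesis .
qed

definition block_sum :: "('a list \<Rightarrow> bit) \<Rightarrow> (bool \<Rightarrow> 'a list) \<Rightarrow> (bool \<Rightarrow> 'a list) \<Rightarrow> (bool \<times> bool \<times> bool) list \<Rightarrow> bit" where
  "block_sum G f g t = (\<Sum>w\<leftarrow>tabs (map (block_row f g) t). G w)"

lemma block_sum_swap: "ez3 (block_sum G f g) (map Not x) ys zs = ez3 (block_sum G g f) x zs ys"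
proof -
  have "map (block_row f g) (map (map_prod Not prod.swap) t) = map (block_row g f) t" for t
    by (auto simp: block_row_def map_prod_def)
  then show ?thesis
    unfolding ez3_Not_swap block_sum_def by (simp del: map_map)
qed

text \<open>The first letter a is either followed by more of its row, and then deleted below, or it
  ends the row. In the second case the path moves to the next row by a step in one of its three
  coordinates.\<close>

lemma block_sum_step:
  assumes row: "block_row f g (x, y, z) = a # r" "a \<notin> set r"
  shows "ez3 (block_sum G f g) (x # xs) (y # ys) (z # zs) =
    ez3 (block_sum (\<lambda>w. G (a # w)) (removeAll a \<circ> f) (removeAll a \<circ> g)) (x # xs) (y # ys) (z # zs)
    + ez3 (block_sum (\<lambda>w. G (a # w)) f g) xs (y # ys) (z # zs)
    + ez3 (block_sum (\<lambda>w. G (a # w)) f g) (x # xs) ys (z # zs)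
    + ez3 (block_sum (\<lambda>w. G (a # w)) f g) (x # xs) (y # ys) zs"
proof -
  let ?Z = "block_sum (\<lambda>w. G (a # w)) f g"
  let ?Z' = "block_sum (\<lambda>w. G (a # w)) (removeAll a \<circ> f) (removeAll a \<circ> g)"
  have rem: "map (removeAll a) (map (block_row f g) t) = map (block_row (removeAll a \<circ> f) (removeAll a \<circ> g)) t" for t
    by (auto simp: block_row_def)
  have "block_sum G f g ((x, y, z) # t) = ?Z' ((x, y, z) # t) + ?Z t" for t
  proof -
    have "block_row (removeAll a \<circ> f) (removeAll a \<circ> g) (x, y, z) = removeAll a (block_row f g (x, y, z))"
      by (auto simp: block_row_def)
    then have "block_row (removeAll a \<circ> f) (removeAll a \<circ> g) (x, y, z) = r"
      using row by simp
    then show ?thesis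
      unfolding block_sum_def list.map(2) row(1) sum_tabs_Cons rem by (simp only: add.commute)
  qed
  then have "ez3 (block_sum G f g) (x # xs) (y # ys) (z # zs) = ez3 (\<lambda>t. ?Z' t + ?Z (tl t)) (x # xs) (y # ys) (z # zs)"
    by (intro ez3_cong_hd) simp
  also have "\<dots> = ez3 ?Z' (x # xs) (y # ys) (z # zs) + ez3 (\<lambda>t. ?Z (tl t)) (x # xs) (y # ys) (z # zs)"
    by (rule ez3_add)
  also have "ez3 (\<lambda>t. ?Z (tl t)) (x # xs) (y # ys) (z # zs) = ez3 ?Z xs (y # ys) (z # zs)
    + ez3 ?Z (x # xs) ys (z # zs) + ez3 ?Z (x # xs) (y # ys) zs"
    by (simp add: ez3_Cons[of "\<lambda>t. ?Z (tl t)"] block_sum_def[of _ _ _ "[]"])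
  finally show ?thesis
    by (simp only: add.assoc)
qed

lemma normal_block_sum:
  assumes "normal G" "\<And>t. distinct (f t)" "\<And>t. distinct (g t)" "\<And>s t. set (f s) \<inter> set (g t) = {}"
  shows "normal (block_sum G f g)"
proof -
  have "distinct (block_row f g t)" for t
    using assms(2,3) assms(4)[unfolded disjoint_iff] by (cases t) (auto simp: block_row_def)
  then show ?thesis
    unfolding block_sum_def[abs_def] by (intro normal_tabs[OF assms(1)])
qed

text \<open>With a constant first block the rows do not depend on the second coordinate, so making
  that coordinate constant changes nothing and produces a degenerate list.\<close>

lemma block_sum_const_eq_0:
  assumes "normal G" "distinct c" "\<And>t. distinct (g t)" "\<And>t. set c \<inter> set (g t) = {}" "length ys \<ge> 2"
  shows "ez3 (block_sum G (\<lambda>_. c) g) xs ys zs = 0"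
proof -
  have "block_sum G (\<lambda>_. c) g (map (map_prod id (map_prod (\<lambda>_. True) id)) t) = block_sum G (\<lambda>_. c) g t" for t
    unfolding block_sum_def by (auto simp: block_row_def o_def intro!: arg_cong[where f = "\<lambda>T. sum_list (map G (tabs T))"])
  then have "ez3 (block_sum G (\<lambda>_. c) g) xs ys zs = ez3 (block_sum G (\<lambda>_. c) g) xs (map (\<lambda>_. True) ys) zs"
    using ez3_map[of "block_sum G (\<lambda>_. c) g" id xs "\<lambda>_. True" ys id zs] by simp
  moreover have "\<not> distinct_adj (map (\<lambda>_. True) ys)"
    using assms(5) by (cases ys; cases "tl ys") auto
  ultimately show ?thesis
    using normal_ez3(2)[OF normal_block_sum[of G "\<lambda>_. c" g]] assms(1-4) by (simp add: normal2_def)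
qed

lemma block_sum_empty:
  assumes "block_word g zs os" "normal G" "length xs = 1" "length ys = 1"
  shows "ez3 (block_sum G (\<lambda>_. []) g) xs ys zs = G os"
proof -
  obtain x y where xy: "xs = [x]" "ys = [y]"
    using assms(3,4) by (auto simp: length_Suc_conv One_nat_def)
  have s: "shuf [u] L = (if L = [] then [] else [map (Pair u) L])" for u :: 'u and L :: "'v list"
    by (induction L) (auto simp: shuf.simps(3))
  have zs: "zs \<noteq> []"
    using assms(1) by (auto elim: block_word.cases)
  have "map (block_row (\<lambda>_. []) g) (map (Pair x) (map (Pair y) zs)) = map g zs"
    by (auto simp: block_row_def)
  then have "ez3 (block_sum G (\<lambda>_. []) g) xs ys zs = (\<Sum>w\<leftarrow>tabs (map g zs). G w)"
    by (simp add: ez3_def xy s zs block_sum_def del: map_map)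
  then show ?thesis
    using tabs_block_word[OF assms(1,2)] by simp
qed

text \<open>When one block is empty, the order of the blocks is irrelevant, so the rows do not see
  the first coordinate.\<close>

lemma block_sum_empty_0:
  assumes "normal G" "\<And>t. distinct (g t)" "length xs \<ge> 2"
  shows "ez3 (block_sum G (\<lambda>_. []) g) xs ys zs = 0"
proof -
  have "block_sum G (\<lambda>_. []) g (map (map_prod (\<lambda>_. True) (map_prod id id)) t) = block_sum G (\<lambda>_. []) g t" for t
    unfolding block_sum_def by (auto simp: block_row_def o_def intro!: arg_cong[where f = "\<lambda>T. sum_list (map G (tabs T))"])
  then have "ez3 (block_sum G (\<lambda>_. []) g) xs ys zs = ez3 (block_sum G (\<lambda>_. []) g) (map (\<lambda>_. True) xs) ys zs"
    using ez3_map[of "block_sum G (\<lambda>_. []) g" "\<lambda>_. True" xs id ys id zs] by simp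
  moreover have "\<not> distinct_adj (map (\<lambda>_. True) xs)"
    using assms(3) by (cases xs; cases "tl xs") auto
  ultimately show ?thesis
    using normalD[OF normal_ez3(1)[OF normal_block_sum[of G "\<lambda>_. []" g]]] assms(1,2) by simp
qed

lemma hd_alt: "hd (alt x y (Suc k)) = x"
  by simp

lemma block_word_facts:
  assumes "block_word f ys fs"
  shows "ys \<noteq> []" "fs \<noteq> []" "distinct (f t)" "set (f t) = set fs" "hd (f (hd ys)) = hd fs" "f t \<noteq> []"
  using assms by (induction rule: block_word.induct) (auto simp: set_alt hd_alt simp del: alt.simps)

text \<open>Table reduction of a product of three alternating simplices is the operadic composite of
  their alternating words. The induction follows the first letter written. With n entries in the
  first coordinate its own word has n + 1 letters, hence n switches.\<close>

lemma block_sum_eq_switch_words: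
  assumes "block_word f ys fs" "block_word g zs os" "set fs \<inter> set os = {}" "normal G" "n > 0"
  shows "ez3 (block_sum G f g) (alt False True n) ys zs = (\<Sum>w\<leftarrow>switch_words n fs os. G w)"
  using assms
proof (induction "n + length ys + length zs + length fs + length os" arbitrary: n f ys fs g zs os G rule: less_induct)
  case less
  note f = block_word_facts[OF less.prems(1)] and g = block_word_facts[OF less.prems(2)]
  obtain n' where n: "n = Suc n'"
    using less.prems(5) by (cases n) auto
  obtain y ys' where ys: "ys = y # ys'"
    using f(1) by (cases ys) auto
  obtain z zs' where zs: "zs = z # zs'"
    using g(1) by (cases zs) auto
  obtain a fs' where fs: "fs = a # fs'"
    using f(2) by (cases fs) auto
  obtain r where r: "f y = a # r" "a \<notin> set r"
    using f(3)[of y] f(5) f(6)[of y] ys fs by (cases "f y") auto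
  have row: "block_row f g (False, y, z) = a # (r @ g z)"
    using r by simp
  have ag: "a \<notin> set (g t)" for t
    using g(4)[of t] less.prems(3) fs by auto
  define H where "H = (\<lambda>w. G (a # w))"
  have H: "normal H"
    unfolding H_def by (rule normal_Cons[OF less.prems(4)])
  have rg: "removeAll a \<circ> g = g"
    using ag by auto
  have G0: "G (a # a # w) = 0" for w
    using less.prems(4) by (simp add: normal_def)
  have step: "ez3 (block_sum G f g) (alt False True n) ys zs =
    ez3 (block_sum H (removeAll a \<circ> f) g) (alt False True n) ys zs
    + ez3 (block_sum H f g) (alt True False n') ys zs
    + ez3 (block_sum H f g) (alt False True n) ys' zs
    + ez3 (block_sum H f g) (alt False True n) ys zs'"
    using block_sum_step[OF row, where G = G and xs = "alt True False n'" and ys = ys' and zs = zs'] r(2) ag[of z] by (simp add: n ys zs H_def rg)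
  \<comment> \<open>A step in the third coordinate leaves \<open>f y\<close> in front, so the next
    row begins with the letter a just written.\<close>
  have zstep: "ez3 (block_sum H f g) (alt False True n) ys zs' = 0"
  proof -
    have "block_sum H f g ((False, y, hd zs') # t) = 0" for t
    proof -
      have b: "block_row f g (False, y, hd zs') = a # (r @ g (hd zs'))"
        using r by simp
      show ?thesis
        unfolding block_sum_def list.map(2) b sum_tabs_Cons H_def by (simp add: G0)
    qed
    then have "ez3 (block_sum H f g) (alt False True n) ys zs' = ez3 (\<lambda>_. 0) (alt False True n) ys zs'"
      by (intro ez3_cong_hd) (simp add: n ys)
    then show ?thesis
      by simp
  qed
  \<comment> \<open>A step in the first coordinate reverses the order of the blocks: the other block
    writes next, and one switch is used up.\<close>
  have xstep: "ez3 (block_sum H f g) (alt True False n') ys zs = (if n' = 0 then 0 else \<Sum>w\<leftarrow>switch_words n' os fs. H w)"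
  proof (cases "n' = 0")
    case False
    have "alt True False n' = map Not (alt False True n')"
      by (simp add: map_alt)
    then have "ez3 (block_sum H f g) (alt True False n') ys zs = ez3 (block_sum H g f) (alt False True n') zs ys"
      by (simp only: block_sum_swap)
    also have "\<dots> = (\<Sum>w\<leftarrow>switch_words n' os fs. H w)"
      using less.prems H False by (intro less.hyps) (auto simp: n)
    finally show ?thesis
      using False by simp
  qed simp
  have cw_eq: "(\<Sum>w\<leftarrow>switch_words n fs os. G w) = (\<Sum>w\<leftarrow>switch_words n fs' os. H w) + (\<Sum>w\<leftarrow>switch_words n' os fs. H w)"
    unfolding fs sum_switch_words_Cons by (simp add: n H_def)
  have gd: "distinct (g t)" for t
    using less.prems(2) by (rule block_word_facts)
  show ?case
    using less.prems(1)
  proof (cases rule: block_word.cases)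
    case (full a' b s m)
    then have fs': "fs' = alt b a (Suc m)" and a': "a' = a" and ys': "ys' = alt (\<not> s) s m" and y: "y = s"
      using fs ys by auto
    have rf: "removeAll a \<circ> f = (\<lambda>_. [b])"
      unfolding full(1) using full(4) a' by auto
    have c0: "n' = 0 \<Longrightarrow> switch_words n' os fs = []"
      using g(2) fs fs' by (cases os) (simp_all add: switch_words_0)
    have bg: "set [b] \<inter> set (g t) = {}" for t
      using less.prems(3) g(4)[of t] fs fs' by auto
    \<comment> \<open>Exactly one of the two terms contributes. On the last row no step in the
      second coordinate is left; on an earlier one deleting a makes the block constant and the first
      term vanishes.\<close>
    have "ez3 (block_sum H (removeAll a \<circ> f) g) (alt False True n) ys zs + ez3 (block_sum H f g) (alt False True n) ys' zs
       = (\<Sum>w\<leftarrow>switch_words n fs' os. H w)"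
    proof (cases m)
      case 0
      have "ez3 (block_sum H (\<lambda>_. [b]) g) (alt False True n) ys zs = (\<Sum>w\<leftarrow>switch_words n [b] os. H w)"
        using less.prems H 0 full(2,3) block_word.one[of b s] fs' fs
        by (intro less.hyps) auto
      then show ?thesis
        using 0 by (simp add: rf fs' ys')
    next
      case (Suc m')
      have "ez3 (block_sum H (\<lambda>_. [b]) g) (alt False True n) ys zs = 0"
        using H gd bg by (intro block_sum_const_eq_0) (simp_all add: ys ys' Suc)
      moreover have "f = (\<lambda>t. if t = (\<not> s) then [b, a] else [a, b])"
        unfolding full(1) a' by auto
      then have "block_word f ys' fs'"
        using block_word.full[of b a "\<not> s" m'] full(4) a' by (simp add: ys' fs' Suc del: alt.simps)
      then have "ez3 (block_sum H f g) (alt False True n) ys' zs = (\<Sum>w\<leftarrow>switch_words n fs' os. H w)"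
        using less.prems H fs ys by (intro less.hyps) auto
      ultimately show ?thesis
        by (simp add: rf)
    qed
    then show ?thesis
      unfolding step zstep xstep cw_eq using c0 by (auto simp: bit_cancel)
  next
    case (one a' s)
    then have fs': "fs' = []" and a': "a' = a" and ys': "ys' = []"
      using fs ys by auto
    have rf: "removeAll a \<circ> f = (\<lambda>_. [])"
      unfolding one(1) a' by auto
    have "ez3 (block_sum H (\<lambda>_. []) g) (alt False True n) ys zs = (if n' = 0 then H os else 0)"
      using block_sum_empty[OF less.prems(2) H, where xs = "alt False True n" and ys = ys]
        block_sum_empty_0[OF H gd, where xs = "alt False True n" and ys = ys and zs = zs]
      by (simp add: n ys ys' del: alt.simps)
    moreover have "n' = 0 \<Longrightarrow> switch_words n' os fs = [os]"
      using g(2) by (cases os) (simp_all add: switch_words_0 fs fs')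
    ultimately show ?thesis
      unfolding step zstep xstep cw_eq by (simp add: rf fs' ys')
  qed
qed

section \<open>Evaluation of chains and of cochain operations\<close>

definition ev :: "('x \<Rightarrow> bit) \<Rightarrow> ('x \<Rightarrow>\<^sub>0 bit) \<Rightarrow> bit" where
  "ev f c = (\<Sum>x \<in> Poly_Mapping.keys c. f x)"

lemma ev_eq_sum:
  assumes "finite S" "Poly_Mapping.keys c \<subseteq> S"
  shows "ev f c = (\<Sum>x\<in>S. Poly_Mapping.lookup c x * f x)"
proof -
  have "ev f c = (\<Sum>x\<in>Poly_Mapping.keys c. Poly_Mapping.lookup c x * f x)"
    unfolding ev_def by (intro sum.cong refl) (simp add: in_keys_iff)
  also have "\<dots> = (\<Sum>x\<in>S. Poly_Mapping.lookup c x * f x)"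
    using assms by (intro sum.mono_neutral_left) (auto simp: in_keys_iff)
  finally show ?thesis .
qed

lemma ev_0 [simp]: "ev f 0 = 0"
  by (simp add: ev_def)

lemma ev_single [simp]: "ev f (Poly_Mapping.single x 1) = f x"
  by (simp add: ev_def)

lemma ev_add: "ev f (c + d) = ev f c + ev f d"
proof -
  let ?S = "Poly_Mapping.keys c \<union> Poly_Mapping.keys d"
  have "finite ?S" "Poly_Mapping.keys (c + d) \<subseteq> ?S"
    by (simp_all add: Poly_Mapping.keys_add)
  then show ?thesis
    using ev_eq_sum[of ?S "c + d" f] ev_eq_sum[of ?S c f] ev_eq_sum[of ?S d f]
    by (simp add: lookup_add distrib_right sum.distrib)
qed

lemma ev_sum: "ev f (\<Sum>i\<in>I. c i) = (\<Sum>i\<in>I. ev f (c i))"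
  by (induction I rule: infinite_finite_induct) (simp_all add: ev_add)

lemma ev_lin: "ev f (lin g c) = ev (\<lambda>x. ev f (g x)) c"
  unfolding lin_def by (simp only: ev_sum ev_def[of "\<lambda>x. ev f (g x)"])

lemma ev_tensor: "ev f (tensor c d) = ev (\<lambda>x. ev (\<lambda>y. f (x, y)) d) c"
  by (simp add: tensor_def ev_lin)

lemma ev_switch: "ev f (switch c) = ev (\<lambda>(x, y). f (y, x)) c"
  by (simp add: switch_def ev_lin case_prod_unfold)

lemma ev_cls: "ev f (cls X k u) = (if degenerate X k u then 0 else f (k, u))"
  by (simp add: cls_def)

lemma ev_push: "ev f (push h Y c) = ev (\<lambda>(k, u). if degenerate Y k (h u) then 0 else f (k, h u)) c"
  by (simp add: push_def ev_lin case_prod_unfold ev_cls)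

lemma ev_cong: "(\<And>x. x \<in> Poly_Mapping.keys c \<Longrightarrow> f x = g x) \<Longrightarrow> ev f c = ev g c"
  unfolding ev_def by (rule sum.cong) auto

section \<open>Divisions into intervals as lattice paths\<close>

fun path :: "'a list \<Rightarrow> nat list \<Rightarrow> ('a \<times> nat) list" where
  "path (x # A) (k # k' # ks) = map (Pair x) [k..<Suc k'] @ path A (k' # ks)"
| "path _ _ = []"

definition cuts :: "'a list \<Rightarrow> nat \<Rightarrow> nat \<Rightarrow> nat list set" where
  "cuts A a N = {ks. length ks = Suc (length A) \<and> sorted ks \<and> hd ks = a \<and> last ks = N}"

lemma finite_cuts: "finite (cuts A a N)"
proof (rule finite_subset)
  have "k \<le> last ks" if "sorted ks" "k \<in> set ks" for k :: nat and ks
    using that by (induction ks) (auto split: if_splits)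
  then show "cuts A a N \<subseteq> {ks. set ks \<subseteq> {..N} \<and> length ks = Suc (length A)}"
    by (auto simp: cuts_def)
qed (simp add: finite_lists_length_eq)

lemma shuf_single: "shuf [x] L = (if L = [] then [] else [map (Pair x) L])"
  by (induction L) (auto simp: shuf.simps(3))

text \<open>A path is determined by the vertices at which the letter changes, and any weakly
  increasing sequence of such vertices occurs.\<close>

lemma sum_shuf_cuts:
  assumes "A \<noteq> []" "a \<le> N"
  shows "(\<Sum>p\<leftarrow>shuf A [a..<Suc N]. F p) = (\<Sum>ks\<in>cuts A a N. F (path A ks) :: bit)"
  using assms
proof (induction A arbitrary: a F)
  case (Cons x A)
  show ?case
  proof (cases "A = []")
    case True
    have "ks = [a, N]" if "ks \<in> cuts [x] a N" for ks
      using that by (cases ks; cases "tl ks"; cases "tl (tl ks)") (auto simp: cuts_def)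
    then have "cuts [x] a N = {[a, N]}"
      using Cons.prems by (auto simp: cuts_def)
    then show ?thesis
      using Cons.prems True by (simp add: shuf_single del: upt_Suc)
  next
    case False
    note IH = Cons.IH[OF False]
    show ?thesis
      using Cons.prems(2)
    proof (induction "N - a" arbitrary: a F)
      case 0
      then have a: "a = N"
        by simp
      have "cuts (x # A) N N = (#) N ` cuts A N N"
      proof (intro Set.set_eqI iffI)
        fix ks assume *: "ks \<in> cuts (x # A) N N"
        then obtain k ks' where ks: "ks = N # k # ks'"
          by (cases ks; cases "tl ks") (auto simp: cuts_def)
        have "k \<le> last (k # ks')" if "sorted (k # ks')" for k :: nat and ks'
          using that by (cases ks') auto
        then have "k = N"
          using * ks by (fastforce simp: cuts_def)
        then have "k # ks' \<in> cuts A N N"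
          using * by (simp add: ks cuts_def)
        then show "ks \<in> (#) N ` cuts A N N"
          by (simp add: ks)
      next
        fix ks assume "ks \<in> (#) N ` cuts A N N"
        then obtain ks' where k: "ks = N # ks'" "ks' \<in> cuts A N N"
          by auto
        then show "ks \<in> cuts (x # A) N N"
          by (cases ks') (auto simp: cuts_def)
      qed
      moreover have "path (x # A) (N # ks) = (x, N) # path A ks" if "ks \<in> cuts A N N" for ks
        using that by (cases ks) (auto simp: cuts_def)
      ultimately show ?case
        using IH[of N "\<lambda>p. F ((x, N) # p)"] False
        by (simp add: a sum_shuf_Cons sum.reindex)
    next
      case (Suc d)
      then have a: "a < N" and u: "[a..<Suc N] = a # [Suc a..<Suc N]"
        by (simp_all add: upt_conv_Cons del: upt_Suc)
      \<comment> \<open>Either the first interval is the single vertex a and the remaining letters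
        divide from a on, or it goes further and its start may be moved to
        \<open>Suc a\<close>.\<close>
      let ?c1 = "(#) a ` cuts A a N" and ?c2 = "(\<lambda>ks. a # tl ks) ` cuts (x # A) (Suc a) N"
      have nonempty: "\<exists>k k' ks'. ks = k # k' # ks'" if "ks \<in> cuts (x # A) b N" for ks b
        using that by (cases ks; cases "tl ks") (auto simp: cuts_def)
      have "cuts (x # A) a N = ?c1 \<union> ?c2"
      proof (intro Set.set_eqI iffI)
        fix ks assume *: "ks \<in> cuts (x # A) a N"
        then obtain k ks' where ks: "ks = a # k # ks'"
          using nonempty[OF *] by (auto simp: cuts_def)
        show "ks \<in> ?c1 \<union> ?c2"
        proof (cases "k = a")
          case True
          then have "k # ks' \<in> cuts A a N"
            using * by (simp add: ks cuts_def)
          then show ?thesis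
            by (simp add: ks)
        next
          case False
          then have "Suc a # k # ks' \<in> cuts (x # A) (Suc a) N"
            using * by (auto simp: ks cuts_def)
          then have "a # tl (Suc a # k # ks') \<in> ?c2"
            by (rule imageI)
          then show ?thesis
            by (simp add: ks)
        qed
      next
        fix ks assume "ks \<in> ?c1 \<union> ?c2"
        then consider ks' where "ks = a # ks'" "ks' \<in> cuts A a N" | ks' where "ks = a # tl ks'" "ks' \<in> cuts (x # A) (Suc a) N"
          by auto
        then show "ks \<in> cuts (x # A) a N"
        proof cases
          case 1
          then show ?thesis
            by (cases ks') (auto simp: cuts_def)
        next
          case 2
          then obtain k ks'' where "ks' = Suc a # k # ks''"
            using nonempty[of ks' "Suc a"] by (auto simp: cuts_def)
          then show ?thesis
            using 2 by (auto simp: cuts_def)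
        qed
      qed
      moreover have "?c1 \<inter> ?c2 = {}"
      proof -
        have "a # ks \<noteq> a # tl ks'" if "ks \<in> cuts A a N" "ks' \<in> cuts (x # A) (Suc a) N" for ks ks'
          using that nonempty[OF that(2)] by (cases ks) (auto simp: cuts_def)
        then show ?thesis
          by blast
      qed
      moreover have "inj_on (\<lambda>ks. a # tl ks) (cuts (x # A) (Suc a) N)"
      proof (rule inj_onI)
        fix ks ks' assume *: "ks \<in> cuts (x # A) (Suc a) N" "ks' \<in> cuts (x # A) (Suc a) N" "a # tl ks = a # tl ks'"
        then show "ks = ks'"
          using nonempty[OF *(1)] nonempty[OF *(2)] by (auto simp: cuts_def)
      qed
      ultimately have "(\<Sum>ks\<in>cuts (x # A) a N. F (path (x # A) ks)) = (\<Sum>ks\<in>cuts A a N. F (path (x # A) (a # ks)))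
        + (\<Sum>ks\<in>cuts (x # A) (Suc a) N. F (path (x # A) (a # tl ks)))"
        by (simp add: sum.union_disjoint finite_cuts sum.reindex o_def)
      also have "(\<Sum>ks\<in>cuts A a N. F (path (x # A) (a # ks))) = (\<Sum>ks\<in>cuts A a N. F ((x, a) # path A ks))"
      proof (intro sum.cong refl)
        fix ks assume "ks \<in> cuts A a N"
        then show "F (path (x # A) (a # ks)) = F ((x, a) # path A ks)"
          by (cases ks) (auto simp: cuts_def)
      qed
      also have "\<dots> = (\<Sum>p\<leftarrow>shuf A [a..<Suc N]. F ((x, a) # p))"
        using IH[of a "\<lambda>p. F ((x, a) # p)"] a by simp
      also have "(\<Sum>ks\<in>cuts (x # A) (Suc a) N. F (path (x # A) (a # tl ks))) =
         (\<Sum>ks\<in>cuts (x # A) (Suc a) N. F ((x, a) # path (x # A) ks))"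
      proof (intro sum.cong refl)
        fix ks assume *: "ks \<in> cuts (x # A) (Suc a) N"
        then obtain k ks' where ks: "ks = Suc a # k # ks'"
          using nonempty[OF *] by (auto simp: cuts_def)
        then have "[a..<Suc k] = a # [Suc a..<Suc k]"
          using * by (simp add: cuts_def upt_conv_Cons del: upt_Suc)
        then show "F (path (x # A) (a # tl ks)) = F ((x, a) # path (x # A) ks)"
          by (simp add: ks del: upt_Suc)
      qed
      also have "\<dots> = (\<Sum>p\<leftarrow>shuf (x # A) [Suc a..<Suc N]. F ((x, a) # p))"
        using Suc(1)[of "Suc a" "\<lambda>p. F ((x, a) # p)"] Suc(2) a by simp
      finally show ?case
        unfolding u sum_shuf_Cons using False by (simp add: u del: upt_Suc)
    qed
  qed
qed simp

lemma set_upt_Suc: "set [k..<Suc k'] = {k..k'}"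
  by auto

lemma set_coll_path:
  assumes "length ks = Suc (length A)"
  shows "set (coll l (path A ks)) = (\<Union>j\<in>{j. j < length A \<and> A ! j = l}. {ks ! j..ks ! Suc j})"
  using assms
proof (induction A ks rule: path.induct)
  case (1 x A k k' ks)
  have c: "coll l (map (Pair y) M @ p) = (if y = l then M else []) @ coll l p" for y M and p :: "('a \<times> nat) list"
    by (auto simp: coll_def filter_map o_def)
  have "{j. j < length (x # A) \<and> (x # A) ! j = l} = (if x = l then {0} else {}) \<union> Suc ` {j. j < length A \<and> A ! j = l}"
    by (auto simp: image_iff less_Suc_eq_0_disj)
  then show ?case
    using 1 by (auto simp: c set_upt_Suc simp del: upt_Suc set_upt)
qed auto

lemma coll_path_not_Nil:
  assumes "length ks = Suc (length A)" "sorted ks" "l \<in> set A"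
  shows "coll l (path A ks) \<noteq> []"
proof -
  obtain j where j: "j < length A" "A ! j = l"
    using assms(3) by (metis in_set_conv_nth)
  then have "ks ! j \<le> ks ! Suc j"
    using assms by (intro sorted_nth_mono) auto
  then have "ks ! j \<in> set (coll l (path A ks))"
    unfolding set_coll_path[OF assms(1)] using j by auto
  then show ?thesis
    by (metis empty_iff list.set(1))
qed

lemma distinct_coll_path:
  assumes "length ks = Suc (length A)"
  shows "(\<forall>l. distinct (coll l (path A ks))) \<longleftrightarrow> (\<forall>i < length A. \<forall>j < length A. i \<noteq> j \<and> A ! i = A ! j \<longrightarrow>
      {ks ! i .. ks ! Suc i} \<inter> {ks ! j .. ks ! Suc j} = {})"
  using assms
proof (induction A ks rule: path.induct)
  case (1 x A k k' ks)
  have c: "coll l (map (Pair y) M @ p) = (if y = l then M else []) @ coll l p" for l y M and p :: "('a \<times> nat) list"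
    by (auto simp: coll_def filter_map o_def)
  let ?S = "\<lambda>ks j. {ks ! j..ks ! Suc j}" and ?ks = "k # k' # ks"
  have "distinct (coll l (path (x # A) ?ks)) \<longleftrightarrow>
     distinct (coll l (path A (k' # ks))) \<and> (x = l \<longrightarrow> {k..k'} \<inter> set (coll l (path A (k' # ks))) = {})" for l
    by (cases "x = l") (simp_all add: c set_upt_Suc conj_commute del: upt_Suc set_upt)
  then have "(\<forall>l. distinct (coll l (path (x # A) ?ks))) \<longleftrightarrow>
     (\<forall>l. distinct (coll l (path A (k' # ks)))) \<and> {k..k'} \<inter> set (coll x (path A (k' # ks))) = {}"
    by blast
  also have "\<dots> \<longleftrightarrow> (\<forall>i < length A. \<forall>j < length A. i \<noteq> j \<and> A ! i = A ! j \<longrightarrow> ?S (k' # ks) i \<inter> ?S (k' # ks) j = {}) \<and>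
     (\<forall>j < length A. A ! j = x \<longrightarrow> {k..k'} \<inter> ?S (k' # ks) j = {})"
  proof -
    have l: "length (k' # ks) = Suc (length A)"
      using 1(2) by simp
    have "{k..k'} \<inter> (\<Union>j\<in>{j. j < length A \<and> A ! j = x}. ?S (k' # ks) j) = {} \<longleftrightarrow>
       (\<forall>j < length A. A ! j = x \<longrightarrow> {k..k'} \<inter> ?S (k' # ks) j = {})"
      by (simp only: Int_UN_distrib UNION_empty_conv mem_Collect_eq) blast
    then show ?thesis
      unfolding 1(1)[OF l] set_coll_path[OF l] by simp
  qed
  also have "\<dots> \<longleftrightarrow> (\<forall>i < length (x # A). \<forall>j < length (x # A). i \<noteq> j \<and> (x # A) ! i = (x # A) ! j \<longrightarrow> ?S ?ks i \<inter> ?S ?ks j = {})"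
    unfolding list.size(4) add_Suc_right add_0_right All_less_Suc2 nth_Cons_0 nth_Cons_Suc
    by (simp add: Int_commute del: Int_atLeastAtMost) blast
  finally show ?case .
qed auto

lemma sorted_snd_path:
  assumes "length ks = Suc (length A)" "sorted ks"
  shows "sorted (map snd (path A ks)) \<and> set (map snd (path A ks)) \<subseteq> {hd ks..last ks}"
  using assms
proof (induction A ks rule: path.induct)
  case (1 x A k k' ks)
  then have IH: "sorted (map snd (path A (k' # ks)))" "snd ` set (path A (k' # ks)) \<subseteq> {k'..last (k' # ks)}"
    by auto
  have "k' \<le> last (k' # ks)"
    using 1(3) by (cases ks) auto
  then show ?case
    using IH 1(3) by (fastforce simp: sorted_append o_def simp del: upt_Suc)
qed auto

lemma divisions_eq: "divisions A N = {ks \<in> cuts A 0 N. \<forall>l. distinct (coll l (path A ks))}"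
proof -
  have "ks \<in> divisions A N \<longleftrightarrow> ks \<in> cuts A 0 N \<and> (\<forall>l. distinct (coll l (path A ks)))" for ks
    by (cases "length ks = Suc (length A)") (simp_all add: divisions_def cuts_def distinct_coll_path conj_ac)
  then show ?thesis
    by blast
qed

text \<open>\<open>shuf\<close> also lists divisions in which intervals of equal label meet. These
  collect a vertex twice, and \<open>F\<close> vanishes on them.\<close>

lemma sum_divisions:
  assumes "A \<noteq> []" "\<And>p l. \<not> distinct (coll l p) \<Longrightarrow> sorted (map snd p) \<Longrightarrow> snd ` set p \<subseteq> {..N} \<Longrightarrow> fst ` set p = set A \<Longrightarrow> l \<in> set A \<Longrightarrow> F p = (0 :: bit)"
  shows "(\<Sum>ks\<in>divisions A N. F (path A ks)) = (\<Sum>p\<leftarrow>shuf A [0..<Suc N]. F p)"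
proof -
  have fst: "fst ` set (path A ks) \<subseteq> set A" for ks
    by (induction A ks rule: path.induct) auto
  have "F (path A ks) = 0" if "ks \<in> cuts A 0 N" "\<not> distinct (coll l (path A ks))" for ks l
  proof -
    have ks: "length ks = Suc (length A)" "sorted ks" "hd ks = 0" "last ks = N"
      using that(1) by (auto simp: cuts_def)
    have "l' \<in> fst ` set (path A ks)" if "l' \<in> set A" for l'
      using coll_path_not_Nil[OF ks(1,2) that] by (simp add: coll_eq_Nil)
    then have f: "fst ` set (path A ks) = set A"
      using fst[of ks] by blast
    have "coll l (path A ks) \<noteq> []"
      using that(2) by auto
    then have "l \<in> set A"
      using f by (simp add: coll_eq_Nil)
    then show ?thesis
      using assms(2)[OF that(2)] f sorted_snd_path[OF ks(1,2)] ks(3,4) by (simp add: atLeast0AtMost)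
  qed
  then have "(\<Sum>ks\<in>divisions A N. F (path A ks)) = (\<Sum>ks\<in>cuts A 0 N. F (path A ks))"
    unfolding divisions_eq by (intro sum.mono_neutral_left finite_cuts) auto
  then show ?thesis
    using sum_shuf_cuts[OF assms(1)] by (simp del: upt_Suc)
qed

lemma sorted_list_of_set_coll:
  assumes "distinct (coll l p)" "sorted (map snd p)"
  shows "sorted_list_of_set (set (coll l p)) = coll l p"
  using assms by (simp add: sorted_list_of_set_sort_remdups sorted_coll sorted_sort_id)

lemma map_nth_degeneracy:
  assumes "Suc i < length S" "S ! i = S ! Suc i"
  shows "map ((!) (take (Suc i) S @ drop (Suc (Suc i)) S)) ([0..<Suc i] @ [i..<length S - 1]) = S"
proof (rule nth_equalityI)
  let ?R = "take (Suc i) S @ drop (Suc (Suc i)) S" and ?s = "[0..<Suc i] @ [i..<length S - 1]"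
  show "length (map ((!) ?R) ?s) = length S"
    using assms(1) by simp
  fix j assume "j < length (map ((!) ?R) ?s)"
  then have j: "j < length S"
    using assms(1) by simp
  show "map ((!) ?R) ?s ! j = S ! j"
  proof (cases "j < Suc i")
    case True
    then show ?thesis
      using j by (simp add: nth_append del: upt_Suc)
  next
    case False
    then have "map ((!) ?R) ?s ! j = ?R ! (j - 1)"
      using assms(1) j by (simp add: nth_append One_nat_def del: upt_Suc)
    also have "\<dots> = S ! j"
    proof (cases "j = Suc i")
      case True
      then show ?thesis
        using assms by (simp add: nth_append)
    next
      case False
      then obtain j' where "j = Suc (Suc j')" "i \<le> j'"
        using \<open>\<not> j < Suc i\<close> by (cases j; cases "j - 1") (auto simp: One_nat_def)
      then show ?thesis
        using assms(1) j by (simp add: nth_append One_nat_def)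
    qed
    finally show ?thesis .
  qed
qed

text \<open>In a sorted list equal entries can be found next to each other, so the operator factors
  through a degeneracy.\<close>

lemma (in simplicial_set) degenerate_act:
  assumes u: "u \<in> cells X N" and S: "sorted S" "set S \<subseteq> {..N}" "\<not> distinct S"
  shows "degenerate X (length S - 1) (act X N S u)"
proof -
  obtain i where i: "Suc i < length S" "S ! i = S ! Suc i"
  proof -
    have "\<not> distinct_adj S"
      using S(1,3)
    proof (induction S)
      case (Cons x S)
      show ?case
      proof (cases "distinct S")
        case False
        then show ?thesis
          using Cons not_distinct_adj_Cons[of S] by simp
      next
        case True
        then have "x \<in> set S"
          using Cons.prems by simp
        then have "S \<noteq> []" "hd S = x"
          using Cons.prems(1) by (cases S; auto)+
        then show ?thesis
          by (cases S) auto
      qed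
    qed simp
    then show thesis
      using that by (auto simp: distinct_adj_conv_nth)
  qed
  define k where "k = length S - 1"
  define R where "R = take (Suc i) S @ drop (Suc (Suc i)) S"
  have k: "length S = Suc k" "i < k"
    using i by (auto simp: k_def)
  have lR: "length R = k"
    using i k by (simp add: R_def)
  have sR: "set R \<subseteq> {..N}"
    using S(2) set_take_subset[of "Suc i" S] set_drop_subset[of "Suc (Suc i)" S] by (auto simp: R_def)
  have soR: "sorted R"
  proof -
    have "sorted (take (Suc i) S @ S ! Suc i # drop (Suc (Suc i)) S)"
      using id_take_nth_drop[OF i(1)] S(1) by simp
    then show ?thesis
      by (auto simp: R_def sorted_append)
  qed
  have "R \<in> Delta (k - 1) N"
    using lR sR soR k by (simp add: Delta_def)
  moreover have "[0..<Suc i] @ [i..<k] \<in> Delta k (k - 1)"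
    using k by (auto simp: Delta_def sorted_append)
  moreover have "map ((!) R) ([0..<Suc i] @ [i..<k]) = S"
    using i unfolding R_def k_def by (rule map_nth_degeneracy)
  ultimately have "act X N S u = act X (k - 1) ([0..<Suc i] @ [i..<k]) (act X N R u)" "act X N R u \<in> cells X (k - 1)"
    using act_comp[OF u, of R "k - 1" _ k] act_closed[OF u, of R "k - 1"] by simp_all
  then show ?thesis
    unfolding degenerate_def using k by (intro exI[of _ i] exI[of _ "act X N R u"]) simp
qed

definition vanishes :: "'a sset \<Rightarrow> 'a cochain \<Rightarrow> bool" where
  "vanishes X \<beta> \<longleftrightarrow> (\<forall>k. \<forall>u \<in> cells X k. degenerate X k u \<longrightarrow> \<beta> k u = 0)"

text \<open>
  Sorting and truncating \<open>M\<close> makes the face operator legitimate for every list \<open>M\<close>, so that the boundary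
  formulas need no side conditions.
\<close>

definition val :: "'a sset \<Rightarrow> nat \<Rightarrow> 'a \<Rightarrow> 'a cochain \<Rightarrow> nat list \<Rightarrow> bit" where
  "val X N u \<beta> M = (if M = [] then 0 else \<beta> (length M - 1) (act X N (sort (map (min N) M)) u))"

lemma val_Nil [simp]: "val X N u \<beta> [] = 0"
  by (simp add: val_def)

lemma val_sorted: "sorted M \<Longrightarrow> set M \<subseteq> {..N} \<Longrightarrow> M \<noteq> [] \<Longrightarrow> val X N u \<beta> M = \<beta> (length M - 1) (act X N M u)"
proof -
  assume *: "sorted M" "set M \<subseteq> {..N}" "M \<noteq> []"
  have "map (min N) M = M"
    using *(2) by (intro map_idI) auto
  then show ?thesis
    using * by (simp add: val_def sorted_sort_id)
qed

lemma (in simplicial_set) val_distinct: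
  assumes "u \<in> cells X N" "vanishes X \<beta>" "\<not> distinct M"
  shows "val X N u \<beta> M = 0"
proof -
  let ?S = "sort (map (min N) M)"
  have "\<not> distinct ?S"
    using assms(3) by (simp add: distinct_map)
  moreover have S: "sorted ?S" "set ?S \<subseteq> {..N}"
    by auto
  ultimately have "degenerate X (length ?S - 1) (act X N ?S u)"
    using assms(1) by (intro degenerate_act)
  moreover have "length M = Suc (length M - 1)"
    using assms(3) by (cases M) auto
  then have "act X N ?S u \<in> cells X (length ?S - 1)"
    using assms(1) S by (intro act_closed) (simp_all add: Delta_def)
  ultimately show ?thesis
    using assms(2) by (auto simp: val_def vanishes_def)
qed

lemma (in simplicial_set) surj_act_eq:
  assumes "u \<in> cells X N" "\<And>l. vanishes X (\<alpha> l)" "set A = {1..r}" "r \<ge> 1"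
  shows "surj_act X r A \<alpha> N u = (\<Sum>p\<leftarrow>shuf A [0..<Suc N]. \<Prod>l\<in>{1..r}. val X N u (\<alpha> l) (coll l p))"
proof -
  have A: "A \<noteq> []"
    using assms(3,4) by auto
  have "surj_act X r A \<alpha> N u = (\<Sum>ks\<in>divisions A N. \<Prod>l\<in>{1..r}. val X N u (\<alpha> l) (coll l (path A ks)))"
    unfolding surj_act_def
  proof (intro sum.cong prod.cong refl)
    fix ks l assume ks: "ks \<in> divisions A N" and l: "l \<in> {1..r}"
    then have k: "length ks = Suc (length A)" "sorted ks" "hd ks = 0" "last ks = N" "distinct (coll l (path A ks))"
      by (auto simp: divisions_eq cuts_def)
    note s = sorted_snd_path[OF k(1,2)]
    have ne: "coll l (path A ks) \<noteq> []"
      using k l assms(3) by (intro coll_path_not_Nil) auto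
    have "set (coll l (path A ks)) \<subseteq> {..N}"
      using s k(3,4) by (intro order_trans[OF set_coll]) (simp add: atLeast0AtMost)
    then show "(let I = \<Union>j\<in>{j. j < length A \<and> A ! j = l}. {ks ! j..ks ! Suc j} in \<alpha> l (card I - 1) (face X N u I)) =
      val X N u (\<alpha> l) (coll l (path A ks))"
      unfolding Let_def face_def set_coll_path[OF k(1), symmetric]
      using s k(5) ne by (simp add: val_sorted sorted_coll sorted_list_of_set_coll distinct_card)
  qed
  also have "\<dots> = (\<Sum>p\<leftarrow>shuf A [0..<Suc N]. \<Prod>l\<in>{1..r}. val X N u (\<alpha> l) (coll l p))"
  proof (rule sum_divisions[OF A])
    fix p :: "(nat \<times> nat) list" and l assume "\<not> distinct (coll l p)" "l \<in> set A"
    then show "(\<Prod>l\<in>{1..r}. val X N u (\<alpha> l) (coll l p)) = 0"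
      using assms by (intro prod_zero bexI[of _ l] val_distinct) auto
  qed
  finally show ?thesis .
qed

section \<open>Steenrod's map as a sum over divisions\<close>

lemma alt_nth: "j < k \<Longrightarrow> alt x y k ! j = (if even j then x else y)"
proof (induction k arbitrary: x y j)
  case (Suc k)
  then show ?case
    by (cases j) auto
qed simp

lemma sorted_last_ge: "sorted ks \<Longrightarrow> k \<in> set ks \<Longrightarrow> k \<le> last ks"
  by (induction ks) (auto split: if_splits)

text \<open>Intervals number i and i + 2 carry the same label, and they are disjoint exactly if the
  interval between them has more than one point. This is strictness of the cut points; the first and
  the last interval may be single points, so 0 and N are allowed as cuts.\<close>

lemma steenrod_divisions:
  "bij_betw (\<lambda>ks. 0 # ks @ [N]) {ks. length ks = Suc m \<and> sorted_wrt (<) ks \<and> set ks \<subseteq> {..N}}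
     (divisions (alt (1::nat) 2 (Suc (Suc m))) N)"
proof (intro bij_betw_imageI inj_onI Set.set_eqI iffI)
  let ?A = "alt (1::nat) 2 (Suc (Suc m))"
  fix ks assume "ks \<in> (\<lambda>ks. 0 # ks @ [N]) ` {ks. length ks = Suc m \<and> sorted_wrt (<) ks \<and> set ks \<subseteq> {..N}}"
  then obtain js where ks: "ks = 0 # js @ [N]" and js: "length js = Suc m" "sorted_wrt (<) js" "set js \<subseteq> {..N}"
    by auto
  have dis: "{ks ! i .. ks ! Suc i} \<inter> {ks ! j .. ks ! Suc j} = {}" if "i < j" "j < Suc (Suc m)" "?A ! i = ?A ! j" for i j
  proof -
    have "even i = even j"
      using that by (simp add: alt_nth split: if_splits del: alt.simps)
    then have "Suc i < j"
      using that(1) by (metis Suc_lessI even_Suc)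
    then have "js ! i < js ! (j - 1)"
      using sorted_wrt_nth_less[OF js(2), of i "j - 1"] js(1) that(2) by simp
    moreover have "ks ! Suc i = js ! i" "ks ! j = js ! (j - 1)"
      using js that \<open>Suc i < j\<close> by (auto simp: ks nth_append nth_Cons')
    ultimately show ?thesis
      by auto
  qed
  have "{ks ! i .. ks ! Suc i} \<inter> {ks ! j .. ks ! Suc j} = {}" if "i < Suc (Suc m)" "j < Suc (Suc m)" "i \<noteq> j" "?A ! i = ?A ! j" for i j
    using dis[of i j] dis[of j i] that by (cases "i < j") auto
  moreover have "sorted ks"
    using js strict_sorted_imp_sorted[OF js(2)] by (auto simp: ks sorted_append)
  ultimately show "ks \<in> divisions ?A N"
    using js(1) unfolding divisions_def by (auto simp: ks simp del: alt.simps)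
next
  let ?A = "alt (1::nat) 2 (Suc (Suc m))"
  fix ks assume ks: "ks \<in> divisions ?A N"
  then have k: "length ks = Suc (Suc (Suc m))" "sorted ks" "hd ks = 0" "last ks = N"
    by (auto simp: divisions_def)
  then obtain js where ksj: "ks = 0 # js @ [N]" "length js = Suc m"
    by (cases ks; cases "tl ks" rule: rev_cases) auto
  have "js ! i < js ! Suc i" if "Suc i < Suc m" for i
  proof -
    have "?A ! i = ?A ! Suc (Suc i)" "i \<noteq> Suc (Suc i)" "i < length ?A" "Suc (Suc i) < length ?A"
      using that by (auto simp: alt_nth simp del: alt.simps)
    then have "{ks ! i .. ks ! Suc i} \<inter> {ks ! Suc (Suc i) .. ks ! Suc (Suc (Suc i))} = {}"
      using ks unfolding divisions_def by blast
    moreover have "ks ! i \<le> ks ! Suc i" "ks ! Suc i \<le> ks ! Suc (Suc i)" "ks ! Suc (Suc i) \<le> ks ! Suc (Suc (Suc i))"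
      using k that by (auto intro!: sorted_nth_mono)
    ultimately have "ks ! Suc i \<noteq> ks ! Suc (Suc i)"
      by auto
    then have "ks ! Suc i < ks ! Suc (Suc i)"
      using \<open>ks ! Suc i \<le> ks ! Suc (Suc i)\<close> by simp
    then show ?thesis
      using that ksj by (simp add: nth_append)
  qed
  then have "sorted_wrt (<) js"
    using ksj(2) by (subst sorted_wrt_iff_nth_Suc_transp) (auto simp: transp_def)
  moreover have "set js \<subseteq> {..N}"
    using k ksj sorted_last_ge[of ks] by auto
  ultimately show "ks \<in> (\<lambda>ks. 0 # ks @ [N]) ` {ks. length ks = Suc m \<and> sorted_wrt (<) ks \<and> set ks \<subseteq> {..N}}"
    using ksj by auto
qed auto

lemma steenrod_part_eq:
  assumes "length ks = Suc m"
  shows "steenrod_part N ks odd = set (coll 1 (path (alt (1::nat) 2 (Suc (Suc m))) (0 # ks @ [N])))"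
    "steenrod_part N ks even = set (coll 2 (path (alt (1::nat) 2 (Suc (Suc m))) (0 # ks @ [N])))"
proof -
  let ?k = "0 # ks @ [N]" and ?A = "alt (1::nat) 2 (Suc (Suc m))"
  have *: "(\<Union>s \<in> {s \<in> {1..Suc (length ks)}. P s}. {?k ! (s - 1) .. ?k ! s}) = set (coll l (path ?A ?k))"
    if "\<And>j. j < Suc (Suc m) \<Longrightarrow> (?A ! j = l) = P (Suc j)" for P l
  proof -
    have "{s \<in> {1..Suc (length ks)}. P s} = Suc ` {j. j < length ?A \<and> ?A ! j = l}"
    proof (rule equalityI; rule subsetI)
      fix s assume "s \<in> {s \<in> {1..Suc (length ks)}. P s}"
      then have "s = Suc (s - 1)" "s - 1 < Suc (Suc m)" "P s"
        using assms by auto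
      then show "s \<in> Suc ` {j. j < length ?A \<and> ?A ! j = l}"
        using that[of "s - 1"] by (intro image_eqI[of _ _ "s - 1"]) (simp_all del: alt.simps)
    next
      fix s assume "s \<in> Suc ` {j. j < length ?A \<and> ?A ! j = l}"
      then show "s \<in> {s \<in> {1..Suc (length ks)}. P s}"
        using that assms by (auto simp del: alt.simps)
    qed
    then show ?thesis
      using assms by (subst set_coll_path) (simp_all del: alt.simps)
  qed
  show "steenrod_part N ks odd = set (coll 1 (path ?A ?k))"
    unfolding steenrod_part_def Let_def by (rule *) (simp add: alt_nth del: alt.simps)
  show "steenrod_part N ks even = set (coll 2 (path ?A ?k))"
    unfolding steenrod_part_def Let_def by (rule *) (simp add: alt_nth del: alt.simps)
qed

text \<open>Formulated for a functional \<open>g\<close> on pairs of simplices, since it serves both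
  for cup products on \<open>X\<close> and for Steenrod's map on \<open>ES2\<close>.\<close>

lemma (in simplicial_set) ev_steenrod_gen:
  assumes u: "u \<in> cells X N"
    and g: "\<And>k v j w. v \<in> cells X k \<Longrightarrow> w \<in> cells X j \<Longrightarrow> degenerate X k v \<or> degenerate X j w \<Longrightarrow> g ((k, v), (j, w)) = 0"
  shows "ev g (steenrod_gen X m (N, u)) = (\<Sum>p\<leftarrow>shuf (alt (1::nat) 2 (Suc (Suc m))) [0..<Suc N].
    g ((length (coll 1 p) - 1, act X N (coll 1 p) u), (length (coll 2 p) - 1, act X N (coll 2 p) u)))"
proof -
  let ?A = "alt (1::nat) 2 (Suc (Suc m))"
  let ?F = "\<lambda>p. g ((length (coll 1 p) - 1, act X N (coll 1 p) u), (length (coll 2 p) - 1, act X N (coll 2 p) u))"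
  let ?K = "{ks. length ks = Suc m \<and> sorted_wrt (<) ks \<and> set ks \<subseteq> {..N}}"
  have cell: "act X N c u \<in> cells X (length c - 1)" if "sorted c" "set c \<subseteq> {..N}" "c \<noteq> []" for c
    using that u by (intro act_closed) (cases c; auto simp: Delta_def)+
  have "ev g (steenrod_gen X m (N, u)) = (\<Sum>ks\<in>?K. ?F (path ?A (0 # ks @ [N])))"
    unfolding steenrod_gen_def prod.case ev_sum
  proof (intro sum.cong refl)
    fix ks assume ks: "ks \<in> ?K"
    let ?k = "0 # ks @ [N]"
    have d: "?k \<in> divisions ?A N"
      using steenrod_divisions[of N m] ks by (auto simp: bij_betw_def simp del: alt.simps)
    then have k: "length ?k = Suc (length ?A)" "sorted ?k" "\<And>l. distinct (coll l (path ?A ?k))"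
      by (auto simp: divisions_eq cuts_def simp del: alt.simps)
    note s = sorted_snd_path[OF k(1,2)]
    have c: "coll l (path ?A ?k) \<noteq> []" "set (coll l (path ?A ?k)) \<subseteq> {..N}" "sorted (coll l (path ?A ?k))" if "l \<in> {1, 2}" for l
    proof -
      show "coll l (path ?A ?k) \<noteq> []"
        using k that set_alt[of 1 "2::nat" m] by (intro coll_path_not_Nil) (auto simp del: alt.simps)
      show "set (coll l (path ?A ?k)) \<subseteq> {..N}"
        using s by (intro order_trans[OF set_coll]) (simp add: atLeast0AtMost del: alt.simps)
      show "sorted (coll l (path ?A ?k))"
        using s by (simp add: sorted_coll del: alt.simps)
    qed
    let ?a = "coll 1 (path ?A ?k)" and ?b = "coll 2 (path ?A ?k)"
    have ca: "act X N ?a u \<in> cells X (length ?a - 1)" and cb: "act X N ?b u \<in> cells X (length ?b - 1)"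
      using c[of 1] c[of 2] by (auto intro!: cell simp del: alt.simps)
    have fa: "face X N u (steenrod_part N ks odd) = act X N ?a u" "card (steenrod_part N ks odd) = length ?a"
      and fb: "face X N u (steenrod_part N ks even) = act X N ?b u" "card (steenrod_part N ks even) = length ?b"
      using ks k(3) s by (simp_all add: steenrod_part_eq face_def sorted_list_of_set_coll distinct_card del: alt.simps)
    show "ev g (let I = steenrod_part N ks odd; J = steenrod_part N ks even
       in tensor (cls X (card I - 1) (face X N u I)) (cls X (card J - 1) (face X N u J))) = ?F (path ?A ?k)"
      unfolding Let_def fa fb ev_tensor ev_cls using g[OF ca cb] by auto
  qed
  also have "\<dots> = (\<Sum>ks\<in>divisions ?A N. ?F (path ?A ks))"
    by (rule sum.reindex_bij_betw[OF steenrod_divisions])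
  also have "\<dots> = (\<Sum>p\<leftarrow>shuf ?A [0..<Suc N]. ?F p)"
  proof (rule sum_divisions)
    fix p and l :: nat assume p: "\<not> distinct (coll l p)" "sorted (map snd p)" "snd ` set p \<subseteq> {..N}" "fst ` set p = set ?A" "l \<in> set ?A"
    have A: "set ?A = {1, 2}"
      by (rule set_alt)
    have s: "sorted (coll l p)" "set (coll l p) \<subseteq> {..N}" "coll l p \<noteq> []" if "l \<in> {1, 2}" for l
      using p(2-4) set_coll[of l p] that A by (auto simp: coll_eq_Nil intro: sorted_coll simp del: alt.simps)
    have l: "l \<in> {1, 2}"
      using p(5) A by blast
    have "degenerate X (length (coll l p) - 1) (act X N (coll l p) u)"
      by (rule degenerate_act[OF u s(1,2)[OF l] p(1)])
    then show "?F p = 0"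
      using l g[OF cell[OF s[of 1]] cell[OF s[of 2]]] by auto
  qed simp
  finally show ?thesis .
qed

lemma bd_index: "bd f xs = (\<Sum>i<length xs. f (take i xs @ drop (Suc i) xs))"
  by (induction xs arbitrary: f) (simp_all add: sum.lessThan_Suc_shift del: sum.lessThan_Suc)

text \<open>For a symmetric function the face depends only on the value that is deleted. This allows
  vertex lists to be sorted before a boundary is computed.\<close>

lemma bd_mset:
  assumes "\<And>xs ys. mset xs = mset ys \<Longrightarrow> f xs = f ys" "mset xs = mset ys"
  shows "bd f xs = bd f ys"
proof -
  have *: "(\<forall>xs ys. mset xs = mset ys \<longrightarrow> f xs = f ys) \<Longrightarrow> bd f xs = (\<Sum>x\<leftarrow>xs. f (remove1 x xs))" for f and xs :: "'a list"
  proof (induction xs arbitrary: f)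
    case Nil
    show ?case
      by (simp only: bd_Nil list.map sum_list.Nil)
  next
    case (Cons x xs)
    note inv = Cons.prems[rule_format]
    have "bd (\<lambda>ys. f (x # ys)) xs = (\<Sum>y\<leftarrow>xs. f (x # remove1 y xs))"
      by (rule Cons.IH) (intro allI impI inv, simp)
    moreover have "f (x # remove1 y xs) = f (remove1 y (x # xs))" if "y \<in> set xs" for y
      using that by (intro inv) auto
    then have "(\<Sum>y\<leftarrow>xs. f (x # remove1 y xs)) = (\<Sum>y\<leftarrow>xs. f (remove1 y (x # xs)))"
      by (rule sum_list_cong)
    ultimately show ?case
      by (simp only: bd_Cons list.map sum_list.Cons remove1.simps if_True simp_thms)
  qed
  have "(\<Sum>x\<leftarrow>xs. f (remove1 x xs)) = (\<Sum>x\<leftarrow>xs. f (remove1 x ys))"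
    by (intro sum_list_cong assms(1)) (simp add: assms(2))
  also have "\<dots> = (\<Sum>x\<leftarrow>ys. f (remove1 x ys))"
    by (metis assms(2) mset_map sum_mset_sum_list)
  finally show ?thesis
    using *[of f xs] *[of f ys] assms(1) by metis
qed

lemma sorted_list_of_set_remove: "i \<le> n \<Longrightarrow> sorted_list_of_set ({..n} - {i}) = take i [0..<Suc n] @ drop (Suc i) [0..<Suc n]"
proof -
  assume "i \<le> n"
  then have e: "{..n} - {i} = set ([0..<i] @ [Suc i..<Suc n])"
    by auto
  have "sorted_list_of_set (set ([0..<i] @ [Suc i..<Suc n])) = [0..<i] @ [Suc i..<Suc n]"
    by (simp only: sorted_list_of_set_sort_remdups, subst distinct_remdups_id)
       (auto simp: sorted_append simp del: upt_Suc intro!: sorted_sort_id)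
  then show ?thesis
    using \<open>i \<le> n\<close> by (simp add: e drop_upt take_upt del: upt_Suc)
qed

lemma bit_eq_of_add: "0 = a + b \<Longrightarrow> b = (a :: bit)"
  by (cases a; cases b) simp_all

lemma bd_mult_left: "bd (\<lambda>ys. c * f ys) xs = c * bd f xs"
  using bd_mult_right[of f c xs] by (simp add: mult.commute)

section \<open>Cocycles and cup products\<close>

definition cocycle :: "'a sset \<Rightarrow> 'a cochain \<Rightarrow> bool" where
  "cocycle X \<beta> \<longleftrightarrow> vanishes X \<beta> \<and> (\<forall>N. \<forall>u \<in> cells X N. coboundary X \<beta> N u = 0)"

context simplicial_set begin

lemma val_act:
  assumes "u \<in> cells X N" "\<eta> \<in> Delta m N" "sorted M" "set M \<subseteq> {..m}"
  shows "val X m (act X N \<eta> u) \<beta> M = val X N u \<beta> (map ((!) \<eta>) M)"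
proof (cases "M = []")
  case False
  have \<eta>: "length \<eta> = Suc m" "sorted \<eta>" "set \<eta> \<subseteq> {..N}"
    using assms(2) by (auto simp: Delta_def)
  have "sorted (map ((!) \<eta>) M)"
    unfolding sorted_map
  proof (rule sorted_wrt_mono_rel[OF _ assms(3)])
    fix x y assume "x \<in> set M" "y \<in> set M" "x \<le> y"
    then show "\<eta> ! x \<le> \<eta> ! y"
      using assms(4) \<eta> by (intro sorted_nth_mono) auto
  qed
  moreover have "set (map ((!) \<eta>) M) \<subseteq> {..N}"
  proof -
    have "\<eta> ! x \<in> set \<eta>" if "x \<in> set M" for x
      using that assms(4) \<eta>(1) by (intro nth_mem) auto
    then show ?thesis
      using \<eta>(3) by auto
  qed
  moreover have "M \<in> Delta (length M - 1) m"
    using False assms(3,4) by (cases M) (auto simp: Delta_def)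
  ultimately show ?thesis
    using False assms(3,4) by (simp add: val_sorted[of M] val_sorted[of "map ((!) \<eta>) M"] act_comp[OF assms(1,2)])
qed simp

text \<open>The cochain \<gamma> is the value of \<Gamma> on the full vertex list, and \<Gamma> is
  compatible with pullback along monotone maps. Faces of a simplex then become faces of a list, and
  the coboundary becomes \<open>bd\<close>.\<close>

definition natural :: "'a cochain \<Rightarrow> (nat \<Rightarrow> 'a \<Rightarrow> nat list \<Rightarrow> bit) \<Rightarrow> bool" where
  "natural \<gamma> \<Gamma> \<longleftrightarrow> (\<forall>N. \<forall>u \<in> cells X N. \<Gamma> N u [] = 0 \<and> \<gamma> N u = \<Gamma> N u [0..<Suc N] \<and>
     (\<forall>m. \<forall>\<eta> \<in> Delta m N. \<Gamma> m (act X N \<eta> u) [0..<Suc m] = \<Gamma> N u \<eta>))"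

lemma face_eq_act:
  assumes "i \<le> N"
  shows "face X N u ({..N} - {i}) = act X N (take i [0..<Suc N] @ drop (Suc i) [0..<Suc N]) u"
  unfolding face_def sorted_list_of_set_remove[OF assms] ..

lemma Delta_face: "i \<le> N \<Longrightarrow> N > 0 \<Longrightarrow> take i [0..<Suc N] @ drop (Suc i) [0..<Suc N] \<in> Delta (N - 1) N"
  by (auto simp: Delta_def sorted_append drop_upt take_upt simp del: upt_Suc)

lemma coboundary_natural:
  assumes "natural \<gamma> \<Gamma>" "u \<in> cells X N"
  shows "coboundary X \<gamma> N u = bd (\<Gamma> N u) [0..<Suc N]"
proof (cases "N = 0")
  case True
  then show ?thesis
    using assms by (simp add: coboundary_def natural_def)
next
  case False
  have "coboundary X \<gamma> N u = (\<Sum>i\<le>N. \<Gamma> N u (take i [0..<Suc N] @ drop (Suc i) [0..<Suc N]))"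
    using False unfolding coboundary_def if_not_P[OF False]
  proof (intro sum.cong refl)
    fix i assume "i \<in> {..N}"
    then have i: "i \<le> N"
      by simp
    note D = Delta_face[OF i False[unfolded neq0_conv]]
    show "\<gamma> (N - 1) (face X N u ({..N} - {i})) = \<Gamma> N u (take i [0..<Suc N] @ drop (Suc i) [0..<Suc N])"
      unfolding face_eq_act[OF i] using assms D act_closed[OF assms(2) D] by (simp add: natural_def del: upt_Suc)
  qed
  then show ?thesis
    unfolding bd_index by (simp add: lessThan_Suc_atMost del: upt_Suc)
qed

lemma val_natural:
  assumes "natural \<gamma> \<Gamma>" "u \<in> cells X N" "sorted M" "set M \<subseteq> {..N}"
  shows "val X N u \<gamma> M = \<Gamma> N u M"
proof (cases "M = []")
  case True
  then show ?thesis
    using assms by (simp add: natural_def)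
next
  case False
  then have D: "M \<in> Delta (length M - 1) N"
    using assms(3,4) by (cases M) (auto simp: Delta_def)
  have "\<gamma> (length M - 1) (act X N M u) = \<Gamma> (length M - 1) (act X N M u) [0..<Suc (length M - 1)]"
    using assms(1) act_closed[OF assms(2) D] unfolding natural_def by blast
  also have "\<dots> = \<Gamma> N u M"
    using assms(1,2) D unfolding natural_def by blast
  finally show ?thesis
    using assms(3,4) False by (simp add: val_sorted)
qed

lemma natural_val: "natural \<beta> (\<lambda>N u. val X N u \<beta>)"
  unfolding natural_def
proof (intro allI ballI conjI)
  fix N u assume u: "u \<in> cells X N"
  show "\<beta> N u = val X N u \<beta> [0..<Suc N]"
    using act_id[OF u] by (subst val_sorted) (auto simp del: upt_Suc)
  fix m \<eta> assume \<eta>: "\<eta> \<in> Delta m N"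
  have "map ((!) \<eta>) [0..<Suc m] = \<eta>"
    using \<eta> map_nth[of \<eta>] by (simp add: Delta_def)
  then show "val X m (act X N \<eta> u) \<beta> [0..<Suc m] = val X N u \<beta> \<eta>"
    using val_act[OF u \<eta>, of "[0..<Suc m]" \<beta>] by (simp add: atLeast0LessThan lessThan_Suc_atMost del: upt_Suc)
qed simp

text \<open>The value depends only on the sorted and truncated list, which is a monotone map into
  the vertices of u. After pulling u back along it the boundary is an honest coboundary of
  \<beta>.\<close>

lemma bd_val:
  assumes u: "u \<in> cells X N" and \<beta>: "cocycle X \<beta>"
  shows "bd (val X N u \<beta>) M = 0"
proof -
  let ?S = "sort (map (min N) M)"
  have v: "val X N u \<beta> xs = val X N u \<beta> ys" if "mset xs = mset ys" for xs ys
  proof -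
    have "length xs = length ys"
      using that by (metis size_mset)
    moreover have "sort (map (min N) xs) = sort (map (min N) ys)"
      using that by (intro properties_for_sort) simp_all
    ultimately show ?thesis
      by (auto simp: val_def)
  qed
  have "val X N u \<beta> xs = val X N u \<beta> (map (min N) xs)" for xs
    by (simp add: val_def o_def)
  then have "bd (val X N u \<beta>) M = bd (val X N u \<beta>) (map (min N) M)"
    by (simp add: bd_map)
  also have "\<dots> = bd (val X N u \<beta>) ?S"
    by (rule bd_mset[OF v]) simp_all
  also have "\<dots> = 0"
  proof (cases "M = []")
    case False
    define k where "k = length M - 1"
    have "length M = Suc k"
      using False by (cases M) (auto simp: k_def)
    then have D: "?S \<in> Delta k N"
      by (auto simp: Delta_def)
    let ?v = "act X N ?S u"
    have "bd (val X k ?v \<beta>) [0..<Suc k] = 0"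
      using coboundary_natural[OF natural_val act_closed[OF u D], of \<beta>] \<beta> act_closed[OF u D] by (simp add: cocycle_def)
    moreover have sf: "set ys \<subseteq> {..k}" if "ys \<in> set (faces [0..<Suc k])" for ys
      using set_faces[OF that] by (simp add: atLeast0LessThan lessThan_Suc_atMost del: upt_Suc)
    have "bd (val X k ?v \<beta>) [0..<Suc k] = bd (\<lambda>ys. val X N u \<beta> (map ((!) ?S) ys)) [0..<Suc k]"
      by (intro bd_cong val_act[OF u D] sorted_faces[OF _ sorted_upt] sf)
    moreover have "map ((!) ?S) [0..<Suc k] = ?S"
      using D map_nth[of ?S] by (simp add: Delta_def)
    ultimately show ?thesis
      by (metis bd_map)
  qed simp
  finally show ?thesis .
qed

lemma natural_word:
  "natural (\<lambda>N u. \<Sum>p\<leftarrow>shuf w [0..<Suc N]. \<Prod>l\<in>R. val X N u (\<beta> l) (coll l p))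
     (\<lambda>N u L. \<Sum>p\<leftarrow>shuf w L. \<Prod>l\<in>R. val X N u (\<beta> l) (coll l p))"
  unfolding natural_def
proof (intro allI ballI conjI)
  fix N u m \<eta> assume u: "u \<in> cells X N" and \<eta>: "\<eta> \<in> Delta m N"
  have e: "\<eta> = map ((!) \<eta>) [0..<Suc m]"
    using \<eta> map_nth[of \<eta>] by (simp add: Delta_def)
  have "(\<Sum>p\<leftarrow>shuf w \<eta>. \<Prod>l\<in>R. val X N u (\<beta> l) (coll l p)) =
     (\<Sum>p\<leftarrow>shuf w [0..<Suc m]. \<Prod>l\<in>R. val X N u (\<beta> l) (map ((!) \<eta>) (coll l p)))"
    using shuf_map[of id w "(!) \<eta>" "[0..<Suc m]", folded e] by (simp add: o_def coll_map_prod del: upt_Suc)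
  also have "\<dots> = (\<Sum>p\<leftarrow>shuf w [0..<Suc m]. \<Prod>l\<in>R. val X m (act X N \<eta> u) (\<beta> l) (coll l p))"
  proof (intro sum_list_cong prod.cong refl)
    fix p l assume p: "p \<in> set (shuf w [0..<Suc m])"
    have "sorted (coll l p)"
      by (rule sorted_coll[OF sorted_snd_shuf[OF p]]) (simp del: upt_Suc)
    moreover have "set (coll l p) \<subseteq> {..m}"
      using set_coll[of l p] snd_shuf[OF p] by auto
    ultimately show "val X N u (\<beta> l) (map ((!) \<eta>) (coll l p)) = val X m (act X N \<eta> u) (\<beta> l) (coll l p)"
      using val_act[OF u \<eta>] by simp
  qed
  finally show "(\<Sum>p\<leftarrow>shuf w [0..<Suc m]. \<Prod>l\<in>R. val X m (act X N \<eta> u) (\<beta> l) (coll l p)) =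
    (\<Sum>p\<leftarrow>shuf w \<eta>. \<Prod>l\<in>R. val X N u (\<beta> l) (coll l p))" ..
qed simp_all

definition cupL :: "nat \<Rightarrow> 'a cochain \<Rightarrow> 'a cochain \<Rightarrow> nat \<Rightarrow> 'a \<Rightarrow> nat list \<Rightarrow> bit" where
  "cupL m \<beta> \<gamma> N u L = (\<Sum>p\<leftarrow>shuf (alt (1::nat) 2 (Suc (Suc m))) L. val X N u \<beta> (coll 1 p) * val X N u \<gamma> (coll 2 p))"

lemma shuf_alt_coll:
  assumes "p \<in> set (shuf (alt (1::nat) 2 (Suc (Suc m))) L)" "l \<in> {1, 2}"
  shows "coll l p \<noteq> []" "sorted L \<Longrightarrow> sorted (coll l p)" "set (coll l p) \<subseteq> set L"
proof -
  show "coll l p \<noteq> []"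
    using fst_shuf[OF assms(1)] set_alt[of 1 "2::nat" m] assms(2) by (simp add: coll_eq_Nil del: alt.simps)
  show "sorted L \<Longrightarrow> sorted (coll l p)"
    by (rule sorted_coll[OF sorted_snd_shuf[OF assms(1)]])
  show "set (coll l p) \<subseteq> set L"
    using set_coll[of l p] snd_shuf[OF assms(1)] by simp
qed

lemma cup_eq:
  assumes u: "u \<in> cells X N" and "vanishes X \<beta>" "vanishes X \<gamma>"
  shows "cup X m \<beta> \<gamma> N u = cupL m \<beta> \<gamma> N u [0..<Suc N]"
proof -
  let ?g = "\<lambda>((i, v), (j, w)). \<beta> i v * \<gamma> j w"
  have "cup X m \<beta> \<gamma> N u = ev ?g (steenrod_gen X m (N, u))"
    by (simp add: cup_def ev_def case_prod_unfold)
  also have "\<dots> = (\<Sum>p\<leftarrow>shuf (alt (1::nat) 2 (Suc (Suc m))) [0..<Suc N].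
      ?g ((length (coll 1 p) - 1, act X N (coll 1 p) u), (length (coll 2 p) - 1, act X N (coll 2 p) u)))"
    using assms by (intro ev_steenrod_gen[OF u]) (auto simp: vanishes_def)
  also have "\<dots> = cupL m \<beta> \<gamma> N u [0..<Suc N]"
    unfolding cupL_def
  proof (intro sum_list_cong)
    fix p assume p: "p \<in> set (shuf (alt (1::nat) 2 (Suc (Suc m))) [0..<Suc N])"
    have "val X N u \<delta> (coll l p) = \<delta> (length (coll l p) - 1) (act X N (coll l p) u)" if "l \<in> {1, 2}" for l \<delta>
    proof (rule val_sorted)
      show "coll l p \<noteq> []" "sorted (coll l p)"
        using shuf_alt_coll[OF p that] by (auto simp del: upt_Suc alt.simps)
      show "set (coll l p) \<subseteq> {..N}"
        using shuf_alt_coll(3)[OF p that] by (auto simp del: alt.simps)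
    qed
    then show "?g ((length (coll 1 p) - 1, act X N (coll 1 p) u), (length (coll 2 p) - 1, act X N (coll 2 p) u)) =
       val X N u \<beta> (coll 1 p) * val X N u \<gamma> (coll 2 p)"
      by simp
  qed
  finally show ?thesis .
qed

lemma natural_cup:
  assumes "vanishes X \<beta>" "vanishes X \<gamma>"
  shows "natural (cup X m \<beta> \<gamma>) (cupL m \<beta> \<gamma>)"
proof -
  have p: "(\<Prod>l\<in>{1, 2}. val X N u ((if l = 1 then \<beta> else \<gamma>)) (coll l p)) = val X N u \<beta> (coll 1 p) * val X N u \<gamma> (coll 2 p)"
    for N u and p :: "(nat \<times> nat) list"
    by simp
  note n = natural_word[where w = "alt (1::nat) 2 (Suc (Suc m))" and R = "{1, 2}" and \<beta> = "\<lambda>l. if l = 1 then \<beta> else \<gamma>", unfolded p, folded cupL_def]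
  then show ?thesis
    using assms unfolding natural_def by (auto simp: cup_eq simp del: upt_Suc)
qed

lemma cupL_not_distinct:
  assumes "u \<in> cells X N" "vanishes X \<beta>" "vanishes X \<gamma>" "\<not> distinct_adj L"
  shows "cupL m \<beta> \<gamma> N u L = 0"
  unfolding cupL_def
proof (intro sum_list_eq_0)
  fix p assume p: "p \<in> set (shuf (alt (1::nat) 2 (Suc (Suc m))) L)"
  then have "\<not> distinct_adj p"
    using shuf_distinct_adj[OF p] assms(4) by blast
  moreover have "fst ` set p \<subseteq> {1, 2}"
    using fst_shuf[OF p] set_alt[of 1 "2::nat" m] by simp
  ultimately have "\<not> distinct (coll 1 p) \<or> \<not> distinct (coll 2 p)"
    using coll2_not_distinct_adj[of p] distinct_adj_altdef remdups_adj_distinct by metis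
  then show "val X N u \<beta> (coll 1 p) * val X N u \<gamma> (coll 2 p) = 0"
    using val_distinct[OF assms(1)] assms(2,3) by auto
qed

text \<open>A degenerate simplex is a pullback along a list with equal neighbours, and on such lists
  \<open>cupL\<close> is 0.\<close>

lemma vanishes_cup:
  assumes "vanishes X \<beta>" "vanishes X \<gamma>"
  shows "vanishes X (cup X m \<beta> \<gamma>)"
  unfolding vanishes_def
proof (intro allI ballI impI)
  fix k u assume u: "u \<in> cells X k" "degenerate X k u"
  then obtain i v where iv: "i < k" "v \<in> cells X (k - 1)" "u = act X (k - 1) ([0..<Suc i] @ [i..<k]) v"
    by (auto simp: degenerate_def)
  have "[0..<Suc i] @ [i..<k] \<in> Delta k (k - 1)"
    using iv(1) by (auto simp: Delta_def sorted_append)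
  then have "cup X m \<beta> \<gamma> k u = cupL m \<beta> \<gamma> (k - 1) v ([0..<Suc i] @ [i..<k])"
    using natural_cup[OF assms, of m] u(1) iv unfolding natural_def by (simp del: upt_Suc)
  also have "\<not> distinct_adj ([0..<Suc i] @ [i..<k])"
    using iv(1) by (simp add: upt_conv_Cons[of i k] distinct_adj_append_iff)
  then have "cupL m \<beta> \<gamma> (k - 1) v ([0..<Suc i] @ [i..<k]) = 0"
    by (rule cupL_not_distinct[OF iv(2) assms])
  finally show "cup X m \<beta> \<gamma> k u = 0" .
qed

lemma sum_shuf_alt_swap:
  fixes L :: "'b list"
  shows "(\<Sum>p\<leftarrow>shuf (alt (2::nat) 1 k) L. f (coll 1 p) (coll 2 p)) = (\<Sum>p\<leftarrow>shuf (alt (1::nat) 2 k) L. f (coll 2 p) (coll 1 p))"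
proof -
  let ?t = "Transposition.transpose 1 (2::nat)"
  have "alt 2 1 k = map ?t (alt 1 2 k)"
    by (simp add: map_alt)
  moreover have "coll 1 (map (map_prod ?t id) r) = coll 2 r" "coll 2 (map (map_prod ?t id) r) = coll 1 r"
    for r :: "(nat \<times> 'b) list"
    using coll_map_inj[OF inj_transpose[of 1 2], of 2 r] coll_map_inj[OF inj_transpose[of 1 2], of 1 r] by simp_all
  ultimately show ?thesis
    using shuf_map[of ?t "alt 1 2 k" id L] by (simp add: o_def)
qed

text \<open>For cocycles every labelled path has boundary 0, so the boundary in the vertices equals
  the boundary in the word 1212... Only its two outer faces survive, and they are the two words for
  m - 1.\<close>

lemma coboundary_cup:
  assumes u: "u \<in> cells X N" and "cocycle X \<beta>" "cocycle X \<gamma>"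
  shows "coboundary X (cup X m \<beta> \<gamma>) N u =
    (if m = 0 then 0 else cup X (m - 1) \<beta> \<gamma> N u + cup X (m - 1) \<gamma> \<beta> N u)"
proof -
  have van: "vanishes X \<beta>" "vanishes X \<gamma>"
    using assms by (auto simp: cocycle_def)
  let ?L = "[0..<Suc N]"
  \<comment> \<open>Setting the value to 0 on paths with foreign labels makes \<open>f\<close>
    normal on all paths; the words used here contain only 1 and 2.\<close>
  define f where "f p = (if fst ` set p \<subseteq> {1, 2} then val X N u \<beta> (coll 1 p) * val X N u \<gamma> (coll 2 p) else 0)"
    for p :: "(nat \<times> nat) list"
  have n: "normal f"
  proof -
    have "val X N u \<beta> (coll 1 p) * val X N u \<gamma> (coll 2 p) = 0" if "\<not> distinct_adj p" "fst ` set p \<subseteq> {1, 2}" for p :: "(nat \<times> nat) list"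
    proof -
      have "\<not> distinct (coll 1 p) \<or> \<not> distinct (coll 2 p)"
        using coll2_not_distinct_adj[OF that] distinct_adj_altdef remdups_adj_distinct by metis
      then show ?thesis
        using val_distinct[OF u] van by auto
    qed
    then show ?thesis
      by (auto simp: normal_def f_def)
  qed
  have sa: "set (alt a b k) \<subseteq> {a, b}" for a b :: nat and k
    by (induction k arbitrary: a b) auto
  have f: "(\<Sum>p\<leftarrow>shuf w L. f p) = (\<Sum>p\<leftarrow>shuf w L. val X N u \<beta> (coll 1 p) * val X N u \<gamma> (coll 2 p))" if "set w \<subseteq> {1, 2}" for w L
    using that by (intro sum_list_cong) (auto simp: f_def dest: fst_shuf)
  have cupL: "cupL m \<beta> \<gamma> N u L = (\<Sum>p\<leftarrow>shuf (alt 1 2 (Suc (Suc m))) L. f p)" for L m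
    unfolding cupL_def by (rule f[OF sa, symmetric])
  have "bd f p = 0" if p: "p \<in> set (shuf (alt 1 2 (Suc (Suc m))) ?L)" for p
  proof -
    have l: "fst ` set p \<subseteq> {1, 2}"
      using fst_shuf[OF p] sa[of 1 2 "Suc (Suc m)"] by simp
    have "bd f p = bd (\<lambda>p. val X N u \<beta> (coll 1 p) * val X N u \<gamma> (coll 2 p)) p"
    proof (rule bd_cong)
      fix q assume "q \<in> set (faces p)"
      then have "fst ` set q \<subseteq> {1, 2}"
        using l set_faces[of q p] by auto
      then show "f q = val X N u \<beta> (coll 1 q) * val X N u \<gamma> (coll 2 q)"
        by (simp add: f_def)
    qed
    also have "\<dots> = 0"
      by (simp add: bd_coll2[OF l, of "\<lambda>a b. val X N u \<beta> a * val X N u \<gamma> b"] D2_def bd_mult_right bd_mult_left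
          bd_val[OF u assms(2)] bd_val[OF u assms(3)])
    finally show ?thesis .
  qed
  then have "0 = (\<Sum>p\<leftarrow>shuf (alt 1 2 (Suc (Suc m))) ?L. bd f p)"
    by (intro sum_list_eq_0[symmetric])
  also have "\<dots> = bd (\<lambda>A. \<Sum>p\<leftarrow>shuf A ?L. f p) (alt 1 2 (Suc (Suc m))) + bd (cupL m \<beta> \<gamma> N u) ?L"
    unfolding shuf_bd cupL[abs_def] by (simp del: alt.simps upt_Suc add: One_nat_def)
  also have "bd (\<lambda>A. \<Sum>p\<leftarrow>shuf A ?L. f p) (alt 1 2 (Suc (Suc m))) =
     (\<Sum>p\<leftarrow>shuf (alt 2 1 (Suc m)) ?L. f p) + (\<Sum>p\<leftarrow>shuf (alt 1 2 (Suc m)) ?L. f p)"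
    by (rule normal_bd_alt[OF normal_shuf(1)[OF n]])
  also have "\<dots> = (if m = 0 then 0 else cup X (m - 1) \<beta> \<gamma> N u + cup X (m - 1) \<gamma> \<beta> N u)"
  proof (cases m)
    case 0
    \<comment> \<open>For m = 0 the outer faces are one-letter words: the other label collects
      \<open>[]\<close>, where \<open>val\<close> is 0.\<close>
    have "(\<Sum>p\<leftarrow>shuf [l] ?L. f p) = 0" for l
    proof (intro sum_list_eq_0)
      fix p assume "p \<in> set (shuf [l] ?L)"
      then have "coll 1 p = [] \<or> coll 2 p = []"
        using fst_shuf[of p "[l]" ?L] by (auto simp: coll_eq_Nil)
      then show "f p = 0"
        by (auto simp: f_def)
    qed
    then show ?thesis
      using 0 by (simp del: upt_Suc)
  next
    case (Suc k)
    have "(\<Sum>p\<leftarrow>shuf (alt 2 1 (Suc m)) ?L. f p) = cup X k \<gamma> \<beta> N u"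
      unfolding Suc cup_eq[OF u van(2,1)] cupL_def using sa[of 2 1 "Suc (Suc k)"]
      using f[of "alt 2 1 (Suc (Suc k))" ?L] sum_shuf_alt_swap[of "\<lambda>a b. val X N u \<beta> a * val X N u \<gamma> b" "Suc (Suc k)" ?L]
      by (simp only: insert_commute mult.commute[of "val X N u \<beta> _"] if_True simp_thms)
    moreover have "(\<Sum>p\<leftarrow>shuf (alt 1 2 (Suc m)) ?L. f p) = cup X k \<beta> \<gamma> N u"
      unfolding Suc cup_eq[OF u van] cupL by simp
    ultimately show ?thesis
      using Suc by (simp add: add.commute)
  qed
  finally show ?thesis
    unfolding coboundary_natural[OF natural_cup[OF van] u]
    by (rule bit_eq_of_add)
qed

lemma cocycle_cup: "cocycle X \<beta> \<Longrightarrow> cocycle X (cup X m \<beta> \<beta>)"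
  by (auto simp: cocycle_def vanishes_cup) (auto simp: coboundary_cup cocycle_def)

end

section \<open>Table reduction and the action on cochains\<close>

definition compositions :: "nat \<Rightarrow> nat \<Rightarrow> nat list set" where
  "compositions k s = {as. length as = k \<and> (\<forall>a\<in>set as. 1 \<le> a) \<and> sum_list as = s}"

lemma finite_compositions: "finite (compositions k s)"
proof (rule finite_subset)
  show "compositions k s \<subseteq> {as. set as \<subseteq> {..s} \<and> length as = k}"
    by (auto simp: compositions_def dest: member_le_sum_list)
qed (simp add: finite_lists_length_eq)

lemma compositions_empty: "s < k \<Longrightarrow> compositions k s = {}"
proof -
  assume "s < k"
  have "length as \<le> sum_list as" if "\<forall>a\<in>set as. 1 \<le> a" for as :: "nat list"
    using that by (induction as) auto
  with \<open>s < k\<close> show "compositions k s = {}"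
    by (fastforce simp: compositions_def)
qed

lemma tabs_single: "tabs [r] = [r]"
  by (induction r) (simp_all add: tabs.simps(3))

lemma compositions_Suc: "compositions (Suc k) (Suc s) = (#) 1 ` compositions k s \<union> (\<lambda>as. Suc (hd as) # tl as) ` compositions (Suc k) s"
proof (intro equalityI subsetI)
  fix as assume as: "as \<in> compositions (Suc k) (Suc s)"
  then obtain a bs where ab: "as = a # bs"
    by (cases as) (auto simp: compositions_def)
  show "as \<in> (#) 1 ` compositions k s \<union> (\<lambda>as. Suc (hd as) # tl as) ` compositions (Suc k) s"
  proof (cases "a = 1")
    case True
    then show ?thesis
      using as ab by (auto simp: compositions_def)
  next
    case False
    then obtain a' where a': "a = Suc a'" "1 \<le> a'"
      using as ab by (cases a) (auto simp: compositions_def One_nat_def)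
    then have "a' # bs \<in> compositions (Suc k) s"
      using as ab by (auto simp: compositions_def)
    then show ?thesis
      using ab a' by (intro UnI2 image_eqI[of _ _ "a' # bs"]) auto
  qed
next
  fix as assume "as \<in> (#) 1 ` compositions k s \<union> (\<lambda>as. Suc (hd as) # tl as) ` compositions (Suc k) s"
  then show "as \<in> compositions (Suc k) (Suc s)"
  proof
    assume "as \<in> (#) 1 ` compositions k s"
    then show ?thesis
      by (auto simp: compositions_def)
  next
    assume "as \<in> (\<lambda>as. Suc (hd as) # tl as) ` compositions (Suc k) s"
    then obtain bs where "as = Suc (hd bs) # tl bs" "bs \<in> compositions (Suc k) s"
      by blast
    then show ?thesis
      by (cases bs) (auto simp: compositions_def)
  qed
qed

lemma sum_compositions_Suc:
  "(\<Sum>as\<in>compositions (Suc k) (Suc s). f as) =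
    (\<Sum>as\<in>compositions k s. f (1 # as)) + (\<Sum>as\<in>compositions (Suc k) s. f (Suc (hd as) # tl as))"
  for f :: "nat list \<Rightarrow> bit"
proof -
  have pos: "\<exists>a bs. as = a # bs \<and> 1 \<le> a" if "as \<in> compositions (Suc k) s" for as
    using that by (cases as) (auto simp: compositions_def)
  have "((#) 1 ` compositions k s) \<inter> ((\<lambda>as. Suc (hd as) # tl as) ` compositions (Suc k) s) = {}"
    using pos by fastforce
  moreover have "inj_on (\<lambda>as. Suc (hd as) # tl as) (compositions (Suc k) s)"
  proof (rule inj_onI)
    fix as bs assume *: "as \<in> compositions (Suc k) s" "bs \<in> compositions (Suc k) s" "Suc (hd as) # tl as = Suc (hd bs) # tl bs"
    then show "as = bs"
      using pos[OF *(1)] pos[OF *(2)] by auto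
  qed
  ultimately show ?thesis
    unfolding compositions_Suc by (simp add: sum.union_disjoint finite_compositions sum.reindex o_def)
qed

text \<open>A composition begins with 1 if the first letter ends its row, and otherwise its first
  part can be lowered by one. The last hypothesis excludes a single empty row, for which
  \<open>tabs\<close> yields the empty word although no composition into positive parts
  exists.\<close>

lemma sum_table_seq:
  fixes G :: "nat list \<Rightarrow> bit"
  assumes "T \<noteq> []" "\<And>r. r \<in> set T \<Longrightarrow> distinct r \<and> set r = S" "finite S" "S \<noteq> {} \<or> length T \<ge> 2"
  shows "(\<Sum>as\<in>compositions (length T) (length T - 1 + card S). G (table_seq T as)) = (\<Sum>w\<leftarrow>tabs T. G w)"
  using assms
proof (induction T arbitrary: G S rule: tabs.induct)
  case (2 T)
  then have "S = {}"
    by force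
  then show ?case
    using 2 by (cases T) (simp_all add: compositions_empty)
next
  case (3 x r T)
  have dr: "distinct r" "x \<notin> set r" and S: "S = insert x (set r)"
    using "3.prems"(2)[of "x # r"] by auto
  have T: "distinct s" "set s = S" if "s \<in> set T" for s
    using "3.prems"(2)[of s] that by auto
  have c: "card S = Suc (length r)"
    using S dr by (simp add: distinct_card)
  show ?case
  proof (cases "T = []")
    case True
    have "compositions 1 (Suc (length r)) = {[Suc (length r)]}"
      by (auto simp: compositions_def length_Suc_conv One_nat_def)
    then show ?thesis
      using True by (simp add: c tabs_single One_nat_def)
  next
    case False
    then obtain n where n: "length T = Suc n"
      by (cases T) auto
    let ?g = "\<lambda>w. G (x # w)"
    have IH1: "(\<Sum>as\<in>compositions (length T) (length T - 1 + card S). ?g (table_seq T as)) = (\<Sum>w\<leftarrow>tabs T. ?g w)"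
      using False "3.prems" S by (intro "3.IH"(1)) auto
    let ?T = "r # map (removeAll x) T"
    have IH2: "(\<Sum>as\<in>compositions (length ?T) (length ?T - 1 + card (set r)). ?g (table_seq ?T as)) = (\<Sum>w\<leftarrow>tabs ?T. ?g w)"
      using False dr T S n by (intro "3.IH"(2)) (auto simp: distinct_removeAll)
    have e: "compositions (length ((x # r) # T)) (length ((x # r) # T) - 1 + card S) = compositions (Suc (length T)) (Suc (n + card S))"
      by (simp add: n)
    have f1: "table_seq ((x # r) # T) (1 # as) = x # table_seq T as" for as
      using map_idI[of T "filter (\<lambda>_. True)"] by (simp add: One_nat_def)
    have f2: "table_seq ((x # r) # T) (Suc (hd as) # tl as) = x # table_seq ?T as"
      if as: "as \<in> compositions (Suc (length T)) (n + card S)" for as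
    proof -
      have "r \<noteq> []"
        using as compositions_empty[of "n + card S" "Suc (length T)"] by (auto simp: c n)
      moreover obtain a bs where ab: "as = Suc a # bs"
      proof (cases as)
        case Nil
        then show thesis
          using as by (simp add: compositions_def)
      next
        case (Cons a bs)
        then show thesis
          using as that by (cases a) (auto simp: compositions_def)
      qed
      ultimately have "take (Suc a) r \<noteq> []"
        by simp
      moreover have "filter (\<lambda>v. v \<notin> insert x B) s = filter (\<lambda>v. v \<notin> B) (removeAll x s)" for B s
        by (induction s) auto
      then have "filter (\<lambda>v. v \<notin> insert x B) = (\<lambda>s. filter (\<lambda>v. v \<notin> B) (removeAll x s))" for B
        by (intro ext)
      ultimately show ?thesis
        by (simp add: ab Let_def o_def)
    qed
    show ?thesis
      unfolding e sum_compositions_Suc sum_tabs_Cons IH1[symmetric] IH2[symmetric]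
      using f1 f2 by (intro arg_cong2[where f = "(+)"] sum.cong) (simp_all add: n c distinct_card[OF dr(1)])
  qed
qed simp

section \<open>Sequences of permutations acting on a cocycle\<close>

definition row4 :: "perm \<Rightarrow> nat list" where
  "row4 \<sigma> = map \<sigma> [1..<5]"

lemma carrier_S4: "carrier S4 = {\<sigma>. \<sigma> permutes {1..4}}"
  by (simp add: sym_group_def)

lemma row4: "\<sigma> \<in> carrier S4 \<Longrightarrow> distinct (row4 \<sigma>) \<and> set (row4 \<sigma>) = {1..4}"
proof -
  assume "\<sigma> \<in> carrier S4"
  then have p: "\<sigma> permutes {1..4}"
    by (simp add: carrier_S4)
  have "{1..<5} = {1..4::nat}"
    by auto
  then show ?thesis
    using permutes_image[OF p] permutes_inj_on[OF p] by (simp add: row4_def distinct_map)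
qed

lemma ev_TR:
  assumes "length \<sigma>s = Suc k" "set \<sigma>s \<subseteq> carrier S4"
  shows "ev G (TR 4 (k, \<sigma>s)) = (\<Sum>w\<leftarrow>tabs (map row4 \<sigma>s). if set w = {1..4} \<and> distinct_adj w then G w else 0)"
proof -
  have r: "distinct r \<and> set r = {1..4}" if "r \<in> set (map row4 \<sigma>s)" for r
    using that assms(2) row4 by auto
  have e: "{as. length as = Suc k \<and> (\<forall>a\<in>set as. 1 \<le> a) \<and> sum_list as = k + 4} =
      compositions (length (map row4 \<sigma>s)) (length (map row4 \<sigma>s) - 1 + card {1..4::nat})"
    using assms(1) by (simp add: compositions_def)
  have "\<sigma>s \<noteq> []"
    using assms(1) by auto
  have "ev G (TR 4 (k, \<sigma>s)) = (\<Sum>as\<in>compositions (length (map row4 \<sigma>s)) (length (map row4 \<sigma>s) - 1 + card {1..4::nat}).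
     (\<lambda>w. if set w = {1..4} \<and> distinct_adj w then G w else 0) (table_seq (map row4 \<sigma>s) as))"
    unfolding TR_def prod.case ev_sum e
    by (intro sum.cong refl) (simp add: surj_cls_def row4_def[abs_def])
  also have "\<dots> = (\<Sum>w\<leftarrow>tabs (map row4 \<sigma>s). if set w = {1..4} \<and> distinct_adj w then G w else 0)"
    using \<open>\<sigma>s \<noteq> []\<close> r by (intro sum_table_seq) auto
  finally show ?thesis .
qed

lemma sum_apply2: "(\<Sum>a\<in>S. f a) x y = (\<Sum>a\<in>S. f a x y :: 'c :: comm_monoid_add)"
  by (induction S rule: infinite_finite_induct) simp_all

context simplicial_set begin

definition theta :: "'a cochain \<Rightarrow> nat \<Rightarrow> 'a \<Rightarrow> nat list \<Rightarrow> perm list \<Rightarrow> bit" where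
  "theta \<alpha> N u L gs = (if set gs \<subseteq> carrier S4 then
     \<Sum>w\<leftarrow>tabs (map row4 gs). \<Sum>p\<leftarrow>shuf w L. \<Prod>l\<in>{1..4::nat}. val X N u \<alpha> (coll l p) else 0)"

lemma word_eq_0:
  assumes "u \<in> cells X N" "vanishes X \<alpha>" "set w \<subseteq> R" "finite R" "\<not> (set w = R \<and> distinct_adj w)" "p \<in> set (shuf w L)"
  shows "(\<Prod>l\<in>R. val X N u \<alpha> (coll l p)) = 0"
proof -
  have "\<exists>l\<in>R. val X N u \<alpha> (coll l p) = 0"
  proof (cases "set w = R")
    case False
    then obtain l where "l \<in> R" "l \<notin> set w"
      using assms(3) by blast
    then show ?thesis
      using fst_shuf[OF assms(6)] by (intro bexI[of _ l]) (simp_all add: coll_eq_Nil[THEN iffD2])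
  next
    case True
    then have "\<not> distinct_adj p"
      using assms(5) shuf_distinct_adj[OF assms(6)] by blast
    then obtain l where l: "l \<in> fst ` set p" "\<not> distinct_adj (coll l p)"
      using coll_not_distinct_adj by blast
    then have "\<not> distinct (coll l p)"
      using distinct_adj_altdef remdups_adj_distinct by metis
    then show ?thesis
      using l(1) True fst_shuf[OF assms(6)] val_distinct[OF assms(1,2)] by auto
  qed
  then show ?thesis
    using assms(4) by (intro prod_zero)
qed

lemma set_tabs_row4:
  assumes "set gs \<subseteq> carrier S4" "w \<in> set (tabs (map row4 gs))"
  shows "set w \<subseteq> {1..4}"
  using set_tabs[OF assms(2)] assms(1) row4 by fastforce

lemma ev_TR_surj_act:
  assumes u: "u \<in> cells X N" and \<alpha>: "vanishes X \<alpha>" and gs: "length gs = Suc k" "set gs \<subseteq> carrier S4"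
  shows "ev (\<lambda>A. surj_act X 4 A (\<lambda>_. \<alpha>) N u) (TR 4 (k, gs)) = theta \<alpha> N u [0..<Suc N] gs"
  unfolding ev_TR[OF gs] theta_def if_P[OF gs(2)]
proof (intro sum_list_cong)
  fix w assume w: "w \<in> set (tabs (map row4 gs))"
  show "(if set w = {1..4} \<and> distinct_adj w then surj_act X 4 w (\<lambda>_. \<alpha>) N u else 0) =
    (\<Sum>p\<leftarrow>shuf w [0..<Suc N]. \<Prod>l\<in>{1..4::nat}. val X N u \<alpha> (coll l p))"
  proof (cases "set w = {1..4} \<and> distinct_adj w")
    case True
    then show ?thesis
      using surj_act_eq[OF u, of "\<lambda>_. \<alpha>" w 4] \<alpha> by (simp del: upt_Suc)
  next
    case False
    have "(\<Sum>p\<leftarrow>shuf w [0..<Suc N]. \<Prod>l\<in>{1..4::nat}. val X N u \<alpha> (coll l p)) = 0"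
      using set_tabs_row4[OF gs(2) w] False by (intro sum_list_eq_0 word_eq_0[OF u \<alpha>]) auto
    then show ?thesis
      unfolding if_not_P[OF False] by simp
  qed
qed

lemma BS4_act_eq:
  assumes u: "u \<in> cells X N" and \<alpha>: "vanishes X \<alpha>"
    and c: "lift_chain S4 y \<in> chains (EG S4)"
  shows "BS4_act X y \<alpha> N u = ev (\<lambda>(k, gs). theta \<alpha> N u [0..<Suc N] gs) (lift_chain S4 y)"
proof -
  have "BS4_act X y \<alpha> N u = ev (\<lambda>A. surj_act X 4 A (\<lambda>_. \<alpha>) N u) (lin (TR 4) (lift_chain S4 y))"
    by (simp add: BS4_act_def sum_apply2 ev_def)
  also have "\<dots> = ev (\<lambda>x. ev (\<lambda>A. surj_act X 4 A (\<lambda>_. \<alpha>) N u) (TR 4 x)) (lift_chain S4 y)"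
    by (rule ev_lin)
  also have "\<dots> = ev (\<lambda>(k, gs). theta \<alpha> N u [0..<Suc N] gs) (lift_chain S4 y)"
  proof (rule ev_cong)
    fix x assume x: "x \<in> Poly_Mapping.keys (lift_chain S4 y)"
    obtain k gs where kg: "x = (k, gs)"
      by fastforce
    have "gs \<in> cells (EG S4) k"
      using c x kg by (auto simp: chains_def)
    then show "ev (\<lambda>A. surj_act X 4 A (\<lambda>_. \<alpha>) N u) (TR 4 x) = (case x of (k, gs) \<Rightarrow> theta \<alpha> N u [0..<Suc N] gs)"
      using ev_TR_surj_act[OF u \<alpha>, of gs k] by (simp add: kg EG_def del: upt_Suc)
  qed
  finally show ?thesis .
qed

lemma normal_theta:
  assumes "u \<in> cells X N" "vanishes X \<alpha>"
  shows "normal (theta \<alpha> N u L)"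
  unfolding normal_def
proof (intro allI impI)
  fix gs :: "perm list" assume "\<not> distinct_adj gs"
  then have nd: "\<not> distinct_adj (map row4 gs)"
    by (blast dest: distinct_adj_mapD)
  show "theta \<alpha> N u L gs = 0"
  proof (cases "set gs \<subseteq> carrier S4")
    case True
    have "distinct r" if "r \<in> set (map row4 gs)" for r
      using True that row4 by auto
    then have "\<not> distinct_adj w" if "w \<in> set (tabs (map row4 gs))" for w
      using tabs_distinct_adj[OF that] nd by blast
    then have "(\<Sum>w\<leftarrow>tabs (map row4 gs). \<Sum>p\<leftarrow>shuf w L. \<Prod>l\<in>{1..4::nat}. val X N u \<alpha> (coll l p)) = 0"
      using set_tabs_row4[OF True] by (intro sum_list_eq_0 word_eq_0[OF assms]) auto
    then show ?thesis
      by (simp add: theta_def)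
  qed (simp add: theta_def)
qed

text \<open>Left multiplication by g renames the four letters in all rows at once. All four inputs
  equal \<alpha>, so only the factors of the product are permuted.\<close>

lemma theta_translate:
  assumes g: "g \<in> carrier S4" and gs: "set gs \<subseteq> carrier S4"
  shows "theta \<alpha> N u L (map (\<lambda>h. g \<circ> h) gs) = theta \<alpha> N u L gs"
proof -
  have p: "g permutes {1..4}"
    using g by (simp add: carrier_S4)
  have inj: "inj g"
    by (rule permutes_inj[OF p])
  have s: "set (map (\<lambda>h. g \<circ> h) gs) \<subseteq> carrier S4"
    using gs p by (auto simp: carrier_S4 intro: permutes_compose)
  have "map row4 (map (\<lambda>h. g \<circ> h) gs) = map (map g) (map row4 gs)"
    by (simp add: row4_def o_def)
  then have T: "tabs (map row4 (map (\<lambda>h. g \<circ> h) gs)) = map (map g) (tabs (map row4 gs))"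
    by (simp only: tabs_map[OF inj])
  have "(\<Prod>l\<in>{1..4::nat}. val X N u \<alpha> (coll l (map (map_prod g id) p))) = (\<Prod>l\<in>{1..4::nat}. val X N u \<alpha> (coll l p))"
    for p :: "(nat \<times> nat) list"
  proof -
    have "(\<Prod>l\<in>{1..4::nat}. val X N u \<alpha> (coll l (map (map_prod g id) p))) =
      (\<Prod>l\<in>{1..4::nat}. val X N u \<alpha> (coll (g l) (map (map_prod g id) p)))"
      using prod.permute[OF p, of "\<lambda>l. val X N u \<alpha> (coll l (map (map_prod g id) p))"] by (simp add: o_def)
    then show ?thesis
      by (simp add: coll_map_inj[OF inj])
  qed
  then show ?thesis
    unfolding theta_def if_P[OF s] if_P[OF gs] T using shuf_map[of g _ id L] by (simp add: o_def)
qed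

text \<open>The boundary of a word with its divisions splits into a part in the vertices and a part
  in the word. The total is 0 by the cocycle condition, and the part in the word is the boundary in
  \<open>gs\<close> by table reduction.\<close>

lemma theta_bd:
  assumes u: "u \<in> cells X N" and \<alpha>: "cocycle X \<alpha>" and gs: "set gs \<subseteq> carrier S4"
  shows "bd (\<lambda>L. theta \<alpha> N u L gs) L = bd (theta \<alpha> N u L) gs"
proof -
  let ?f = "\<lambda>p. \<Prod>l\<in>{1..4::nat}. val X N u \<alpha> (coll l p)"
  let ?S = "\<lambda>w L. \<Sum>p\<leftarrow>shuf w L. ?f p"
  have rows: "distinct r \<and> set r = {1..4}" if "r \<in> set (map row4 gs)" for r
    using that gs row4 by auto
  have f0: "?f [] = 0"
    by (intro prod_zero bexI[of _ 1]) auto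
  have w0: "bd (\<lambda>w. ?S w L) w = bd (?S w) L" if w: "w \<in> set (tabs (map row4 gs))" for w
  proof -
    have "bd ?f p = 0" if p: "p \<in> set (shuf w L)" for p
      using fst_shuf[OF p] set_tabs_row4[OF gs w] bd_val[OF u \<alpha>] by (intro bd_prod_coll) auto
    then have "0 = (\<Sum>p\<leftarrow>shuf w L. bd ?f p)"
      by (intro sum_list_eq_0[symmetric])
    also have "\<dots> = bd (?S w) L + bd (\<lambda>w. ?S w L) w"
      unfolding shuf_bd f0 by (simp add: add.commute)
    finally show ?thesis
      by (rule bit_eq_of_add)
  qed
  have "bd (\<lambda>L. theta \<alpha> N u L gs) L = (\<Sum>w\<leftarrow>tabs (map row4 gs). bd (?S w) L)"
    using gs by (simp add: theta_def bd_sum_list)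
  also have "\<dots> = (\<Sum>w\<leftarrow>tabs (map row4 gs). bd (\<lambda>w. ?S w L) w)"
    by (intro sum_list_cong) (simp add: w0)
  also have "\<dots> = bd (\<lambda>T. \<Sum>w\<leftarrow>tabs T. ?S w L) (map row4 gs)
     + (\<Sum>l\<in>{1..4::nat}. \<Sum>w\<leftarrow>tabs (map (removeAll l) (map row4 gs)). ?S w L)"
    by (intro tabs_bd rows) auto
  also have "(\<Sum>l\<in>{1..4::nat}. \<Sum>w\<leftarrow>tabs (map (removeAll l) (map row4 gs)). ?S w L) = 0"
  proof (intro sum.neutral ballI sum_list_eq_0)
    fix l w p assume l: "l \<in> {1..4::nat}" and w: "w \<in> set (tabs (map (removeAll l) (map row4 gs)))" and p: "p \<in> set (shuf w L)"
    have "l \<notin> set w"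
      using set_tabs[OF w] by auto
    then have "coll l p = []"
      using fst_shuf[OF p] by (simp add: coll_eq_Nil)
    then show "?f p = 0"
      using l by (intro prod_zero bexI[of _ l]) auto
  qed
  also have "bd (\<lambda>T. \<Sum>w\<leftarrow>tabs T. ?S w L) (map row4 gs) = bd (theta \<alpha> N u L) gs"
    unfolding bd_map using gs by (intro bd_cong) (auto simp: theta_def dest: set_faces)
  finally show ?thesis
    by simp
qed

lemma natural_theta:
  assumes "set gs \<subseteq> carrier S4"
  shows "natural (\<lambda>N u. theta \<alpha> N u [0..<Suc N] gs) (\<lambda>N u L. theta \<alpha> N u L gs)"
  using natural_word[where R = "{1..4::nat}" and \<beta> = "\<lambda>_. \<alpha>"] assms
  unfolding natural_def theta_def by (auto intro!: sum_list_cong simp del: upt_Suc)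

lemma coboundary_theta:
  assumes "u \<in> cells X N" "cocycle X \<alpha>" "set gs \<subseteq> carrier S4"
  shows "coboundary X (\<lambda>N u. theta \<alpha> N u [0..<Suc N] gs) N u = bd (theta \<alpha> N u [0..<Suc N]) gs"
  using coboundary_natural[OF natural_theta[OF assms(3)] assms(1)] theta_bd[OF assms] by simp

end

section \<open>Classifying spaces and the groups\<close>

lemma simplicial_set_EG: "simplicial_set (EG G)"
proof
  fix u n \<theta> m assume u: "u \<in> cells (EG G) n" and \<theta>: "\<theta> \<in> Delta m n"
  have l: "length u = Suc n" "set u \<subseteq> carrier G" "length \<theta> = Suc m" "set \<theta> \<subseteq> {..n}"
    using u \<theta> by (auto simp: EG_def Delta_def)
  have "u ! x \<in> set u" if "x \<in> set \<theta>" for x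
    using that l by (intro nth_mem) auto
  then show "act (EG G) n \<theta> u \<in> cells (EG G) m"
    using l by (auto simp: EG_def)
  fix \<eta> k assume \<eta>: "\<eta> \<in> Delta k m"
  have "x < length \<theta>" if "x \<in> set \<eta>" for x
    using that \<eta> l by (auto simp: Delta_def)
  then show "act (EG G) m \<eta> (act (EG G) n \<theta> u) = act (EG G) n (map ((!) \<theta>) \<eta>) u"
    by (simp add: EG_def)
next
  fix u n assume "u \<in> cells (EG G) n"
  then have "length u = Suc n"
    by (simp add: EG_def)
  then show "act (EG G) n [0..<Suc n] u = u"
    using map_nth[of u] by (simp add: EG_def)
qed

lemma act_EG: "act (EG G) n \<theta> u = map ((!) u) \<theta>"
  by (simp add: EG_def)

lemma cells_EG: "u \<in> cells (EG G) n \<longleftrightarrow> length u = Suc n \<and> set u \<subseteq> carrier G"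
  by (simp add: EG_def)

lemma degeneracy_not_distinct_adj: "i < k \<Longrightarrow> \<not> distinct_adj ([0..<Suc i] @ [i..<k])"
  by (simp add: upt_conv_Cons[of i k] distinct_adj_append_iff)

lemma degenerate_EG_not_distinct_adj: "degenerate (EG G) k u \<Longrightarrow> \<not> distinct_adj u"
  unfolding degenerate_def act_EG using degeneracy_not_distinct_adj distinct_adj_mapD by metis

lemma degenerate_EG:
  assumes "u \<in> cells (EG G) k"
  shows "degenerate (EG G) k u \<longleftrightarrow> \<not> distinct_adj u"
proof
  assume "\<not> distinct_adj u"
  then obtain i where i: "Suc i < length u" "u ! i = u ! Suc i"
    by (auto simp: distinct_adj_conv_nth)
  let ?v = "take (Suc i) u @ drop (Suc (Suc i)) u"
  have l: "length u = Suc k"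
    using assms by (simp add: cells_EG)
  have "?v \<in> cells (EG G) (k - 1)"
    using assms i set_take_subset[of "Suc i" u] set_drop_subset[of "Suc (Suc i)" u] by (auto simp: cells_EG)
  moreover have "map ((!) ?v) ([0..<Suc i] @ [i..<k]) = u"
    using map_nth_degeneracy[OF i] l by simp
  ultimately show "degenerate (EG G) k u"
    unfolding degenerate_def act_EG using i l by (intro exI[of _ i] exI[of _ ?v]) simp
qed (rule degenerate_EG_not_distinct_adj)

lemma poly_eqI_ev:
  assumes "\<And>f. ev f c = ev f d"
  shows "c = d"
proof (rule poly_mapping_eqI)
  fix x
  have "Poly_Mapping.lookup c x = ev (\<lambda>y. of_bool (y = x)) c" for c :: "'a \<Rightarrow>\<^sub>0 bit"
  proof (cases "x \<in> Poly_Mapping.keys c")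
    case True
    then have "Poly_Mapping.lookup c x = 1"
      by (simp add: in_keys_iff)
    moreover have "ev (\<lambda>y. of_bool (y = x)) c = 1"
      unfolding ev_def using True by (simp add: of_bool_def sum.delta)
    ultimately show ?thesis
      by simp
  next
    case False
    then have "ev (\<lambda>y. of_bool (y = x)) c = 0"
      unfolding ev_def by (intro sum.neutral) auto
    with False show ?thesis
      by (simp add: in_keys_iff)
  qed
  then show "Poly_Mapping.lookup c x = Poly_Mapping.lookup d x"
    using assms by simp
qed

lemma keys_lin: "Poly_Mapping.keys (lin f c) \<subseteq> (\<Union>x\<in>Poly_Mapping.keys c. Poly_Mapping.keys (f x))"
  unfolding lin_def by (rule keys_sum)

lemma keys_cls: "Poly_Mapping.keys (cls X k u) = (if degenerate X k u then {} else {(k, u)})"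
  by (simp add: cls_def)

section \<open>Orbits, coinvariants and the choice of lifts\<close>

lemma (in group) orbit_of_self:
  assumes "set u \<subseteq> carrier G"
  shows "u \<in> orbit_of G u"
proof -
  have "translate G \<one> u = u"
    using assms by (auto simp: translate_def intro!: map_idI)
  then show ?thesis
    unfolding orbit_of_def by (metis imageI one_closed)
qed

lemma act_BG_orbit:
  assumes "u \<in> cells (EG G) n" "set \<theta> \<subseteq> {..n}"
  shows "act (BG G) n \<theta> (orbit_of G u) = orbit_of G (map ((!) u) \<theta>)"
proof -
  have "map ((!) (translate G g u)) \<theta> = translate G g (map ((!) u) \<theta>)" for g
    using assms by (auto simp: translate_def cells_EG)
  then show ?thesis
    by (simp add: BG_def act_EG orbit_of_def image_image)
qed

lemma (in group) degenerate_BG: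
  assumes "set u \<subseteq> carrier G" "degenerate (BG G) k (orbit_of G u)"
  shows "\<not> distinct_adj u"
proof -
  obtain i v where iv: "i < k" "orbit_of G u = act (BG G) (k - 1) ([0..<Suc i] @ [i..<k]) v"
    using assms(2) by (auto simp: degenerate_def)
  then have "u \<in> act (EG G) (k - 1) ([0..<Suc i] @ [i..<k]) ` v"
    using orbit_of_self[OF assms(1)] by (simp add: BG_def)
  then show ?thesis
    unfolding act_EG using degeneracy_not_distinct_adj[OF iv(1)] distinct_adj_mapD by blast
qed

lemma chains_EG: "c \<in> chains (EG G) \<longleftrightarrow>
    (\<forall>(k, u) \<in> Poly_Mapping.keys c. u \<in> cells (EG G) k \<and> distinct_adj u)"
  by (auto simp: chains_def degenerate_EG)

text \<open>An invariant functional descends to orbits by evaluation at an arbitrary representative.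
  This is what removes the choice made by \<open>lift_chain\<close>.\<close>

lemma (in group) ev_proj_eq:
  assumes "c \<in> chains (EG G)" "d \<in> chains (EG G)" "proj G c = proj G d"
    and inv: "\<And>k u g. u \<in> cells (EG G) k \<Longrightarrow> g \<in> carrier G \<Longrightarrow> f (k, translate G g u) = f (k, u)"
  shows "ev f c = ev f d"
proof -
  define fbar where "fbar = (\<lambda>(k, \<omega>). f (k, SOME u. u \<in> \<omega>))"
  have *: "ev fbar (proj G c) = ev f c" if "c \<in> chains (EG G)" for c
    unfolding proj_def ev_push
  proof (rule ev_cong)
    fix x assume "x \<in> Poly_Mapping.keys c"
    then obtain k u where x: "x = (k, u)" "u \<in> cells (EG G) k" "distinct_adj u"
      using \<open>c \<in> chains (EG G)\<close> by (cases x) (auto simp: chains_EG)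
    then have s: "set u \<subseteq> carrier G"
      by (simp add: cells_EG)
    have "(SOME v. v \<in> orbit_of G u) \<in> orbit_of G u"
      using orbit_of_self[OF s] by (rule someI)
    then obtain g where "g \<in> carrier G" "(SOME v. v \<in> orbit_of G u) = translate G g u"
      by (auto simp: orbit_of_def)
    then have "fbar (k, orbit_of G u) = f (k, u)"
      using inv[OF x(2)] by (simp add: fbar_def)
    then show "(case x of (k, u) \<Rightarrow> if degenerate (BG G) k (orbit_of G u) then 0 else fbar (k, orbit_of G u)) = f x"
      using degenerate_BG[OF s] x by auto
  qed
  then show ?thesis
    using assms(1-3) by metis
qed

lemma lift_chain_proj:
  assumes "c \<in> chains (EG G)"
  shows "lift_chain G (proj G c) \<in> chains (EG G) \<and> proj G (lift_chain G (proj G c)) = proj G c"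
  unfolding lift_chain_def by (rule someI_ex) (use assms in blast)

lemma (in group) ev_lift_chain:
  assumes "c \<in> chains (EG G)"
    and "\<And>k u g. u \<in> cells (EG G) k \<Longrightarrow> g \<in> carrier G \<Longrightarrow> f (k, translate G g u) = f (k, u)"
  shows "ev f (lift_chain G (proj G c)) = ev f c"
  by (rule ev_proj_eq[OF _ assms(1)]) (use lift_chain_proj[OF assms(1)] assms(2) in auto)

text \<open>All elements of the H-orbit of u have the same G-orbit, so the union in
  \<open>incl_BG\<close> is that one orbit.\<close>

lemma incl_BG_proj:
  assumes "group G" "group H" "carrier H \<subseteq> carrier G" "mult H = mult G" "c \<in> chains (EG H)"
  shows "c \<in> chains (EG G)" "incl_BG G (proj H c) = proj G c"
proof -
  show c: "c \<in> chains (EG G)"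
    using assms(3,5) by (fastforce simp: chains_EG cells_EG)
  show "incl_BG G (proj H c) = proj G c"
  proof (rule poly_eqI_ev)
    fix f
    show "ev f (incl_BG G (proj H c)) = ev f (proj G c)"
      unfolding incl_BG_def proj_def ev_push
    proof (rule ev_cong)
      fix x assume "x \<in> Poly_Mapping.keys c"
      then obtain k u where x: "x = (k, u)" "u \<in> cells (EG H) k" "distinct_adj u"
        using assms(5) by (cases x) (auto simp: chains_EG)
      then have s: "set u \<subseteq> carrier H" "set u \<subseteq> carrier G"
        using assms(3) by (auto simp: cells_EG)
      have "orbit_of G v = orbit_of G u" if v: "v \<in> orbit_of H u" for v
      proof -
        obtain h where h: "h \<in> carrier H" "v = translate G h u"
          using v assms(4) by (auto simp: orbit_of_def translate_def)
        then have hG: "h \<in> carrier G"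
          using assms(3) by auto
        interpret group G by fact
        have tt: "translate G g (translate G h u) = translate G (g \<otimes>\<^bsub>G\<^esub> h) u" if "g \<in> carrier G" for g
          using s(2) hG that by (auto simp: translate_def m_assoc)
        have "(\<lambda>g. g \<otimes>\<^bsub>G\<^esub> h) ` carrier G = carrier G"
        proof (intro equalityI subsetI)
          fix g assume "g \<in> carrier G"
          then have "g = (g \<otimes>\<^bsub>G\<^esub> inv\<^bsub>G\<^esub> h) \<otimes>\<^bsub>G\<^esub> h" "g \<otimes>\<^bsub>G\<^esub> inv\<^bsub>G\<^esub> h \<in> carrier G"
            using hG by (simp_all add: m_assoc)
          then show "g \<in> (\<lambda>g. g \<otimes>\<^bsub>G\<^esub> h) ` carrier G"
            by blast
        qed (use hG in auto)
        then have "(\<lambda>g. translate G (g \<otimes>\<^bsub>G\<^esub> h) u) ` carrier G = (\<lambda>g. translate G g u) ` carrier G"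
          using image_image[of "\<lambda>g. translate G g u" "\<lambda>g. g \<otimes>\<^bsub>G\<^esub> h" "carrier G"] by simp
        then show ?thesis
          unfolding orbit_of_def h(2) using tt by (simp cong: image_cong)
      qed
      then have "\<Union> (orbit_of G ` orbit_of H u) = (\<Union>v\<in>orbit_of H u. orbit_of G u)"
        by (rule SUP_cong[OF refl])
      moreover have "orbit_of H u \<noteq> {}"
        using group.orbit_of_self[OF assms(2) s(1)] by blast
      ultimately have U: "\<Union> (orbit_of G ` orbit_of H u) = orbit_of G u"
        by simp
      show "(case x of (k, u) \<Rightarrow> if degenerate (BG H) k (orbit_of H u) then 0
          else (case (k, orbit_of H u) of (k, u) \<Rightarrow> if degenerate (BG G) k (\<Union> (orbit_of G ` u)) then 0 else f (k, \<Union> (orbit_of G ` u)))) =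
        (case x of (k, u) \<Rightarrow> if degenerate (BG G) k (orbit_of G u) then 0 else f (k, orbit_of G u))"
        using group.degenerate_BG[OF assms(2) s(1)] x U by auto
    qed
  qed
qed

section \<open>Coordinates on the groups by bits\<close>

definition tp :: "bool \<Rightarrow> perm" where
  "tp e = (if e then pT else id)"

definition vV :: "bool \<times> bool \<Rightarrow> perm" where
  "vV = (\<lambda>(e, f). vertex_V4 (tp e, tp f))"

definition vD :: "bool \<times> bool \<times> bool \<Rightarrow> perm" where
  "vD = (\<lambda>(r, s, t). vertex_D8 (tp r, tp s, tp t))"

lemma pT_neq_id: "pT \<noteq> id"
proof
  assume "pT = id"
  then have "pT 1 = 1"
    by simp
  then show False
    by (simp add: pT_def)
qed

lemma tp_eq_iff [simp]: "tp e = tp f \<longleftrightarrow> e = f"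
  using pT_neq_id by (auto simp: tp_def)

lemma inj_tp: "inj tp"
  by (simp add: inj_def)

lemma pT_pT: "pT \<circ> pT = id"
  by (simp add: pT_def)

lemma carrier_S2: "carrier S2 = range tp"
proof -
  have "{1..2} = {1, 2::nat}"
    by auto
  then show ?thesis
    by (auto simp: sym_group_def permutes_doubleton_iff tp_def pT_def)
qed

lemma xt_eq: "xt k = map tp (xb k)"
proof -
  have "pT ^^ i = tp (odd i)" for i
    using pT_pT by (induction i) (auto simp: tp_def fun_eq_iff)
  moreover have "xb k = map odd [0..<Suc k]"
    by (rule nth_equalityI) (simp_all add: alt_nth del: alt.simps upt_Suc)
  ultimately show ?thesis
    by (simp add: xt_def o_def)
qed

lemma vV_eq: "vV (e, f) = (if e then pa else id) \<circ> (if f then pb \<circ> pc else id)"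
  using pT_neq_id by (auto simp: vV_def vertex_V4_def if_T_def tp_def)

lemma vD_eq: "vD (r, s, t) = (if t then pc else id) \<circ> (if s then pb else id) \<circ> (if r then pa else id)"
  using pT_neq_id by (auto simp: vD_def vertex_D8_def if_T_def tp_def)

lemma relations:
  "pa \<circ> pa = id" "pb \<circ> pb = id" "pc \<circ> pc = id" "pc \<circ> pb = pb \<circ> pc" "pb \<circ> pa = pa \<circ> pc" "pc \<circ> pa = pa \<circ> pb"
  "p23 \<circ> p23 = id"
  by (auto simp: fun_eq_iff pa_def pb_def pc_def p23_def Transposition.transpose_def)

lemma perm_simps:
  "pa \<circ> pa = id" "pb \<circ> pb = id" "pc \<circ> pc = id" "pc \<circ> pb = pb \<circ> pc" "pb \<circ> pa = pa \<circ> pc" "pc \<circ> pa = pa \<circ> pb"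
  "pa \<circ> (pa \<circ> f) = f" "pb \<circ> (pb \<circ> f) = f" "pc \<circ> (pc \<circ> f) = f" "pc \<circ> (pb \<circ> f) = pb \<circ> (pc \<circ> f)"
  "pb \<circ> (pa \<circ> f) = pa \<circ> (pc \<circ> f)" "pc \<circ> (pa \<circ> f) = pa \<circ> (pb \<circ> f)"
  using relations by (simp_all flip: comp_assoc)

lemma in_S4: "pa \<in> carrier S4" "pb \<in> carrier S4" "pc \<in> carrier S4" "p23 \<in> carrier S4"
  unfolding carrier_S4 pa_def pb_def pc_def p23_def mem_Collect_eq
  by (intro permutes_compose permutes_swap_id; simp)+

lemma group_S4: "group S4"
  by (rule sym_group_is_group)

lemma mult_S4 [simp]: "x \<otimes>\<^bsub>S4\<^esub> y = x \<circ> y" and one_S4 [simp]: "\<one>\<^bsub>S4\<^esub> = id"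
  by (simp_all add: sym_group_def)

lemma comp_S4: "x \<in> carrier S4 \<Longrightarrow> y \<in> carrier S4 \<Longrightarrow> x \<circ> y \<in> carrier S4"
  by (simp add: carrier_S4 permutes_compose)

lemma inv_S4: "x \<in> carrier S4 \<Longrightarrow> x \<circ> x = id \<Longrightarrow> inv\<^bsub>S4\<^esub> x = x"
  using group.inv_equality[OF group_S4, of x x] by simp

lemma group_generate_S4: "H \<subseteq> carrier S4 \<Longrightarrow> group (S4\<lparr>carrier := generate S4 H\<rparr>)"
  by (intro group.subgroup_imp_group[OF group_S4] group.generate_is_subgroup[OF group_S4])

lemma group_V4: "group V4" and group_D8: "group D8"
  unfolding V4_def D8_def using in_S4 comp_S4 by (auto intro!: group_generate_S4)

lemma mult_V4 [simp]: "x \<otimes>\<^bsub>V4\<^esub> y = x \<circ> y" and mult_D8 [simp]: "x \<otimes>\<^bsub>D8\<^esub> y = x \<circ> y"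
  by (simp_all add: V4_def D8_def)

lemma D8_sub: "carrier D8 \<subseteq> carrier S4"
  unfolding D8_def using group.generate_incl[OF group_S4, of "{pa, pb, pc}"] in_S4 by auto

lemma vV_mult: "vV (e, f) \<circ> vV (e', f') = vV (e \<noteq> e', f \<noteq> f')"
  unfolding vV_eq by (cases e; cases e'; cases f; cases f') (simp_all add: comp_assoc perm_simps)

lemma carrier_V4: "carrier V4 = range vV"
proof (intro equalityI subsetI)
  fix x assume "x \<in> carrier V4"
  then have "x \<in> generate S4 {pa, pb \<circ> pc}"
    by (simp add: V4_def)
  then show "x \<in> range vV"
  proof (induction x rule: generate.induct)
    case one
    have "id = vV (False, False)"
      by (simp add: vV_eq)
    then show ?case
      unfolding one_S4 by (metis rangeI)
  next
    case (incl h)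
    have "pa = vV (True, False)" "pb \<circ> pc = vV (False, True)"
      by (simp_all add: vV_eq)
    then show ?case
      using incl by (metis emptyE insertE rangeI)
  next
    case (inv h)
    have h: "h = vV (True, False) \<or> h = vV (False, True)"
      using inv by (auto simp: vV_eq)
    then have "h \<circ> h = id"
      by (auto simp: vV_mult) (simp_all add: vV_eq)
    moreover have "h \<in> carrier S4"
      using inv in_S4 comp_S4 by auto
    ultimately have "inv\<^bsub>S4\<^esub> h = h"
      by (intro inv_S4)
    then show ?case
      using h by auto
  next
    case (eng h1 h2)
    then obtain e f e' f' where "h1 = vV (e, f)" "h2 = vV (e', f')"
      by fastforce
    then show ?case
      by (simp add: vV_mult)
  qed
next
  fix x assume "x \<in> range vV"
  then obtain e f where x: "x = vV (e, f)"
    by fastforce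
  have "pa \<in> generate S4 {pa, pb \<circ> pc}" "pb \<circ> pc \<in> generate S4 {pa, pb \<circ> pc}" "id \<in> generate S4 {pa, pb \<circ> pc}"
    using generate.one[of S4] by (auto intro: generate.incl)
  then have "(if e then pa else id) \<otimes>\<^bsub>S4\<^esub> (if f then pb \<circ> pc else id) \<in> generate S4 {pa, pb \<circ> pc}"
    by (intro generate.eng) auto
  then show "x \<in> carrier V4"
    by (simp add: x vV_eq V4_def)
qed

text \<open>The four elements send 1 to four different places, whence the coordinates are
  unique.\<close>

lemma vV_apply_1: "vV (e, f) 1 = (if e then if f then 4 else 3 else if f then 2 else 1)"
  unfolding vV_eq by (simp add: pa_def pb_def pc_def Transposition.transpose_def)

lemma inj_vV: "inj vV"
proof (rule injI)
  fix x y assume "vV x = vV y"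
  then have "vV x 1 = vV y 1"
    by simp
  then show "x = y"
    by (cases x; cases y) (auto simp: vV_apply_1 split: if_splits)
qed

lemma vD_in_D8: "vD x \<in> carrier D8"
proof -
  obtain r s t where x: "x = (r, s, t)"
    by (metis prod.exhaust)
  have "pa \<in> generate S4 {pa, pb, pc}" "pb \<in> generate S4 {pa, pb, pc}" "pc \<in> generate S4 {pa, pb, pc}" "id \<in> generate S4 {pa, pb, pc}"
    using generate.one[of S4] by (auto intro: generate.incl)
  then have "(if t then pc else id) \<otimes>\<^bsub>S4\<^esub> (if s then pb else id) \<otimes>\<^bsub>S4\<^esub> (if r then pa else id) \<in> generate S4 {pa, pb, pc}"
    by (intro generate.eng) auto
  then show ?thesis
    by (simp add: x vD_eq D8_def)
qed

lemma vD_in_S4: "vD x \<in> carrier S4"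
  using vD_in_D8 D8_sub by blast

text \<open>Since a and bc commute, the inclusion of \<open>V4\<close> is the diagonal in the last
  two coordinates of \<open>D8\<close>.\<close>

lemma vV_eq_vD: "vV (e, f) = vD (e, f, f)"
  unfolding vV_eq vD_eq by (cases e; cases f) (simp_all add: comp_assoc perm_simps)

lemma vV_in_D8: "vV x \<in> carrier D8"
  using vD_in_D8 by (cases x) (simp add: vV_eq_vD)

lemma vV_in_S4: "vV x \<in> carrier S4"
  using vV_in_D8 D8_sub by blast

lemma pa_vD: "pa \<circ> vD (r, s, t) = vD (\<not> r, t, s)" and pbpc_vD: "pb \<circ> pc \<circ> vD (r, s, t) = vD (r, \<not> s, \<not> t)"
  and pb_vD: "pb \<circ> vD (r, s, t) = vD (r, \<not> s, t)" and pc_vD: "pc \<circ> vD (r, s, t) = vD (r, s, \<not> t)"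
  unfolding vD_eq by ((cases r; cases s; cases t), simp_all add: comp_assoc perm_simps)+

lemma p23_vV: "p23 \<circ> vV (e, f) \<circ> p23 = vV (f, e)"
  unfolding vV_eq by (cases e; cases f)
    (auto simp: fun_eq_iff pa_def pb_def pc_def p23_def Transposition.transpose_def)

text \<open>The block structure of \<open>D8\<close>: b orders 1 and 2, c orders 3 and 4, a
  exchanges the two blocks.\<close>

lemma row4_vD: "row4 (vD x) = block_row row2 (\<lambda>t. if t then [4, 3] else [3, 4]) x"
proof -
  obtain r s t where x: "x = (r, s, t)"
    by (metis prod.exhaust)
  have u: "[1..<5] = [1, 2, 3, 4::nat]"
    by (simp add: upt_rec)
  show ?thesis
    unfolding x row4_def u vD_eq
    by (cases r; cases s; cases t)
      (auto simp: row2_def pa_def pb_def pc_def Transposition.transpose_def)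
qed

section \<open>Evaluation of the chain maps\<close>

lemma nth_map_list: "set \<theta> \<subseteq> {..<length A} \<Longrightarrow> map ((!) (map f A)) \<theta> = map f (map ((!) A) \<theta>)"
  by auto

lemma chain_length:
  assumes "sorted (map fst ((a, b) # q))" "sorted (map snd ((a, b) # q))" "distinct ((a, b) # q)"
    "\<forall>(c, d) \<in> set ((a, b) # q). c \<le> k \<and> d \<le> (m::nat)"
  shows "length q \<le> (k - a) + (m - b :: nat)"
  using assms
proof (induction q arbitrary: a b)
  case (Cons z q)
  obtain a' b' where z: "z = (a', b')"
    by fastforce
  have "length q \<le> (k - a') + (m - b')"
    using Cons.prems by (intro Cons.IH) (auto simp: z)
  moreover have "a \<le> a'" "b \<le> b'" "a' \<le> k" "b' \<le> m" "a \<noteq> a' \<or> b \<noteq> b'"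
    using Cons.prems by (auto simp: z)
  ultimately show ?case
    by auto
qed simp

text \<open>Maximal chains above an arbitrary lower corner (i, j), so that the description can be
  proved by moving the corner.\<close>

definition grid_paths :: "nat \<Rightarrow> nat \<Rightarrow> nat \<Rightarrow> nat \<Rightarrow> (nat \<times> nat) list set" where
  "grid_paths i k j m = {p. length p = Suc ((k - i) + (m - j)) \<and> sorted (map fst p) \<and> sorted (map snd p)
     \<and> distinct p \<and> fst ` set p \<subseteq> {i..k} \<and> snd ` set p \<subseteq> {j..m}}"

text \<open>Each step of a strict chain raises at least one coordinate; a chain of the maximal
  length must therefore start at the corner and make unit steps in one coordinate.\<close>

lemma set_shuf_upt:
  assumes "i \<le> k" "j \<le> m"
  shows "set (shuf [i..<Suc k] [j..<Suc m]) = grid_paths i k j m"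
  using assms
proof (induction "(k - i) + (m - j)" arbitrary: i j rule: less_induct)
  case less
  have u: "[i..<Suc k] = i # [Suc i..<Suc k]" "[j..<Suc m] = j # [Suc j..<Suc m]"
    using less.prems by (simp_all add: upt_conv_Cons del: upt_Suc)
  have IH1: "set (shuf [Suc i..<Suc k] (j # [Suc j..<Suc m])) = (if i < k then grid_paths (Suc i) k j m else {})"
    using less.hyps[of "Suc i" j] less.prems unfolding u(2)[symmetric] by (auto simp del: upt_Suc)
  have IH2: "set (shuf (i # [Suc i..<Suc k]) [Suc j..<Suc m]) = (if j < m then grid_paths i k (Suc j) m else {})"
    using less.hyps[of i "Suc j"] less.prems unfolding u(1)[symmetric] by (auto simp del: upt_Suc)
  have e: "[Suc i..<Suc k] = [] \<and> [Suc j..<Suc m] = [] \<longleftrightarrow> i = k \<and> j = m"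
    using less.prems by auto
  have S: "set (shuf [i..<Suc k] [j..<Suc m]) = (#) (i, j) `
     ((if i = k \<and> j = m then {[]} else {}) \<union> (if i < k then grid_paths (Suc i) k j m else {}) \<union> (if j < m then grid_paths i k (Suc j) m else {}))"
    unfolding u set_shuf_Cons IH1 IH2 e ..
  show ?case
    unfolding S
  proof (intro equalityI subsetI)
    fix p assume "p \<in> (#) (i, j) `
     ((if i = k \<and> j = m then {[]} else {}) \<union> (if i < k then grid_paths (Suc i) k j m else {}) \<union> (if j < m then grid_paths i k (Suc j) m else {}))"
    then obtain q where p: "p = (i, j) # q" and "(i = k \<and> j = m \<and> q = []) \<or> (i < k \<and> q \<in> grid_paths (Suc i) k j m) \<or> (j < m \<and> q \<in> grid_paths i k (Suc j) m)"
      by (auto split: if_splits)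
    then consider "i = k" "j = m" "q = []" | "i < k" "q \<in> grid_paths (Suc i) k j m" | "j < m" "q \<in> grid_paths i k (Suc j) m"
      by blast
    then show "p \<in> grid_paths i k j m"
    proof cases
      case 2
      then have "\<forall>z\<in>set q. Suc i \<le> fst z \<and> fst z \<le> k \<and> j \<le> snd z \<and> snd z \<le> m"
        by (auto simp: grid_paths_def)
      then show ?thesis
        using 2 less.prems by (fastforce simp: grid_paths_def p)
    next
      case 3
      then have "\<forall>z\<in>set q. i \<le> fst z \<and> fst z \<le> k \<and> Suc j \<le> snd z \<and> snd z \<le> m"
        by (auto simp: grid_paths_def)
      then show ?thesis
        using 3 less.prems by (fastforce simp: grid_paths_def p)
    qed (simp add: grid_paths_def p)
  next
    fix p assume p: "p \<in> grid_paths i k j m"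
    then obtain a b q where ab: "p = (a, b) # q"
      by (cases p) (auto simp: grid_paths_def)
    have s: "sorted (map fst ((a, b) # q))" "sorted (map snd ((a, b) # q))" "distinct ((a, b) # q)"
      and r: "\<forall>z\<in>set ((a, b) # q). i \<le> fst z \<and> fst z \<le> k \<and> j \<le> snd z \<and> snd z \<le> m"
      and l: "length q = (k - i) + (m - j)"
      using p by (auto simp: grid_paths_def ab)
    have "length q \<le> (k - a) + (m - b)"
      using r by (intro chain_length[OF s]) auto
    then have ij: "a = i" "b = j"
      using l r by auto
    have "q \<in> (if i = k \<and> j = m then {[]} else {}) \<union> (if i < k then grid_paths (Suc i) k j m else {}) \<union> (if j < m then grid_paths i k (Suc j) m else {})"
    proof (cases q)
      case Nil
      then show ?thesis
        using l less.prems by auto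
    next
      case (Cons z q')
      obtain a' b' where z: "z = (a', b')"
        by fastforce
      have s': "sorted (map fst ((a', b') # q'))" "sorted (map snd ((a', b') # q'))" "distinct ((a', b') # q')"
        using s by (auto simp: Cons z)
      have "length q' \<le> (k - a') + (m - b')"
        using r by (intro chain_length[OF s']) (auto simp: Cons z)
      moreover have "i \<le> a'" "j \<le> b'" "a' \<le> k" "b' \<le> m" "a' \<noteq> i \<or> b' \<noteq> j"
        using r s ij by (auto simp: Cons z)
      ultimately have c: "(a' = Suc i \<and> b' = j) \<or> (a' = i \<and> b' = Suc j)"
        using l Cons by auto
      have ge: "\<forall>w\<in>set q. a' \<le> fst w \<and> b' \<le> snd w"
        using s' by (auto simp: Cons z)
      from c show ?thesis
      proof
        assume c: "a' = Suc i \<and> b' = j"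
        then have "fst ` set q \<subseteq> {Suc i..k}" "snd ` set q \<subseteq> {j..m}"
          using ge r by (auto simp: image_subset_iff)
        then have "q \<in> grid_paths (Suc i) k j m" "i < k"
          using c s l \<open>a' \<le> k\<close> by (auto simp: grid_paths_def)
        then show ?thesis
          by simp
      next
        assume c: "a' = i \<and> b' = Suc j"
        then have "fst ` set q \<subseteq> {i..k}" "snd ` set q \<subseteq> {Suc j..m}"
          using ge r by (auto simp: image_subset_iff)
        then have "q \<in> grid_paths i k (Suc j) m" "j < m"
          using c s l \<open>b' \<le> m\<close> by (auto simp: grid_paths_def)
        then show ?thesis
          by simp
      qed
    qed
    then show "p \<in> (#) (i, j) `
     ((if i = k \<and> j = m then {[]} else {}) \<union> (if i < k then grid_paths (Suc i) k j m else {}) \<union> (if j < m then grid_paths i k (Suc j) m else {}))"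
      unfolding ab ij by (rule imageI)
  qed
qed

lemma distinct_shuf: "distinct A \<Longrightarrow> distinct L \<Longrightarrow> distinct (shuf A L)"
proof (induction A L rule: shuf.induct)
  case (3 x xs y ys)
  have "set (shuf xs (y # ys)) \<inter> set (shuf (x # xs) ys) = {}"
  proof (rule ccontr)
    assume "set (shuf xs (y # ys)) \<inter> set (shuf (x # xs) ys) \<noteq> {}"
    then obtain p where p: "p \<in> set (shuf xs (y # ys))" "p \<in> set (shuf (x # xs) ys)"
      by blast
    then have "hd xs = x" "xs \<noteq> []"
      using shuf_hd[OF p(1)] shuf_hd[OF p(2)] by auto
    then show False
      using 3(3) by (cases xs) auto
  qed
  then show ?case
    using 3 by (auto simp: shuf.simps(3) distinct_map)
qed simp_all

lemma sum_max_chains: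
  fixes F :: "(nat \<times> nat) list \<Rightarrow> bit"
  shows "(\<Sum>(\<theta>, \<eta>) \<in> max_chains k m. F (zip \<theta> \<eta>)) = (\<Sum>p\<leftarrow>shuf [0..<Suc k] [0..<Suc m]. F p)"
proof -
  have "(\<Sum>(\<theta>, \<eta>) \<in> max_chains k m. F (zip \<theta> \<eta>)) = (\<Sum>p\<in>grid_paths 0 k 0 m. F p)"
    by (rule sum.reindex_bij_witness[where i = "\<lambda>p. (map fst p, map snd p)" and j = "\<lambda>(\<theta>, \<eta>). zip \<theta> \<eta>"])
      (auto simp: max_chains_def grid_paths_def Delta_def zip_map_fst_snd dest: set_zip_leftD set_zip_rightD)
  also have "\<dots> = (\<Sum>p\<leftarrow>shuf [0..<Suc k] [0..<Suc m]. F p)"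
    using set_shuf_upt[of 0 k 0 m] distinct_shuf[of "[0..<Suc k]" "[0..<Suc m]"]
    by (simp add: sum_list_distinct_conv_sum_set del: upt_Suc)
  finally show ?thesis .
qed

text \<open>Simplices given by lists: operators act on the list, and a degeneracy is visible as
  equal neighbours. One computation of \<open>EZ\<close> thus covers \<open>ES2\<close>, products of
  such, and orbits in \<open>BG S2\<close>.\<close>

definition encodes :: "'z sset \<Rightarrow> ('b list \<Rightarrow> 'z) \<Rightarrow> bool" where
  "encodes Z e \<longleftrightarrow> (\<forall>m S \<theta>. length S = Suc m \<longrightarrow> set \<theta> \<subseteq> {..m} \<longrightarrow> act Z m \<theta> (e S) = e (map ((!) S) \<theta>)) \<and>
    (\<forall>k i v S. i < k \<longrightarrow> length S = Suc k \<longrightarrow> e S = act Z (k - 1) ([0..<Suc i] @ [i..<k]) v \<longrightarrow> S ! i = S ! Suc i)"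

lemma degeneracy_nth:
  "i < k \<Longrightarrow> map f ([0..<Suc i] @ [i..<k]) ! i = map f ([0..<Suc i] @ [i..<k]) ! Suc i"
  by (simp add: nth_append del: upt_Suc)

lemma encodes_ES2: "encodes ES2 (map tp)"
  unfolding encodes_def act_EG
proof (intro conjI allI impI)
  fix m :: nat and S :: "bool list" and \<theta> assume "length S = Suc m" "set \<theta> \<subseteq> {..m}"
  then show "map ((!) (map tp S)) \<theta> = map tp (map ((!) S) \<theta>)"
    by (intro nth_map_list) auto
next
  fix k i v and S :: "bool list" assume *: "i < k" "length S = Suc k" "map tp S = map ((!) v) ([0..<Suc i] @ [i..<k])"
  then have "map tp S ! i = map tp S ! Suc i"
    using degeneracy_nth by metis
  then show "S ! i = S ! Suc i"
    using *(1,2) by simp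
qed

lemma encodes_prod:
  fixes d :: "'b list \<Rightarrow> 'y" and e :: "'c list \<Rightarrow> 'z"
  assumes "encodes Y d" "encodes Z e"
  shows "encodes (Y \<times>\<^sub>s Z) (\<lambda>S. (d (map fst S), e (map snd S)))"
  unfolding encodes_def
proof (intro conjI allI impI)
  fix m :: nat and S :: "('b \<times> 'c) list" and \<theta> assume *: "length S = Suc m" "set \<theta> \<subseteq> {..m}"
  then have "act Y m \<theta> (d (map fst S)) = d (map ((!) (map fst S)) \<theta>)" "act Z m \<theta> (e (map snd S)) = e (map ((!) (map snd S)) \<theta>)"
    using assms unfolding encodes_def by auto
  moreover have "map ((!) (map fst S)) \<theta> = map fst (map ((!) S) \<theta>)" "map ((!) (map snd S)) \<theta> = map snd (map ((!) S) \<theta>)"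
    using * by (intro nth_map_list; auto)+
  ultimately show "act (Y \<times>\<^sub>s Z) m \<theta> (d (map fst S), e (map snd S)) = (d (map fst (map ((!) S) \<theta>)), e (map snd (map ((!) S) \<theta>)))"
    by (simp add: prod_sset_def del: map_map)
next
  fix k i and v and S :: "('b \<times> 'c) list" assume *: "i < k" "length S = Suc k"
    "(d (map fst S), e (map snd S)) = act (Y \<times>\<^sub>s Z) (k - 1) ([0..<Suc i] @ [i..<k]) v"
  then have "d (map fst S) = act Y (k - 1) ([0..<Suc i] @ [i..<k]) (fst v)" "e (map snd S) = act Z (k - 1) ([0..<Suc i] @ [i..<k]) (snd v)"
    by (auto simp: prod_sset_def split: prod.splits)
  then have "map fst S ! i = map fst S ! Suc i" "map snd S ! i = map snd S ! Suc i"
    using assms * unfolding encodes_def by (metis length_map)+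
  then show "S ! i = S ! Suc i"
    using * by (simp add: prod_eq_iff)
qed

lemma encodes_degenerate:
  assumes "encodes Z e" "length S = Suc k" "degenerate Z k (e S)"
  shows "\<not> distinct_adj S"
proof -
  obtain i v where "i < k" "e S = act Z (k - 1) ([0..<Suc i] @ [i..<k]) v"
    using assms(3) by (auto simp: degenerate_def)
  then have "S ! i = S ! Suc i" "Suc i < length S"
    using assms(1,2) unfolding encodes_def by auto
  then show ?thesis
    by (auto simp: distinct_adj_conv_nth)
qed

lemma ev_EZ:
  assumes Y: "encodes Y d" and Z: "encodes Z e" and l: "length A = Suc k" "length B = Suc m"
    and F: "\<And>p. p \<in> set (shuf A B) \<Longrightarrow> \<not> distinct_adj p \<Longrightarrow> F (k + m, (d (map fst p), e (map snd p))) = 0"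
  shows "ev F (EZ Y Z ((k, d A), (m, e B))) = (\<Sum>p\<leftarrow>shuf A B. F (k + m, (d (map fst p), e (map snd p))))"
proof -
  let ?G = "\<lambda>p. if degenerate (Y \<times>\<^sub>s Z) (k + m) (d (map fst p), e (map snd p)) then 0 else F (k + m, (d (map fst p), e (map snd p)))"
  let ?h = "map_prod ((!) A) ((!) B)"
  have "ev F (EZ Y Z ((k, d A), (m, e B))) = (\<Sum>(\<theta>, \<eta>) \<in> max_chains k m. ?G (map ?h (zip \<theta> \<eta>)))"
    unfolding EZ_def prod.case ev_sum
  proof (intro sum.cong refl)
    fix x assume "x \<in> max_chains k m"
    then obtain \<theta> \<eta> where x: "x = (\<theta>, \<eta>)" and *: "\<theta> \<in> Delta (k + m) k" "\<eta> \<in> Delta (k + m) m"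
      by (cases x) (auto simp: max_chains_def)
    have "act Y k \<theta> (d A) = d (map ((!) A) \<theta>)" "act Z m \<eta> (e B) = e (map ((!) B) \<eta>)"
      using Y Z l * unfolding encodes_def Delta_def by auto
    moreover have "map fst (map ?h (zip \<theta> \<eta>)) = map ((!) A) \<theta>" "map snd (map ?h (zip \<theta> \<eta>)) = map ((!) B) \<eta>"
    proof -
      have "length \<theta> = length \<eta>"
        using * by (simp add: Delta_def)
      moreover have "map fst (map ?h (zip \<theta> \<eta>)) = map ((!) A) (map fst (zip \<theta> \<eta>))"
        "map snd (map ?h (zip \<theta> \<eta>)) = map ((!) B) (map snd (zip \<theta> \<eta>))"
        by simp_all
      ultimately show "map fst (map ?h (zip \<theta> \<eta>)) = map ((!) A) \<theta>" "map snd (map ?h (zip \<theta> \<eta>)) = map ((!) B) \<eta>"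
        by (simp_all del: map_map)
    qed
    ultimately show "ev F (case x of (\<theta>, \<eta>) \<Rightarrow> cls (Y \<times>\<^sub>s Z) (k + m) (act Y k \<theta> (d A), act Z m \<eta> (e B))) =
        (case x of (\<theta>, \<eta>) \<Rightarrow> ?G (map ?h (zip \<theta> \<eta>)))"
      unfolding x prod.case ev_cls by presburger
  qed
  also have "\<dots> = (\<Sum>p\<leftarrow>shuf [0..<Suc k] [0..<Suc m]. ?G (map ?h p))"
    by (rule sum_max_chains)
  also have "\<dots> = (\<Sum>p\<leftarrow>shuf (map ((!) A) [0..<Suc k]) (map ((!) B) [0..<Suc m]). ?G p)"
    by (simp only: shuf_map map_map o_def)
  also have "\<dots> = (\<Sum>p\<leftarrow>shuf A B. ?G p)"
    using map_nth[of A] map_nth[of B] l by simp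
  also have "\<dots> = (\<Sum>p\<leftarrow>shuf A B. F (k + m, (d (map fst p), e (map snd p))))"
  proof (intro sum_list_cong)
    fix p assume p: "p \<in> set (shuf A B)"
    have "length p = Suc (k + m)"
      using length_shuf[OF p] l by simp
    then show "?G p = F (k + m, (d (map fst p), e (map snd p)))"
      using encodes_degenerate[OF encodes_prod[OF Y Z], of p "k + m"] F[OF p] by auto
  qed
  finally show ?thesis .
qed

definition vanishes_degenerate :: "(nat \<times> perm list \<Rightarrow> bit) \<Rightarrow> bool" where
  "vanishes_degenerate H \<longleftrightarrow> (\<forall>n. \<forall>v \<in> cells (EG D8) n. \<not> distinct_adj v \<longrightarrow> H (n, v) = 0)"

lemma normal_vD:
  assumes "vanishes_degenerate H"
  shows "normal (\<lambda>T. H (length T - 1, map vD T))"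
  unfolding normal_def
proof (intro allI impI)
  fix T :: "(bool \<times> bool \<times> bool) list" assume T: "\<not> distinct_adj T"
  then have "\<not> distinct_adj (map vD T)"
    by (blast dest: distinct_adj_mapD)
  moreover have "map vD T \<in> cells (EG D8) (length T - 1)"
    using T vD_in_D8 by (cases T) (auto simp: cells_EG)
  ultimately show "H (length T - 1, map vD T) = 0"
    using assms by (auto simp: vanishes_degenerate_def)
qed

lemma degenerate_EG_cell: "degenerate (EG G) k u \<Longrightarrow> u \<in> cells (EG G) k"
proof -
  assume "degenerate (EG G) k u"
  then obtain i v where v: "i < k" "v \<in> cells (EG G) (k - 1)" "u = act (EG G) (k - 1) ([0..<Suc i] @ [i..<k]) v"
    by (auto simp: degenerate_def)
  have "[0..<Suc i] @ [i..<k] \<in> Delta k (k - 1)"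
    using v(1) by (auto simp: Delta_def sorted_append)
  then show ?thesis
    unfolding v(3) by (rule simplicial_set.act_closed[OF simplicial_set_EG v(2)])
qed

definition ES2_simplex :: "bool list \<Rightarrow> nat \<times> perm list" where
  "ES2_simplex A = (length A - 1, map tp A)"

lemma ev_EZ3:
  assumes ne: "A \<noteq> []" "B \<noteq> []" "C \<noteq> []"
    and H: "vanishes_degenerate H"
  shows "ev (\<lambda>(n, t). H (n, to_ED8 t)) (EZ3 (ES2_simplex A, ES2_simplex B, ES2_simplex C)) =
    ez3 (\<lambda>T. H (length T - 1, map vD T)) A B C"
proof -
  let ?F = "\<lambda>(n, t). H (n, to_ED8 t)"
  let ?h = "\<lambda>T. H (length T - 1, map vD T)"
  define i j k where "i = length A - 1" and "j = length B - 1" and "k = length C - 1"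
  have l: "length A = Suc i" "length B = Suc j" "length C = Suc k"
    using ne by (cases A; cases B; cases C; simp add: i_def j_def k_def)+
  let ?e2 = "\<lambda>S. (map tp (map fst S), map tp (map snd S))"
  have e2: "encodes (ES2 \<times>\<^sub>s ES2) ?e2"
    by (rule encodes_prod[OF encodes_ES2 encodes_ES2])
  have to: "to_ED8 (map tp (map fst t), ?e2 (map snd t)) = map vD t" for t
    unfolding to_ED8_def prod.case by (rule nth_equalityI) (simp_all add: vD_def case_prod_unfold)
  have hn: "normal ?h"
    by (rule normal_vD[OF H])
  have inner: "ev ?F (EZ ES2 (ES2 \<times>\<^sub>s ES2) ((i, map tp A), (j + k, ?e2 s))) = (\<Sum>t\<leftarrow>shuf A s. ?h t)"
    if s: "s \<in> set (shuf B C)" for s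
  proof -
    have ls: "length s = Suc (j + k)"
      using length_shuf[OF s] l by simp
    have v: "?F (i + (j + k), (map tp (map fst t), ?e2 (map snd t))) = ?h t" if "t \<in> set (shuf A s)" for t
      unfolding prod.case to using length_shuf[OF that] l ls by simp
    have "ev ?F (EZ ES2 (ES2 \<times>\<^sub>s ES2) ((i, map tp A), (j + k, ?e2 s))) =
      (\<Sum>t\<leftarrow>shuf A s. ?F (i + (j + k), (map tp (map fst t), ?e2 (map snd t))))"
    proof (rule ev_EZ[OF encodes_ES2 e2 l(1) ls])
      fix t assume t: "t \<in> set (shuf A s)" "\<not> distinct_adj t"
      show "?F (i + (j + k), (map tp (map fst t), ?e2 (map snd t))) = 0"
        unfolding v[OF t(1)] by (rule normalD[OF hn t(2)])
    qed
    also have "\<dots> = (\<Sum>t\<leftarrow>shuf A s. ?h t)"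
      by (intro sum_list_cong v)
    finally show ?thesis .
  qed
  have "ev ?F (EZ3 (ES2_simplex A, ES2_simplex B, ES2_simplex C)) =
    ev (\<lambda>w. ev ?F (EZ ES2 (ES2 \<times>\<^sub>s ES2) ((i, map tp A), w))) (EZ ES2 ES2 ((j, map tp B), (k, map tp C)))"
    unfolding EZ3_def prod.case ev_lin ES2_simplex_def i_def j_def k_def ..
  also have "\<dots> = (\<Sum>s\<leftarrow>shuf B C. ev ?F (EZ ES2 (ES2 \<times>\<^sub>s ES2) ((i, map tp A), (j + k, ?e2 s))))"
  proof (rule ev_EZ[OF encodes_ES2 encodes_ES2 l(2,3)])
    fix s assume s: "s \<in> set (shuf B C)" "\<not> distinct_adj s"
    show "ev ?F (EZ ES2 (ES2 \<times>\<^sub>s ES2) ((i, map tp A), (j + k, ?e2 s))) = 0"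
      unfolding inner[OF s(1)] by (rule normalD[OF normal_shuf(2)[OF hn] s(2)])
  qed
  also have "\<dots> = ez3 ?h A B C"
    unfolding ez3_def by (intro sum_list_cong inner)
  finally show ?thesis .
qed

section \<open>Alexander-Whitney, Steenrod's map and \<Psi> on chains\<close>

lemma map_nth_upt_take: "i < length L \<Longrightarrow> map ((!) L) [0..<Suc i] = take (Suc i) L"
  by (rule nth_equalityI) (simp_all del: upt_Suc)

lemma map_nth_upt_drop: "map ((!) L) [i..<length L] = drop i L"
  by (rule nth_equalityI) simp_all

lemma degenerate_tp: "A \<noteq> [] \<Longrightarrow> degenerate ES2 (length A - 1) (map tp A) \<longleftrightarrow> \<not> distinct_adj A"
proof -
  assume "A \<noteq> []"
  then have "map tp A \<in> cells ES2 (length A - 1)"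
    by (cases A) (auto simp: cells_EG carrier_S2)
  then show ?thesis
    by (simp add: degenerate_EG distinct_adj_map_iff inj_on_subset[OF inj_tp])
qed

text \<open>On degenerate faces \<open>cls\<close> gives 0 on one side and normality gives 0 on the
  other, so \<open>G\<close> and \<open>g\<close> are compared on nondegenerate pairs only.\<close>

lemma ev_AW:
  fixes W :: "(bool \<times> bool) list"
  assumes W: "length W = Suc n"
    and g: "normal2 g" "\<And>(U :: (bool \<times> bool) list) (V :: (bool \<times> bool) list). U \<noteq> [] \<Longrightarrow> V \<noteq> [] \<Longrightarrow> distinct_adj (map fst U) \<Longrightarrow> distinct_adj (map snd V) \<Longrightarrow>
      G (ES2_simplex (map fst U), ES2_simplex (map snd V)) = g (map fst U) (map snd V)"
  shows "ev G (AW ES2 ES2 (n, (map tp (map fst W), map tp (map snd W)))) = cut (\<lambda>U V. g (map fst U) (map snd V)) W"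
proof -
  have "ev G (AW ES2 ES2 (n, (map tp (map fst W), map tp (map snd W)))) =
    (\<Sum>i\<le>n. g (map fst (take (Suc i) W)) (map snd (drop i W)))"
    unfolding AW_def prod.case ev_sum
  proof (intro sum.cong refl)
    fix i assume "i \<in> {..n}"
    then have i: "i < length W"
      using W by simp
    let ?U = "take (Suc i) W" and ?V = "drop i W"
    have U: "act ES2 n [0..<Suc i] (map tp (map fst W)) = map tp (map fst ?U)" and lU: "length ?U - 1 = i" "?U \<noteq> []"
      using i map_nth_upt_take[of i "map tp (map fst W)"] by (auto simp: act_EG take_map simp del: upt_Suc take_Suc)
    have V: "act ES2 n [i..<Suc n] (map tp (map snd W)) = map tp (map snd ?V)" and lV: "length ?V - 1 = n - i" "?V \<noteq> []"
      using i W map_nth_upt_drop[of "map tp (map snd W)" i] by (auto simp: act_EG drop_map simp del: upt_Suc)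
    have dU: "degenerate ES2 i (map tp (map fst ?U)) \<longleftrightarrow> \<not> distinct_adj (map fst ?U)"
      using degenerate_tp[of "map fst ?U"] lU by simp
    have dV: "degenerate ES2 (n - i) (map tp (map snd ?V)) \<longleftrightarrow> \<not> distinct_adj (map snd ?V)"
      using degenerate_tp[of "map snd ?V"] lV by simp
    have s: "ES2_simplex (map fst ?U) = (i, map tp (map fst ?U))" "ES2_simplex (map snd ?V) = (n - i, map tp (map snd ?V))"
      using lU lV by (simp_all add: ES2_simplex_def)
    show "ev G (tensor (cls ES2 i (act ES2 n [0..<Suc i] (map tp (map fst W)))) (cls ES2 (n - i) (act ES2 n [i..<Suc n] (map tp (map snd W)))))
      = g (map fst ?U) (map snd ?V)"
      unfolding U V ev_tensor ev_cls dU dV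
      using g(2)[of ?U ?V, OF lU(2) lV(2)] g(1) unfolding normal2_def s by auto
  qed
  then show ?thesis
    unfolding cut_sum by (simp add: W lessThan_Suc_atMost)
qed

text \<open>A nondegenerate list of bits alternates, so it is \<open>xt m\<close> or its T-translate
  according to its first entry s; these are the first two cases of \<open>AW_tilde\<close>.\<close>

lemma ev_AW_tilde:
  assumes x: "x \<noteq> []" "distinct_adj x" and Y: "Y \<noteq> []"
    and k: "normal2 k" "\<And>a b. a \<noteq> [] \<Longrightarrow> b \<noteq> [] \<Longrightarrow> K (ES2_simplex a, ES2_simplex b) = k a b"
  shows "ev K (AW_tilde ES2 (ES2_simplex x, ES2_simplex Y)) = sq k x Y"
proof -
  define m N where "m = length x - 1" and "N = length Y - 1"
  obtain s where xs: "x = alt s (\<not> s) (Suc m)"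
    using x distinct_adj_bool_alt by (cases x) (auto simp: m_def)
  have lY: "length Y = Suc N"
    using Y by (cases Y) (simp_all add: N_def)
  have cell: "map tp Y \<in> cells ES2 N"
    using lY by (auto simp: cells_EG carrier_S2)
  have st: "ev g (steenrod_gen ES2 m (N, map tp Y)) =
      (\<Sum>r\<leftarrow>shuf (alt (1::nat) 2 (Suc (Suc m))) Y. g (ES2_simplex (coll 1 r), ES2_simplex (coll 2 r)))"
    if g: "\<And>a b. a \<noteq> [] \<Longrightarrow> b \<noteq> [] \<Longrightarrow> \<not> distinct_adj a \<or> \<not> distinct_adj b \<Longrightarrow> g (ES2_simplex a, ES2_simplex b) = 0" for g
  proof -
    have "ev g (steenrod_gen ES2 m (N, map tp Y)) = (\<Sum>p\<leftarrow>shuf (alt (1::nat) 2 (Suc (Suc m))) [0..<Suc N].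
      g ((length (coll 1 p) - 1, act ES2 N (coll 1 p) (map tp Y)), (length (coll 2 p) - 1, act ES2 N (coll 2 p) (map tp Y))))"
    proof (rule simplicial_set.ev_steenrod_gen[OF simplicial_set_EG cell])
      fix k v j w assume vw: "v \<in> cells ES2 k" "w \<in> cells ES2 j" "degenerate ES2 k v \<or> degenerate ES2 j w"
      have "\<exists>a. v = map tp a \<and> length a = Suc k" if "v \<in> cells ES2 k" for v k
      proof -
        have "tp (inv_into UNIV tp g) = g" if "g \<in> set v" for g
          using that \<open>v \<in> cells ES2 k\<close> by (intro f_inv_into_f) (auto simp: cells_EG carrier_S2)
        then have "v = map tp (map (inv_into UNIV tp) v)"
          by (simp add: map_idI)
        then show ?thesis
          using that by (metis cells_EG length_map)
      qed
      then obtain a b where ab: "v = map tp a" "length a = Suc k" "w = map tp b" "length b = Suc j"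
        using vw(1,2) by metis
      then have "degenerate ES2 k v \<longleftrightarrow> \<not> distinct_adj a" "degenerate ES2 j w \<longleftrightarrow> \<not> distinct_adj b"
        using degenerate_tp[of a] degenerate_tp[of b] by (cases a; cases b; auto)+
      then have "g (ES2_simplex a, ES2_simplex b) = 0"
        using vw(3) ab by (intro g) auto
      then show "g ((k, v), (j, w)) = 0"
        using ab by (simp add: ES2_simplex_def)
    qed
    also have "\<dots> = (\<Sum>p\<leftarrow>shuf (alt (1::nat) 2 (Suc (Suc m))) [0..<Suc N].
       g (ES2_simplex (map ((!) Y) (coll 1 p)), ES2_simplex (map ((!) Y) (coll 2 p))))"
    proof (intro sum_list_cong)
      fix p assume p: "p \<in> set (shuf (alt (1::nat) 2 (Suc (Suc m))) [0..<Suc N])"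
      have "act ES2 N (coll l p) (map tp Y) = map tp (map ((!) Y) (coll l p))" for l
        unfolding act_EG using set_coll[of l p] snd_shuf[OF p] lY by (intro nth_map_list) auto
      then show "g ((length (coll 1 p) - 1, act ES2 N (coll 1 p) (map tp Y)), (length (coll 2 p) - 1, act ES2 N (coll 2 p) (map tp Y))) =
        g (ES2_simplex (map ((!) Y) (coll 1 p)), ES2_simplex (map ((!) Y) (coll 2 p)))"
        by (simp add: ES2_simplex_def)
    qed
    also have "\<dots> = (\<Sum>r\<leftarrow>shuf (alt (1::nat) 2 (Suc (Suc m))) (map ((!) Y) [0..<Suc N]). g (ES2_simplex (coll 1 r), ES2_simplex (coll 2 r)))"
      using shuf_map[of id "alt (1::nat) 2 (Suc (Suc m))" "(!) Y" "[0..<Suc N]"]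
      by (simp add: o_def coll_map_prod del: upt_Suc alt.simps)
    also have "map ((!) Y) [0..<Suc N] = Y"
      using map_nth[of Y] lY by simp
    finally show ?thesis .
  qed
  have ne: "coll 1 r \<noteq> []" "coll 2 r \<noteq> []" if "r \<in> set (shuf (alt (1::nat) 2 (Suc (Suc m))) Y)" for r
    using fst_shuf[OF that] set_alt[of 1 "2::nat" m] by (simp_all add: coll_eq_Nil del: alt.simps)
  have z: "(m, map tp x) = ES2_simplex x" "(N, map tp Y) = ES2_simplex Y"
    by (simp_all add: ES2_simplex_def m_def N_def)
  show ?thesis
  proof (cases s)
    case False
    then have "AW_tilde ES2 (ES2_simplex x, ES2_simplex Y) = steenrod_gen ES2 m (N, map tp Y)"
      unfolding z[symmetric] AW_tilde_def prod.case xt_eq using xs by simp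
    then have "ev K (AW_tilde ES2 (ES2_simplex x, ES2_simplex Y)) =
      (\<Sum>r\<leftarrow>shuf (alt (1::nat) 2 (Suc (Suc m))) Y. K (ES2_simplex (coll 1 r), ES2_simplex (coll 2 r)))"
      using st[of K] k by (simp add: normal2_def)
    also have "\<dots> = (\<Sum>r\<leftarrow>shuf (alt (1::nat) 2 (Suc (Suc m))) Y. if s then k (coll 2 r) (coll 1 r) else k (coll 1 r) (coll 2 r))"
      using False by (intro sum_list_cong) (simp add: k(2) ne)
    finally show ?thesis
      unfolding xs sq_alt[OF k(1)] .
  next
    case True
    have "map tp x \<noteq> xt m"
      using True xs by (simp add: xt_eq)
    moreover have "map tp x = translate S2 pT (xt m)"
    proof -
      have "pT \<circ> tp e = tp (\<not> e)" for e
        using pT_pT by (cases e) (auto simp: tp_def fun_eq_iff)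
      then have "translate S2 pT (xt m) = map tp (map Not (xb m))"
        by (simp add: translate_def xt_eq sym_group_def o_def del: alt.simps)
      then show ?thesis
        using True xs by (simp add: map_alt)
    qed
    ultimately have "AW_tilde ES2 (ES2_simplex x, ES2_simplex Y) = switch (steenrod_gen ES2 m (N, map tp Y))"
      unfolding z[symmetric] AW_tilde_def prod.case by simp
    then have "ev K (AW_tilde ES2 (ES2_simplex x, ES2_simplex Y)) = ev (\<lambda>(a, b). K (b, a)) (steenrod_gen ES2 m (N, map tp Y))"
      by (simp add: ev_switch)
    also have "\<dots> =
      (\<Sum>r\<leftarrow>shuf (alt (1::nat) 2 (Suc (Suc m))) Y. (\<lambda>(a, b). K (b, a)) (ES2_simplex (coll 1 r), ES2_simplex (coll 2 r)))"
      by (rule st) (use k in \<open>auto simp: normal2_def\<close>)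
    also have "\<dots> = (\<Sum>r\<leftarrow>shuf (alt (1::nat) 2 (Suc (Suc m))) Y. if s then k (coll 2 r) (coll 1 r) else k (coll 1 r) (coll 2 r))"
      using True by (intro sum_list_cong) (simp add: k(2) ne)
    finally show ?thesis
      unfolding xs sq_alt[OF k(1)] .
  qed
qed

lemma ev_Phi:
  assumes X: "X \<noteq> []" and Y: "Y \<noteq> []"
    and h: "normal h" "\<And>x a b. x \<noteq> [] \<Longrightarrow> a \<noteq> [] \<Longrightarrow> b \<noteq> [] \<Longrightarrow> K (ES2_simplex x, ES2_simplex a, ES2_simplex b) = ez3 h x a b"
  shows "ev K (Phi (ES2_simplex X, ES2_simplex Y)) = phi h X Y"
proof -
  define n where "n = length X - 1"
  \<comment> \<open>The diagonal as a list of pairs, to which the formula for \<open>AW\<close>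
    applies.\<close>
  define W where "W = zip X X"
  have W: "length W = Suc n" "map fst W = X" "map snd W = X"
    using X by (cases X; simp add: n_def W_def)+
  have n2: "normal2 (\<lambda>x x'. sq (ez3 h x) x' Y)"
  proof -
    have "ez3 h x = (\<lambda>_ _. 0)" if "\<not> distinct_adj x" for x
      by (intro ext normalD[OF normal_ez3(1)[OF h(1)] that])
    then show ?thesis
      using normal2_sq[OF normal_ez3(2)[OF h(1)]] by (auto simp: normal2_def)
  qed
  have "ev K (Phi (ES2_simplex X, ES2_simplex Y)) =
    ev (\<lambda>(x', x''). ev (\<lambda>z. K (x', z)) (AW_tilde ES2 (x'', ES2_simplex Y))) (AW ES2 ES2 (n, (map tp (map fst W), map tp (map snd W))))"
    unfolding Phi_def prod.case ev_lin W by (simp add: case_prod_unfold ev_tensor AW_diag_def ES2_simplex_def n_def)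
  also have "\<dots> = cut (\<lambda>U V. sq (ez3 h (map fst U)) (map snd V) Y) W"
  proof (rule ev_AW[OF W(1) n2])
    fix U V :: "(bool \<times> bool) list"
    assume *: "U \<noteq> []" "V \<noteq> []" "distinct_adj (map fst U)" "distinct_adj (map snd V)"
    show "(\<lambda>(x', x''). ev (\<lambda>z. K (x', z)) (AW_tilde ES2 (x'', ES2_simplex Y))) (ES2_simplex (map fst U), ES2_simplex (map snd V)) =
        sq (ez3 h (map fst U)) (map snd V) Y"
      unfolding prod.case using * Y h by (intro ev_AW_tilde normal_ez3(2)) auto
  qed
  also have "\<dots> = phi h X Y"
  proof -
    have "map (\<lambda>x. (x, x)) X = W"
      unfolding W_def by (rule nth_equalityI) auto
    then show ?thesis
      unfolding phi_def using cut_map[of "\<lambda>U V. sq (ez3 h (map fst U)) (map snd V) Y" "\<lambda>x. (x, x)" X] by (simp add: o_def)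
  qed
  finally show ?thesis .
qed

lemma from_EV4_vV: "from_EV4 (map vV W) = (map tp (map fst W), map tp (map snd W))"
proof -
  have "inj_on vertex_V4 (carrier S2 \<times> carrier S2)"
  proof (rule inj_onI)
    fix x y assume "x \<in> carrier S2 \<times> carrier S2" "y \<in> carrier S2 \<times> carrier S2" "vertex_V4 x = vertex_V4 y"
    moreover from this obtain a b c d where "x = (tp a, tp b)" "y = (tp c, tp d)"
      by (auto simp: carrier_S2)
    ultimately have "vV (a, b) = vV (c, d)"
      by (simp add: vV_def)
    then show "x = y"
      using inj_vV \<open>x = _\<close> \<open>y = _\<close> by (auto simp: inj_def)
  qed
  then have "inv_into (carrier S2 \<times> carrier S2) vertex_V4 (vV w) = (tp (fst w), tp (snd w))" for w
    by (cases w) (auto simp: vV_def carrier_S2)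
  then show ?thesis
    by (simp add: from_EV4_def Let_def o_def)
qed

lemma ev_Psi:
  assumes W: "length W = Suc m" and H: "vanishes_degenerate H"
  shows "ev H (Psi (cls (EG V4) m (map vV W))) = psi (\<lambda>T. H (length T - 1, map vD T)) W"
proof -
  let ?h = "\<lambda>T. H (length T - 1, map vD T)"
  have hn: "normal ?h"
    by (rule normal_vD[OF H])
  have cell: "map vV W \<in> cells (EG V4) m"
    using W by (auto simp: cells_EG carrier_V4)
  have d: "degenerate (EG V4) m (map vV W) \<longleftrightarrow> \<not> distinct_adj W"
    unfolding degenerate_EG[OF cell] by (simp add: distinct_adj_map_iff inj_on_subset[OF inj_vV])
  show ?thesis
  proof (cases "distinct_adj W")
    case False
    then have "cls (EG V4) m (map vV W) = 0"
      using d by (simp add: cls_def)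
    moreover have "ev H (Psi 0) = 0"
      by (simp add: Psi_def ev_push ev_lin)
    ultimately show ?thesis
      using normalD[OF normal_psi[OF hn] False] by simp
  next
    case True
    let ?F = "\<lambda>(n, t). H (n, to_ED8 t)"
    have F: "(if degenerate (EG D8) n (to_ED8 t) then 0 else H (n, to_ED8 t)) = H (n, to_ED8 t)" for n t
      using degenerate_EG_not_distinct_adj[of D8 n "to_ED8 t"] degenerate_EG_cell[of D8 n "to_ED8 t"] H
      by (auto simp: vanishes_degenerate_def)
    let ?W = "(map tp (map fst W), map tp (map snd W))"
    have nd: "\<not> degenerate (ES2 \<times>\<^sub>s ES2) m ?W"
      using encodes_degenerate[OF encodes_prod[OF encodes_ES2 encodes_ES2] W] True by auto
    have "push from_EV4 (ES2 \<times>\<^sub>s ES2) (cls (EG V4) m (map vV W)) = Poly_Mapping.single (m, ?W) 1"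
      using d True nd by (simp add: push_def lin_def cls_def from_EV4_vV del: map_map)
    then have "ev H (Psi (cls (EG V4) m (map vV W))) =
       ev (\<lambda>x. ev (\<lambda>y. ev ?F (EZ3 y)) (Phi x)) (AW ES2 ES2 (m, ?W))"
      by (simp add: Psi_def ev_push ev_lin F cong: if_cong)
    also have "\<dots> = cut (\<lambda>U V. phi ?h (map fst U) (map snd V)) W"
    proof (rule ev_AW[OF W normal2_phi[OF hn]])
      fix U V :: "(bool \<times> bool) list"
      assume "U \<noteq> []" "V \<noteq> []"
      then show "ev (\<lambda>y. ev ?F (EZ3 y)) (Phi (ES2_simplex (map fst U), ES2_simplex (map snd V))) = phi ?h (map fst U) (map snd V)"
        using H by (intro ev_Phi hn ev_EZ3) auto
    qed
    finally show ?thesis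
      by (simp add: psi_def)
  qed
qed

section \<open>The homotopies on chains\<close>

lemma J_sum: "J i P f W = (\<Sum>j<length W. P (\<lambda>M. f (map i (take (Suc j) W) @ M)) (drop j W))"
  by (induction W arbitrary: f) (simp_all add: sum.lessThan_Suc_shift del: sum.lessThan_Suc)

lemma J_eq_0:
  assumes "\<And>W. P (\<lambda>_. 0) W = 0" "\<And>w M. f (w # M) = 0"
  shows "J i P f W = 0"
proof -
  have "J i P (\<lambda>_. 0) W = 0" for W
    by (induction W) (simp_all add: assms(1))
  then show ?thesis
    by (cases W) (simp_all add: assms)
qed

lemma J_add:
  assumes "\<And>f g W. P (\<lambda>t. f t + g t) W = P f W + P g W"
  shows "J i P (\<lambda>t. f t + g t) W = J i P f W + J i P g W"
  by (induction W arbitrary: f g) (simp_all add: assms bit_cancel)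

lemma J_invariant:
  assumes "\<And>h W. P (\<lambda>t. h (map m t)) W = P h W" "\<And>w. m (i w) = i w"
  shows "J i P (\<lambda>t. f (map m t)) W = J i P f W"
proof (induction W arbitrary: f)
  case (Cons w W)
  have "P (\<lambda>M. f (m (i w) # map m M)) (w # W) = P (\<lambda>M. f (i w # M)) (w # W)"
    using assms(1)[of "\<lambda>M. f (i w # M)"] by (simp add: assms(2))
  moreover have "J i P (\<lambda>M. f (m (i w) # map m M)) W = J i P (\<lambda>M. f (i w # M)) W"
    using Cons.IH[of "\<lambda>M. f (i w # M)"] by (simp add: assms(2))
  ultimately show ?case
    by simp
qed simp

definition dup :: "bool \<times> bool \<Rightarrow> bool \<times> bool \<times> bool" where
  "dup = (\<lambda>(e, f). (e, f, f))"

lemma vD_dup [simp]: "vD (dup w) = vV w"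
  by (cases w) (simp add: dup_def vV_eq_vD)

lemma ev_join:
  "ev H (join G c d) = ev (\<lambda>(j, u). ev (\<lambda>(k, v). if degenerate (EG G) (j + k + 1) (u @ v) then 0 else H (j + k + 1, u @ v)) d) c"
  by (simp add: join_def ev_lin ev_tensor case_prod_unfold ev_cls cong: if_cong)

lemma ev_J_Psi:
  assumes W: "length W = Suc k" and H: "vanishes_degenerate H"
  shows "ev H (J_Psi (k, map vV W)) = J dup psi (\<lambda>T. H (length T - 1, map vD T)) W"
proof -
  let ?h = "\<lambda>T. H (length T - 1, map vD T)"
  have "ev H (J_Psi (k, map vV W)) = (\<Sum>j\<le>k. psi (\<lambda>M. ?h (map dup (take (Suc j) W) @ M)) (drop j W))"
    unfolding J_Psi_def prod.case ev_sum
  proof (intro sum.cong refl)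
    fix j assume "j \<in> {..k}"
    then have j: "j \<le> k"
      by simp
    let ?u = "map vV (take (Suc j) W)"
    \<comment> \<open>Joining with the fixed front makes \<open>H\<close> a functional of the back
      part; the join raises the degree by 1.\<close>
    let ?H = "\<lambda>(k', v). H (j + k' + 1, ?u @ v)"
    have cu: "?u \<in> cells (EG D8) j"
      using j W vV_in_D8 by (auto simp: cells_EG)
    have H': "vanishes_degenerate ?H"
      using H cu by (auto simp: vanishes_degenerate_def cells_EG distinct_adj_append_iff)
    have e: "(if degenerate (EG D8) (j + k' + 1) (?u @ v) then 0 else H (j + k' + 1, ?u @ v)) = H (j + k' + 1, ?u @ v)" for k' v
      using degenerate_EG_not_distinct_adj[of D8 "j + k' + 1" "?u @ v"] degenerate_EG_cell[of D8 "j + k' + 1" "?u @ v"] H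
      by (auto simp: vanishes_degenerate_def)
    have l: "length (drop j W) = Suc (k - j)"
      using W j by simp
    have E: "ev ?H (Psi (cls (EG V4) (k - j) (map vV (drop j W)))) = psi (\<lambda>M. ?h (map dup (take (Suc j) W) @ M)) (drop j W)"
    proof -
      have "ev ?H (Psi (cls (EG V4) (k - j) (map vV (drop j W)))) = psi (\<lambda>T. ?H (length T - 1, map vD T)) (drop j W)"
        by (rule ev_Psi[OF l H'])
      also have "\<dots> = psi (\<lambda>M. ?h (map dup (take (Suc j) W) @ M)) (drop j W)"
      proof (rule psi_cong)
        fix t :: "(bool \<times> bool \<times> bool) list" assume "length t = length (drop j W)"
        then have "length t = Suc (k - j)"
          using l by simp
        then show "?H (length t - 1, map vD t) = ?h (map dup (take (Suc j) W) @ t)"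
          using j W by (simp add: o_def One_nat_def)
      qed
      finally show ?thesis .
    qed
    have "ev H (join D8 (cls (EG D8) j ?u) (Psi (cls (EG V4) (k - j) (map vV (drop j W))))) =
       (if degenerate (EG D8) j ?u then 0 else ev ?H (Psi (cls (EG V4) (k - j) (map vV (drop j W)))))"
      unfolding ev_join ev_cls prod.case e ..
    also have "\<dots> = psi (\<lambda>M. ?h (map dup (take (Suc j) W) @ M)) (drop j W)"
    proof (cases "degenerate (EG D8) j ?u")
      case True
      then have "\<not> distinct_adj ?u"
        by (rule degenerate_EG_not_distinct_adj)
      moreover have "?u @ map vD M \<in> cells (EG D8) (length (map dup (take (Suc j) W) @ M) - 1)" for M
        using cu vD_in_D8 by (auto simp: cells_EG)
      ultimately have "?h (map dup (take (Suc j) W) @ M) = 0" for M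
        using H by (auto simp: vanishes_degenerate_def distinct_adj_append_iff o_def)
      then show ?thesis
        using True by simp
    next
      case False
      then show ?thesis
        unfolding E by simp
    qed
    finally show "ev H (join D8 (cls (EG D8) j (take (Suc j) (map vV W))) (Psi (cls (EG V4) (k - j) (drop j (map vV W)))))
      = psi (\<lambda>M. ?h (map dup (take (Suc j) W) @ M)) (drop j W)"
      by (simp only: take_map drop_map)
  qed
  then show ?thesis
    unfolding J_sum by (simp add: W lessThan_Suc_atMost)
qed

lemma ev_of_bool: "ev (\<lambda>y. of_bool (y = x)) c = of_bool (x \<in> Poly_Mapping.keys c)"
proof (cases "x \<in> Poly_Mapping.keys c")
  case True
  then show ?thesis
    unfolding ev_def by (simp add: of_bool_def sum.delta)
next
  case False
  then show ?thesis
    unfolding ev_def by (intro trans[OF sum.neutral]) auto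
qed

lemma cells_V4: "u \<in> cells (EG V4) k \<Longrightarrow> \<exists>W. u = map vV W \<and> length W = Suc k"
proof -
  assume u: "u \<in> cells (EG V4) k"
  have "vV (inv_into UNIV vV g) = g" if "g \<in> set u" for g
    using that u by (intro f_inv_into_f) (auto simp: cells_EG carrier_V4)
  then have "u = map vV (map (inv_into UNIV vV) u)"
    by (simp add: map_idI)
  then show ?thesis
    using u by (metis cells_EG length_map)
qed

lemma lin_J_Psi_chains:
  assumes "c \<in> chains (EG V4)"
  shows "lin J_Psi c \<in> chains (EG D8)"
proof -
  have "v \<in> cells (EG D8) n \<and> distinct_adj v" if "(n, v) \<in> Poly_Mapping.keys (J_Psi (k, map vV W))" "length W = Suc k" for n v k W
  proof -
    have nd: "\<not> degenerate (EG D8) n v"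
    proof -
      have "Poly_Mapping.keys (J_Psi (k, map vV W)) \<subseteq> {(n, v). \<not> degenerate (EG D8) n v}"
        unfolding J_Psi_def prod.case join_def
        by (rule order_trans[OF keys_sum], rule UN_least, rule order_trans[OF keys_lin], rule UN_least)
           (auto simp: keys_cls split: if_splits)
      with that(1) show ?thesis
        by auto
    qed
    have "v \<in> cells (EG D8) n"
    proof (rule ccontr)
      assume nc: "v \<notin> cells (EG D8) n"
      \<comment> \<open>The indicator of a simplex outside \<open>EG D8\<close> vanishes on
        everything that \<open>J\<close> evaluates, so by the pairing formula this simplex is not in
        the support.\<close>
      let ?H = "\<lambda>y. of_bool (y = (n, v)) :: bit"
      have H: "vanishes_degenerate ?H"
        using nc by (auto simp: vanishes_degenerate_def)
      have "ev ?H (J_Psi (k, map vV W)) = J dup psi (\<lambda>T. ?H (length T - 1, map vD T)) W"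
        by (rule ev_J_Psi[OF that(2) H])
      also have "\<dots> = 0"
      proof (rule J_eq_0)
        fix w M
        have "map vD (w # M) \<in> cells (EG D8) (length (w # M) - 1)"
          using vD_in_D8 by (auto simp: cells_EG)
        then show "?H (length (w # M) - 1, map vD (w # M)) = 0"
          using nc by auto
      qed simp
      finally show False
        using that(1) by (simp add: ev_of_bool)
    qed
    then show ?thesis
      using nd by (simp add: degenerate_EG)
  qed
  then have "v \<in> cells (EG D8) n \<and> distinct_adj v" if "(n, v) \<in> Poly_Mapping.keys (J_Psi x)" "x \<in> Poly_Mapping.keys c" for n v x
    using that assms cells_V4 by (cases x) (fastforce simp: chains_EG)
  then show ?thesis
    using keys_lin[of J_Psi c] by (fastforce simp: chains_EG)
qed

definition right23 :: "perm \<Rightarrow> perm" where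
  "right23 h = h \<circ> p23"

lemma inv_p23: "inv\<^bsub>S4\<^esub> p23 = p23"
  by (rule inv_S4) (use in_S4 relations in auto)

lemma right23_S4: "h \<in> carrier S4 \<Longrightarrow> right23 h \<in> carrier S4"
  unfolding right23_def by (rule comp_S4) (use in_S4 in auto)

lemma J_23_eq: "J_23 (k, gs) = (\<Sum>j\<le>k. cls (EG S4) (k + 1) (take (Suc j) gs @ map right23 (drop j gs)))"
  by (simp add: J_23_def inv_p23 right23_def[abs_def])

lemma ev_J_23:
  assumes "length gs = Suc k" "normal h"
  shows "ev (\<lambda>(n, v). h v) (J_23 (k, gs)) = J (\<lambda>x. x) (\<lambda>h W. h (map right23 W)) h gs"
proof -
  have "(if degenerate (EG S4) (k + 1) v then 0 else h v) = h v" for v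
    using degenerate_EG_not_distinct_adj[of S4 "k + 1" v] assms(2) by (auto simp: normal_def)
  then show ?thesis
    unfolding J_23_eq ev_sum ev_cls prod.case J_sum by (simp add: assms(1) lessThan_Suc_atMost)
qed

lemma lin_J_23_chains:
  assumes "c \<in> chains (EG S4)"
  shows "lin J_23 c \<in> chains (EG S4)"
proof -
  have "v \<in> cells (EG S4) n \<and> distinct_adj v" if kgs: "(n, v) \<in> Poly_Mapping.keys (J_23 (k, gs))" "gs \<in> cells (EG S4) k" for n v k gs
  proof -
    obtain j where j: "j \<le> k" and v: "(n, v) \<in> Poly_Mapping.keys (cls (EG S4) (k + 1) (take (Suc j) gs @ map right23 (drop j gs)))"
      using kgs(1) keys_sum[of "\<lambda>j. cls (EG S4) (k + 1) (take (Suc j) gs @ map right23 (drop j gs))" "{..k}"]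
      unfolding J_23_eq by auto
    have "take (Suc j) gs @ map right23 (drop j gs) \<in> cells (EG S4) (k + 1)"
      using kgs(2) j right23_S4 set_take_subset[of "Suc j" gs] set_drop_subset[of j gs] by (fastforce simp: cells_EG)
    then show ?thesis
      using v by (auto simp: keys_cls degenerate_EG split: if_splits)
  qed
  then have "v \<in> cells (EG S4) n \<and> distinct_adj v" if "(n, v) \<in> Poly_Mapping.keys (J_23 x)" "x \<in> Poly_Mapping.keys c" for n v x
    using that assms by (cases x) (fastforce simp: chains_EG)
  then show ?thesis
    using keys_lin[of J_23 c] by (fastforce simp: chains_EG)
qed

section \<open>An explicit lift of the cross product\<close>

lemma distinct_adj_shuf:
  "p \<in> set (shuf A L) \<Longrightarrow> distinct_adj A \<Longrightarrow> distinct_adj L \<Longrightarrow> distinct_adj p"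
proof (induction A L arbitrary: p rule: shuf.induct)
  case (3 x xs y ys)
  obtain q where p: "p = (x, y) # q"
    and q: "xs = [] \<and> ys = [] \<and> q = [] \<or> q \<in> set (shuf xs (y # ys)) \<or> q \<in> set (shuf (x # xs) ys)"
    using 3(3) by (rule shuf_ConsE)
  have d: "distinct_adj xs" "distinct_adj ys"
    using not_distinct_adj_Cons[of xs x] not_distinct_adj_Cons[of ys y] 3(4,5) by metis+
  from q consider "q = []" | "q \<in> set (shuf xs (y # ys))" | "q \<in> set (shuf (x # xs) ys)"
    by blast
  then show ?case
  proof cases
    case 2
    then have "hd q = (hd xs, y)" "q \<noteq> []" "xs \<noteq> []"
      using shuf_hd[OF 2] shuf_not_Nil[OF 2] by auto
    then show ?thesis
      using 3(1)[OF 2 d(1) 3(5)] 3(4) p by (cases q; cases xs) auto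
  next
    case 3
    then have "hd q = (x, hd ys)" "q \<noteq> []" "ys \<noteq> []"
      using shuf_hd[OF 3] shuf_not_Nil[OF 3] by auto
    then show ?thesis
      using "3.IH"(2)[OF 3 \<open>distinct_adj (x # xs)\<close> d(2)] \<open>distinct_adj (y # ys)\<close> p by (cases q; cases ys) auto
  qed (simp add: p)
qed simp_all

lemma distinct_adj_alt: "x \<noteq> y \<Longrightarrow> distinct_adj (alt x y k)"
proof (induction k arbitrary: x y)
  case (Suc k)
  then have "distinct_adj (alt y x k)"
    by metis
  then show ?case
    using Suc.prems by (cases k) auto
qed simp

definition x_cross_lift :: "nat \<Rightarrow> nat \<Rightarrow> perm list chain" where
  "x_cross_lift q p = push to_EV4 (EG V4) (EZ ES2 ES2 ((q, xt q), (p, xt p)))"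

lemma to_EV4_tp: "length A = length B \<Longrightarrow> to_EV4 (map tp A, map tp B) = map vV (zip A B)"
  unfolding to_EV4_def prod.case by (rule nth_equalityI) (simp_all add: vV_def)

lemma to_EV4_tp_fst_snd: "to_EV4 (map tp (map fst W), map tp (map snd W)) = map vV W"
  using to_EV4_tp[of "map fst W" "map snd W"] by (simp add: zip_map_fst_snd)

lemma map_vV_cell: "length W = Suc k \<Longrightarrow> map vV W \<in> cells (EG V4) k"
  by (auto simp: cells_EG carrier_V4)

lemma distinct_adj_map_vV [simp]: "distinct_adj (map vV W) \<longleftrightarrow> distinct_adj W"
  by (simp add: distinct_adj_map_iff inj_on_subset[OF inj_vV])

lemma shuf_xb:
  assumes "W \<in> set (shuf (xb q) (xb p))"
  shows "length W = Suc (q + p)" "distinct_adj W"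
  using length_shuf[OF assms] distinct_adj_shuf[OF assms distinct_adj_alt distinct_adj_alt] by simp_all

lemma ev_x_cross_lift: "ev f (x_cross_lift q p) = (\<Sum>W\<leftarrow>shuf (xb q) (xb p). f (q + p, map vV W))"
proof -
  let ?F = "\<lambda>(k, u). if degenerate (EG V4) k (to_EV4 u) then 0 else f (k, to_EV4 u)"
  have F: "?F (q + p, (map tp (map fst W), map tp (map snd W))) = f (q + p, map vV W)" if "W \<in> set (shuf (xb q) (xb p))" for W
    unfolding prod.case to_EV4_tp_fst_snd using degenerate_EG[OF map_vV_cell[OF shuf_xb(1)[OF that]]] shuf_xb(2)[OF that] by simp
  have "ev f (x_cross_lift q p) = (\<Sum>W\<leftarrow>shuf (xb q) (xb p). ?F (q + p, (map tp (map fst W), map tp (map snd W))))"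
    unfolding x_cross_lift_def ev_push xt_eq
  proof (rule ev_EZ[OF encodes_ES2 encodes_ES2])
    fix W assume "W \<in> set (shuf (xb q) (xb p))" "\<not> distinct_adj W"
    then show "?F (q + p, (map tp (map fst W), map tp (map snd W))) = 0"
      using shuf_xb by blast
  qed simp_all
  also have "\<dots> = (\<Sum>W\<leftarrow>shuf (xb q) (xb p). f (q + p, map vV W))"
    by (intro sum_list_cong F)
  finally show ?thesis .
qed

lemma x_cross_lift_chains: "x_cross_lift q p \<in> chains (EG V4)"
proof -
  have "v \<in> cells (EG V4) n \<and> distinct_adj v" if "(n, v) \<in> Poly_Mapping.keys (x_cross_lift q p)" for n v
  proof -
    have "ev (\<lambda>y. of_bool (y = (n, v))) (x_cross_lift q p) \<noteq> 0"
      using that by (simp add: ev_of_bool)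
    then obtain W where "W \<in> set (shuf (xb q) (xb p))" "(q + p, map vV W) = (n, v)"
      unfolding ev_x_cross_lift using sum_list_eq_0[of "shuf (xb q) (xb p)" "\<lambda>W. of_bool ((q + p, map vV W) = (n, v))"] by fastforce
    then show ?thesis
      using shuf_xb[of W q p] map_vV_cell[of W "q + p"] by auto
  qed
  then show ?thesis
    by (auto simp: chains_EG)
qed

definition orb2 :: "bool list \<Rightarrow> perm list set" where
  "orb2 A = orbit_of S2 (map tp A)"

lemma pT_tp: "tp e \<circ> tp f = tp (e \<noteq> f)"
  using pT_pT by (cases e; cases f) (auto simp: tp_def fun_eq_iff)

lemma mult_S2 [simp]: "x \<otimes>\<^bsub>S2\<^esub> y = x \<circ> y"
  by (simp add: sym_group_def)

lemma orb2_eq: "orb2 A = range (\<lambda>e. map tp (map (\<lambda>a. e \<noteq> a) A))"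
  by (auto simp: orb2_def orbit_of_def carrier_S2 translate_def pT_tp image_iff)

lemma encodes_BS2: "encodes (BG S2) orb2"
  unfolding encodes_def
proof (intro conjI allI impI)
  fix m :: nat and S :: "bool list" and \<theta> assume *: "length S = Suc m" "set \<theta> \<subseteq> {..m}"
  have "map tp S \<in> cells (EG S2) m"
    using *(1) by (auto simp: cells_EG carrier_S2)
  then have "act (BG S2) m \<theta> (orb2 S) = orbit_of S2 (map ((!) (map tp S)) \<theta>)"
    unfolding orb2_def by (rule act_BG_orbit[OF _ *(2)])
  then show "act (BG S2) m \<theta> (orb2 S) = orb2 (map ((!) S) \<theta>)"
    using * by (subst (asm) nth_map_list) (auto simp: orb2_def)
next
  fix k i v and S :: "bool list" assume *: "i < k" "length S = Suc k"
    "orb2 S = act (BG S2) (k - 1) ([0..<Suc i] @ [i..<k]) v"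
  have "map tp S \<in> orb2 S"
    unfolding orb2_eq by (rule image_eqI[of _ _ False]) (simp_all add: o_def)
  then obtain w where "map tp S = map ((!) w) ([0..<Suc i] @ [i..<k])"
    unfolding *(3) by (auto simp: BG_def act_EG)
  then have "map tp S ! i = map tp S ! Suc i"
    using degeneracy_nth[OF *(1)] by metis
  then show "S ! i = S ! Suc i"
    using *(1,2) by simp
qed

text \<open>Flipping the two coordinates independently is translation by an element of
  \<open>V4\<close>, since the group law of \<open>V4\<close> is exclusive or in each
  coordinate.\<close>

lemma to_EV4_orb2: "to_EV4 ` (orb2 (map fst W) \<times> orb2 (map snd W)) = orbit_of V4 (map vV W)"
proof -
  have "to_EV4 (map tp (map (\<lambda>a. e \<noteq> a) (map fst W)), map tp (map (\<lambda>a. f \<noteq> a) (map snd W))) = translate V4 (vV (e, f)) (map vV W)" for e f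
  proof -
    have "zip (map (\<lambda>a. e \<noteq> a) (map fst W)) (map (\<lambda>a. f \<noteq> a) (map snd W)) = map (\<lambda>(a, b). (e \<noteq> a, f \<noteq> b)) W"
      by (rule nth_equalityI) (simp_all add: case_prod_unfold)
    moreover have "vV (e, f) \<circ> vV x = vV (e \<noteq> fst x, f \<noteq> snd x)" for x
      by (cases x) (simp add: vV_mult)
    ultimately show ?thesis
      by (subst to_EV4_tp) (simp_all add: translate_def case_prod_unfold)
  qed
  then show ?thesis
    unfolding orb2_eq orbit_of_def carrier_V4 by (force simp: image_iff)
qed

lemma x_B_eq: "x_B q = Poly_Mapping.single (q, orb2 (xb q)) 1"
proof -
  have c: "xt q \<in> cells ES2 q"
    by (auto simp: xt_eq cells_EG carrier_S2 simp del: alt.simps)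
  have d: "distinct_adj (xt q)"
    by (simp add: xt_eq distinct_adj_map_iff inj_on_subset[OF inj_tp] distinct_adj_alt del: alt.simps)
  have "group S2"
    by (rule sym_group_is_group)
  then have "\<not> degenerate (BG S2) q (orbit_of S2 (xt q))"
    using group.degenerate_BG[of S2 "xt q" q] c d by (auto simp: cells_EG)
  moreover have "\<not> degenerate ES2 q (xt q)"
    using degenerate_EG[OF c] d by simp
  ultimately show ?thesis
    by (simp add: x_B_def proj_def push_def lin_def cls_def orb2_def xt_eq del: alt.simps)
qed

lemma x_cross_eq: "x_cross q p = proj V4 (x_cross_lift q p)"
proof (rule poly_eqI_ev)
  fix f :: "nat \<times> perm list set \<Rightarrow> bit"
  let ?F = "\<lambda>(k, u). if degenerate (BG V4) k ((\<lambda>(\<omega>, \<omega>'). to_EV4 ` (\<omega> \<times> \<omega>')) u) then 0 else f (k, (\<lambda>(\<omega>, \<omega>'). to_EV4 ` (\<omega> \<times> \<omega>')) u)"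
  have t: "lin (EZ (BG S2) (BG S2)) (tensor (x_B q) (x_B p)) = EZ (BG S2) (BG S2) ((q, orb2 (xb q)), (p, orb2 (xb p)))"
    unfolding x_B_eq by (simp add: tensor_def lin_def del: alt.simps)
  have "ev f (x_cross q p) = (\<Sum>W\<leftarrow>shuf (xb q) (xb p). ?F (q + p, (orb2 (map fst W), orb2 (map snd W))))"
    unfolding x_cross_def t ev_push
  proof (rule ev_EZ[OF encodes_BS2 encodes_BS2])
    fix W assume "W \<in> set (shuf (xb q) (xb p))" "\<not> distinct_adj W"
    then show "?F (q + p, (orb2 (map fst W), orb2 (map snd W))) = 0"
      using shuf_xb by blast
  qed simp_all
  also have "\<dots> = (\<Sum>W\<leftarrow>shuf (xb q) (xb p). (\<lambda>(k, u). if degenerate (BG V4) k (orbit_of V4 u) then 0 else f (k, orbit_of V4 u)) (q + p, map vV W))"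
    unfolding prod.case to_EV4_orb2 ..
  also have "\<dots> = ev f (proj V4 (x_cross_lift q p))"
    unfolding proj_def ev_push ev_x_cross_lift ..
  finally show "ev f (x_cross q p) = ev f (proj V4 (x_cross_lift q p))" .
qed

section \<open>The boundary of the homotopies\<close>

lemma J_comp: "J i P f (map n W) = J (\<lambda>w. i (n w)) (\<lambda>h W. P h (map n W)) f W"
  by (induction W arbitrary: f) simp_all

lemma set_switch_words: "w \<in> set (switch_words n fs os) \<Longrightarrow> set w \<subseteq> set fs \<union> set os"
proof (induction n fs os arbitrary: w rule: switch_words.induct)
  case (2 n x fs os)
  from 2(3) obtain v where w: "w = x # v" and "v = [] \<or> v \<in> set (switch_words n fs os) \<or> (n \<noteq> 0 \<and> v \<in> set (switch_words (n - 1) os (x # fs)))"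
    by (auto simp: switch_words.simps(2) split: if_splits)
  then show ?case
    using 2(1)[of v] 2(2)[of v] by (elim disjE) auto
qed simp

lemma coll_filter: "P l \<Longrightarrow> coll l (filter (\<lambda>z. P (fst z)) p) = coll l p"
  by (induction p) auto

lemma sum_list_prod: "(\<Sum>x\<leftarrow>xs. \<Sum>y\<leftarrow>ys. f x * g y) = (\<Sum>x\<leftarrow>xs. f x) * (\<Sum>y\<leftarrow>ys. g y)"
  for f :: "_ \<Rightarrow> bit"
  by (simp add: sum_list_const_mult sum_list_mult_const)

lemma sum_shuf_alt_34:
  fixes L :: "'c list"
  shows "(\<Sum>p\<leftarrow>shuf (alt (3::nat) 4 k) L. f (coll 3 p) (coll 4 p)) = (\<Sum>p\<leftarrow>shuf (alt (1::nat) 2 k) L. f (coll 1 p) (coll 2 p))"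
proof -
  have a: "alt 3 4 k = map (\<lambda>l. l + 2) (alt (1::nat) 2 k)"
    by (simp add: map_alt)
  have i: "inj (\<lambda>l::nat. l + 2)"
    by (simp add: inj_def)
  have "coll 3 (map (map_prod (\<lambda>l. l + 2) id) r) = coll 1 r" "coll 4 (map (map_prod (\<lambda>l. l + 2) id) r) = coll 2 r" for r :: "(nat \<times> 'c) list"
    using coll_map_inj[OF i, of 1 r] coll_map_inj[OF i, of 2 r] by simp_all
  then show ?thesis
    unfolding a using shuf_map[of "\<lambda>l. l + 2" "alt (1::nat) 2 k" id L] by (simp add: o_def)
qed

context simplicial_set begin

text \<open>Left multiplication by an element of \<open>S4\<close> also keeps sequences outside
  \<open>S4\<close> outside, so the default value respects it.\<close>

lemma theta_left_mult:
  assumes g: "g \<in> carrier S4"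
  shows "theta \<alpha> N u L (map (\<lambda>h. g \<circ> h) gs) = theta \<alpha> N u L gs"
proof (cases "set gs \<subseteq> carrier S4")
  case False
  then obtain h where h: "h \<in> set gs" "h \<notin> carrier S4"
    by blast
  have p: "g permutes {1..4}"
    using g by (simp add: carrier_S4)
  have "g \<circ> h \<notin> carrier S4"
  proof
    assume "g \<circ> h \<in> carrier S4"
    then have "inv_into UNIV g \<circ> (g \<circ> h) \<in> carrier S4"
      by (rule comp_S4[rotated]) (use permutes_inv[OF p] in \<open>simp add: carrier_S4\<close>)
    moreover have "inv_into UNIV g \<circ> (g \<circ> h) = h"
      using permutes_inv_o(2)[OF p] by (simp add: comp_assoc[symmetric])
    ultimately show False
      using h(2) by simp
  qed
  then show ?thesis
    using h False by (auto simp: theta_def)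
qed (rule theta_translate[OF g])

text \<open>Left multiplication by a, bc, b and c, written in the coordinates (r, s, t).\<close>

lemma theta_vD:
  "theta \<alpha> N u L (map vD (map (map_prod Not prod.swap) t)) = theta \<alpha> N u L (map vD t)"
  "theta \<alpha> N u L (map vD (map (map_prod id (map_prod Not Not)) t)) = theta \<alpha> N u L (map vD t)"
  "theta \<alpha> N u L (map vD (map (map_prod id (map_prod Not id)) t)) = theta \<alpha> N u L (map vD t)"
  "theta \<alpha> N u L (map vD (map (map_prod id (map_prod id Not)) t)) = theta \<alpha> N u L (map vD t)"
proof -
  have *: "theta \<alpha> N u L (map vD (map m t)) = theta \<alpha> N u L (map vD t)"
    if "g \<in> carrier S4" "\<And>x. vD (m x) = g \<circ> vD x" for g m
  proof -
    have "map vD (map m t) = map (\<lambda>h. g \<circ> h) (map vD t)"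
      by (simp add: that(2))
    then show ?thesis
      by (simp only: theta_left_mult[OF that(1)])
  qed
  show "theta \<alpha> N u L (map vD (map (map_prod Not prod.swap) t)) = theta \<alpha> N u L (map vD t)"
    by (rule *[OF in_S4(1)]) (auto simp: pa_vD split: prod.splits)
  show "theta \<alpha> N u L (map vD (map (map_prod id (map_prod Not Not)) t)) = theta \<alpha> N u L (map vD t)"
    by (rule *[OF comp_S4[OF in_S4(2,3)]]) (auto simp: pbpc_vD split: prod.splits)
  show "theta \<alpha> N u L (map vD (map (map_prod id (map_prod Not id)) t)) = theta \<alpha> N u L (map vD t)"
    by (rule *[OF in_S4(2)]) (auto simp: pb_vD split: prod.splits)
  show "theta \<alpha> N u L (map vD (map (map_prod id (map_prod id Not)) t)) = theta \<alpha> N u L (map vD t)"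
    by (rule *[OF in_S4(3)]) (auto simp: pc_vD split: prod.splits)
qed

definition thetaD :: "'a cochain \<Rightarrow> nat \<Rightarrow> 'a \<Rightarrow> (bool \<times> bool \<times> bool) list \<Rightarrow> bit" where
  "thetaD \<alpha> N u T = theta \<alpha> N u [0..<Suc N] (map vD T)"

lemma normal_thetaD:
  assumes "u \<in> cells X N" "vanishes X \<alpha>"
  shows "normal (thetaD \<alpha> N u)"
  using normal_theta[OF assms] unfolding normal_def thetaD_def by (blast dest: distinct_adj_mapD)

lemma J_thetaD_invariant:
  "J dup psi (thetaD \<alpha> N u) (map (map_prod Not id) W) = J dup psi (thetaD \<alpha> N u) W"
  "J dup psi (thetaD \<alpha> N u) (map (map_prod id Not) W) = J dup psi (thetaD \<alpha> N u) W"
proof -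
  have "J dup psi (thetaD \<alpha> N u) (map (map_prod Not id) W) = J dup psi (\<lambda>t. thetaD \<alpha> N u (map (map_prod Not prod.swap) t)) W"
    by (rule J_map) (auto simp: dup_def psi_map_Not)
  then show "J dup psi (thetaD \<alpha> N u) (map (map_prod Not id) W) = J dup psi (thetaD \<alpha> N u) W"
    by (simp only: thetaD_def[abs_def] theta_vD)
  have "J dup psi (thetaD \<alpha> N u) (map (map_prod id Not) W) = J dup psi (\<lambda>t. thetaD \<alpha> N u (map (map_prod id (map_prod Not Not)) t)) W"
    by (rule J_map) (auto simp: dup_def psi_map_snd)
  then show "J dup psi (thetaD \<alpha> N u) (map (map_prod id Not) W) = J dup psi (thetaD \<alpha> N u) W"
    by (simp only: thetaD_def[abs_def] theta_vD)
qed

lemma ev_theta_proj: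
  assumes u: "u \<in> cells X N" and \<alpha>: "vanishes X \<alpha>" and c: "c \<in> chains (EG S4)"
  shows "BS4_act X (proj S4 c) \<alpha> N u = ev (\<lambda>(k, gs). theta \<alpha> N u [0..<Suc N] gs) c"
proof -
  have "BS4_act X (proj S4 c) \<alpha> N u = ev (\<lambda>(k, gs). theta \<alpha> N u [0..<Suc N] gs) (lift_chain S4 (proj S4 c))"
    using lift_chain_proj[OF c] by (intro BS4_act_eq[OF u \<alpha>]) simp
  also have "\<dots> = ev (\<lambda>(k, gs). theta \<alpha> N u [0..<Suc N] gs) c"
    by (rule group.ev_lift_chain[OF group_S4 c]) (simp add: translate_def theta_left_mult)
  finally show ?thesis .
qed

text \<open>The value of the homotopy on \<open>theta\<close> is invariant under \<open>V4\<close>,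
  so the unspecified lift may be replaced by the explicit one.\<close>

lemma BS4_act_J_Psi:
  assumes u: "u \<in> cells X N" and \<alpha>: "vanishes X \<alpha>"
  shows "BS4_act X (incl_BG S4 (J_Psi_bar (x_cross q p))) \<alpha> N u =
    (\<Sum>W\<leftarrow>shuf (xb q) (xb p). J dup psi (thetaD \<alpha> N u) W)"
proof -
  let ?H = "\<lambda>(k, gs). theta \<alpha> N u [0..<Suc N] gs"
  define c where "c = lift_chain V4 (proj V4 (x_cross_lift q p))"
  have c: "c \<in> chains (EG V4)"
    unfolding c_def using lift_chain_proj[OF x_cross_lift_chains] by blast
  have D: "lin J_Psi c \<in> chains (EG D8)"
    by (rule lin_J_Psi_chains[OF c])
  have m: "mult D8 = mult S4"
    by (simp add: D8_def)
  note i = incl_BG_proj[OF group_S4 group_D8 D8_sub m D]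
  have vd: "vanishes_degenerate ?H"
    using normal_theta[OF u \<alpha>] by (auto simp: vanishes_degenerate_def normal_def)
  have J: "ev ?H (J_Psi (k, map vV W)) = J dup psi (thetaD \<alpha> N u) W" if "length W = Suc k" for k W
    using ev_J_Psi[OF that vd] by (simp add: thetaD_def[abs_def] del: upt_Suc)
  have "BS4_act X (incl_BG S4 (J_Psi_bar (x_cross q p))) \<alpha> N u = ev ?H (lin J_Psi c)"
    unfolding J_Psi_bar_def x_cross_eq c_def[symmetric] i(2) by (rule ev_theta_proj[OF u \<alpha> i(1)])
  also have "\<dots> = ev (\<lambda>x. ev ?H (J_Psi x)) c"
    by (rule ev_lin)
  also have "\<dots> = ev (\<lambda>x. ev ?H (J_Psi x)) (x_cross_lift q p)"
    unfolding c_def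
  proof (rule group.ev_lift_chain[OF group_V4 x_cross_lift_chains])
    fix k v g assume v: "v \<in> cells (EG V4) k" and g: "g \<in> carrier V4"
    obtain W where W: "v = map vV W" "length W = Suc k"
      using cells_V4[OF v] by blast
    obtain e f where ef: "g = vV (e, f)"
      using g by (auto simp: carrier_V4)
    define W' where "W' = map (\<lambda>(a, b). (e \<noteq> a, f \<noteq> b)) W"
    have "translate V4 g v = map vV W'"
      by (auto simp: translate_def W ef W'_def vV_mult)
    moreover have "J dup psi (thetaD \<alpha> N u) W' = J dup psi (thetaD \<alpha> N u) W"
    proof -
      have "W' = (if e then map (map_prod Not id) else id) ((if f then map (map_prod id Not) else id) W)"
        by (cases e; cases f) (auto simp: W'_def intro!: map_idI)
      then show ?thesis
        by (simp add: J_thetaD_invariant)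
    qed
    moreover have "length W' = Suc k"
      using W by (simp add: W'_def)
    ultimately show "ev ?H (J_Psi (k, translate V4 g v)) = ev ?H (J_Psi (k, v))"
      using J W by simp
  qed
  also have "\<dots> = (\<Sum>W\<leftarrow>shuf (xb q) (xb p). J dup psi (thetaD \<alpha> N u) W)"
    unfolding ev_x_cross_lift by (intro sum_list_cong J shuf_xb(1))
  finally show ?thesis .
qed

abbreviation J23 :: "(perm list \<Rightarrow> bit) \<Rightarrow> (bool \<times> bool) list \<Rightarrow> bit" where
  "J23 \<equiv> J vV (\<lambda>h W. h (map (\<lambda>w. right23 (vV w)) W))"

lemma BS4_act_J_23:
  assumes u: "u \<in> cells X N" and \<alpha>: "vanishes X \<alpha>"
  shows "BS4_act X (J_23_bar (incl_BG S4 (x_cross q p))) \<alpha> N u =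
    (\<Sum>W\<leftarrow>shuf (xb q) (xb p). J23 (theta \<alpha> N u [0..<Suc N]) W)"
proof -
  let ?\<theta> = "theta \<alpha> N u [0..<Suc N]"
  let ?H = "\<lambda>(k, gs). ?\<theta> gs"
  have V: "carrier V4 \<subseteq> carrier S4" "mult V4 = mult S4"
    using vV_in_S4 by (auto simp: carrier_V4) (simp add: V4_def)
  note i = incl_BG_proj[OF group_S4 group_V4 V x_cross_lift_chains, of q p]
  define c where "c = lift_chain S4 (proj S4 (x_cross_lift q p))"
  have c: "c \<in> chains (EG S4)"
    unfolding c_def using lift_chain_proj[OF i(1)] by blast
  have J: "ev ?H (J_23 (k, gs)) = J (\<lambda>x. x) (\<lambda>h W. h (map right23 W)) ?\<theta> gs" if "length gs = Suc k" for k gs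
    by (rule ev_J_23[OF that normal_theta[OF u \<alpha>]])
  have "BS4_act X (J_23_bar (incl_BG S4 (x_cross q p))) \<alpha> N u = ev ?H (lin J_23 c)"
    unfolding J_23_bar_def x_cross_eq i(2) c_def[symmetric] by (rule ev_theta_proj[OF u \<alpha> lin_J_23_chains[OF c]])
  also have "\<dots> = ev (\<lambda>x. ev ?H (J_23 x)) c"
    by (rule ev_lin)
  also have "\<dots> = ev (\<lambda>x. ev ?H (J_23 x)) (x_cross_lift q p)"
    unfolding c_def
  proof (rule group.ev_lift_chain[OF group_S4 i(1)])
    fix k v g assume v: "v \<in> cells (EG S4) k" and g: "g \<in> carrier S4"
    have l: "length v = Suc k" "length (map (\<lambda>h. g \<circ> h) v) = Suc k"
      using v by (simp_all add: cells_EG)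
    have "J (\<lambda>x. x) (\<lambda>h W. h (map right23 W)) ?\<theta> (map (\<lambda>h. g \<circ> h) v) =
      J (\<lambda>x. x) (\<lambda>h W. h (map right23 W)) (\<lambda>t. ?\<theta> (map (\<lambda>h. g \<circ> h) t)) v"
      by (rule J_map) (simp_all add: right23_def o_def)
    then show "ev ?H (J_23 (k, translate S4 g v)) = ev ?H (J_23 (k, v))"
      unfolding translate_def mult_S4 J[OF l(1)] J[OF l(2)] theta_left_mult[OF g] .
  qed
  also have "\<dots> = (\<Sum>W\<leftarrow>shuf (xb q) (xb p). J23 ?\<theta> W)"
    unfolding ev_x_cross_lift
  proof (rule sum_list_cong)
    fix W assume "W \<in> set (shuf (xb q) (xb p))"
    then have "length (map vV W) = Suc (q + p)"
      using shuf_xb(1) by simp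
    from J[OF this] show "ev ?H (J_23 (q + p, map vV W)) = J23 ?\<theta> W"
      by (simp add: J_comp o_def)
  qed
  finally show ?thesis .
qed

lemma coboundary_cong:
  assumes "\<And>N u. u \<in> cells X N \<Longrightarrow> \<beta> N u = \<gamma> N u" "u \<in> cells X N"
  shows "coboundary X \<beta> N u = coboundary X \<gamma> N u"
proof (cases "N = 0")
  case False
  have "face X N u ({..N} - {i}) \<in> cells X (N - 1)" if "i \<le> N" for i
    unfolding face_eq_act[OF that] using Delta_face[OF that] False by (intro act_closed[OF assms(2)]) simp
  then show ?thesis
    unfolding coboundary_def if_not_P[OF False] by (intro sum.cong refl assms(1)) simp
qed (simp add: coboundary_def)

text \<open>The coboundary sums over faces of u, while \<Lambda> acts on the other variable; this
  lets the coboundary pass through the homotopies.\<close>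

lemma coboundary_linear:
  assumes "\<And>f g. \<Lambda> (\<lambda>x. f x + g x) = \<Lambda> f + \<Lambda> g" "\<Lambda> (\<lambda>_. 0) = 0"
  shows "coboundary X (\<lambda>N u. \<Lambda> (\<lambda>x. F x N u)) N u = \<Lambda> (\<lambda>x. coboundary X (F x) N u)"
proof -
  have S: "\<Lambda> (\<lambda>x. \<Sum>i\<in>I. f i x) = (\<Sum>i\<in>I. \<Lambda> (f i))" for I :: "nat set" and f
    by (induction I rule: infinite_finite_induct) (simp_all add: assms)
  show ?thesis
    by (cases "N = 0") (simp_all add: coboundary_def assms S)
qed

lemma coboundary_add: "coboundary X (\<beta> + \<gamma>) N u = coboundary X \<beta> N u + coboundary X \<gamma> N u"
  by (simp add: coboundary_def sum.distrib)

lemma coboundary_sum_scale: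
  "coboundary X (\<Sum>x\<in>I. scale (t x) (\<beta> x)) N u = (\<Sum>x\<in>I. t x * coboundary X (\<beta> x) N u)"
proof (induction I rule: infinite_finite_induct)
  case (insert x I)
  have "coboundary X (scale (t x) (\<beta> x)) N u = t x * coboundary X (\<beta> x) N u"
    by (simp add: coboundary_def scale_def sum_distrib_left)
  then show ?case
    unfolding sum.insert[OF insert(1,2)] coboundary_add insert(3) by (rule arg_cong)
qed (simp_all add: coboundary_def)

lemma coboundary_J_Psi:
  assumes u: "u \<in> cells X N" and \<alpha>: "cocycle X \<alpha>"
  shows "coboundary X (BS4_act X (incl_BG S4 (J_Psi_bar (x_cross q p))) \<alpha>) N u =
    (\<Sum>W\<leftarrow>shuf (xb q) (xb p). theta \<alpha> N u [0..<Suc N] (map vV W)) + phi (thetaD \<alpha> N u) (xb q) (xb p)"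
proof -
  have van: "vanishes X \<alpha>"
    using \<alpha> by (simp add: cocycle_def)
  note n = normal_thetaD[OF u van]
  let ?\<Lambda> = "\<lambda>f. \<Sum>W\<leftarrow>shuf (xb q) (xb p). J dup psi (\<lambda>T. f (map vD T)) W"
  have L: "?\<Lambda> (\<lambda>x. f x + g x) = ?\<Lambda> f + ?\<Lambda> g" "?\<Lambda> (\<lambda>_. 0) = 0" for f g
    by (simp_all add: J_add[OF psi_add] sum_list_addf sum_list_eq_0 J_eq_0)
  have "coboundary X (BS4_act X (incl_BG S4 (J_Psi_bar (x_cross q p))) \<alpha>) N u =
    coboundary X (\<lambda>N u. ?\<Lambda> (\<lambda>gs. theta \<alpha> N u [0..<Suc N] gs)) N u"
    by (rule coboundary_cong[OF _ u]) (simp add: BS4_act_J_Psi[OF _ van] thetaD_def[abs_def] del: alt.simps upt_Suc)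
  also have "\<dots> = ?\<Lambda> (\<lambda>gs. coboundary X (\<lambda>N u. theta \<alpha> N u [0..<Suc N] gs) N u)"
    by (rule coboundary_linear[OF L])
  also have "\<dots> = (\<Sum>W\<leftarrow>shuf (xb q) (xb p). J dup psi (bd (thetaD \<alpha> N u)) W)"
  proof -
    have "coboundary X (\<lambda>N u. theta \<alpha> N u [0..<Suc N] (map vD T)) N u = bd (thetaD \<alpha> N u) T" for T
    proof -
      have "set (map vD T) \<subseteq> carrier S4"
        using vD_in_S4 by auto
      from coboundary_theta[OF u \<alpha> this] show ?thesis
        unfolding bd_map thetaD_def[abs_def] .
    qed
    then show ?thesis
      by (simp only:)
  qed
  also have "\<dots> = (\<Sum>W\<leftarrow>shuf (xb q) (xb p). thetaD \<alpha> N u (map dup W) + psi (thetaD \<alpha> N u) W + bd (J dup psi (thetaD \<alpha> N u)) W)"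
  proof (rule sum_list_cong)
    fix W assume W: "W \<in> set (shuf (xb q) (xb p))"
    show "J dup psi (bd (thetaD \<alpha> N u)) W = thetaD \<alpha> N u (map dup W) + psi (thetaD \<alpha> N u) W + bd (J dup psi (thetaD \<alpha> N u)) W"
    proof (rule J_bd[OF psi_add psi_bd_ge_2])
      fix h and w :: "bool \<times> bool"
      show "psi (bd h) [w] = h []"
        by (cases w) (simp add: psi_single)
    qed (use shuf_not_Nil[OF W] in simp_all)
  qed
  also have "\<dots> = (\<Sum>W\<leftarrow>shuf (xb q) (xb p). thetaD \<alpha> N u (map dup W)) + (\<Sum>W\<leftarrow>shuf (xb q) (xb p). psi (thetaD \<alpha> N u) W)"
  proof -
    \<comment> \<open>The homotopy on the boundary of the cross product, which is 0 in the
      coinvariants.\<close>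
    have "(\<Sum>W\<leftarrow>shuf (xb q) (xb p). bd (J dup psi (thetaD \<alpha> N u)) W) = 0"
    proof (rule cross_bd)
      show "normal (J dup psi (thetaD \<alpha> N u))"
        by (rule normal_J[OF _ _ n]) (simp_all add: normal_psi psi_zero)
    qed (simp_all add: J_thetaD_invariant)
    then show ?thesis
      by (simp only: sum_list_addf add_0_right)
  qed
  also have "(\<Sum>W\<leftarrow>shuf (xb q) (xb p). psi (thetaD \<alpha> N u) W) = phi (thetaD \<alpha> N u) (xb q) (xb p)"
    by (rule sum_shuf_psi[OF n]) simp_all
  also have "(\<Sum>W\<leftarrow>shuf (xb q) (xb p). thetaD \<alpha> N u (map dup W)) = (\<Sum>W\<leftarrow>shuf (xb q) (xb p). theta \<alpha> N u [0..<Suc N] (map vV W))"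
    by (simp add: thetaD_def o_def del: upt_Suc alt.simps)
  finally show ?thesis .
qed

lemma coboundary_J_23:
  assumes u: "u \<in> cells X N" and \<alpha>: "cocycle X \<alpha>"
  shows "coboundary X (BS4_act X (J_23_bar (incl_BG S4 (x_cross q p))) \<alpha>) N u =
    (\<Sum>W\<leftarrow>shuf (xb q) (xb p). theta \<alpha> N u [0..<Suc N] (map vV W)) + (\<Sum>W\<leftarrow>shuf (xb p) (xb q). theta \<alpha> N u [0..<Suc N] (map vV W))"
proof -
  have van: "vanishes X \<alpha>"
    using \<alpha> by (simp add: cocycle_def)
  let ?\<theta> = "theta \<alpha> N u [0..<Suc N]"
  let ?\<Lambda> = "\<lambda>f. \<Sum>W\<leftarrow>shuf (xb q) (xb p). J23 f W"
  have L: "?\<Lambda> (\<lambda>x. f x + g x) = ?\<Lambda> f + ?\<Lambda> g" "?\<Lambda> (\<lambda>_. 0) = 0" for f g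
    by (simp_all add: J_add sum_list_addf sum_list_eq_0 J_eq_0)
  \<comment> \<open>The coboundary of \<open>theta\<close> is known on sequences in
    \<open>S4\<close>, but the linear functional takes functions of all sequences. This retraction
    onto \<open>S4\<close> changes no sequence at which \<open>J23\<close> evaluates.\<close>
  define r where "r g = (if g \<in> carrier S4 then g else id)" for g
  have rS: "r g \<in> carrier S4" for g
    by (auto simp: r_def carrier_S4 permutes_id)
  have r: "J23 (\<lambda>t. f (map r t)) W = J23 f W" for f W
    by (rule J_invariant) (simp_all add: r_def vV_in_S4 right23_S4 o_def)
  have "coboundary X (BS4_act X (J_23_bar (incl_BG S4 (x_cross q p))) \<alpha>) N u =
    coboundary X (\<lambda>N u. ?\<Lambda> (\<lambda>gs. theta \<alpha> N u [0..<Suc N] gs)) N u"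
    by (rule coboundary_cong[OF _ u]) (simp add: BS4_act_J_23[OF _ van] del: alt.simps upt_Suc)
  also have "\<dots> = ?\<Lambda> (\<lambda>gs. coboundary X (\<lambda>N u. theta \<alpha> N u [0..<Suc N] gs) N u)"
    by (rule coboundary_linear[OF L])
  also have "\<dots> = ?\<Lambda> (\<lambda>gs. coboundary X (\<lambda>N u. theta \<alpha> N u [0..<Suc N] (map r gs)) N u)"
    by (rule sum_list_cong, rule r[symmetric])
  also have "\<dots> = ?\<Lambda> (\<lambda>gs. bd ?\<theta> (map r gs))"
  proof -
    have "coboundary X (\<lambda>N u. theta \<alpha> N u [0..<Suc N] (map r gs)) N u = bd ?\<theta> (map r gs)" for gs
      using rS by (intro coboundary_theta[OF u \<alpha>]) auto
    then show ?thesis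
      by (simp only:)
  qed
  also have "\<dots> = ?\<Lambda> (bd ?\<theta>)"
    by (rule sum_list_cong, rule r)
  also have "\<dots> = (\<Sum>W\<leftarrow>shuf (xb q) (xb p). ?\<theta> (map vV W) + ?\<theta> (map (\<lambda>w. right23 (vV w)) W) + bd (J23 ?\<theta>) W)"
  proof (rule sum_list_cong)
    fix W assume W: "W \<in> set (shuf (xb q) (xb p))"
    show "J23 (bd ?\<theta>) W = ?\<theta> (map vV W) + ?\<theta> (map (\<lambda>w. right23 (vV w)) W) + bd (J23 ?\<theta>) W"
      by (rule J_bd) (use shuf_not_Nil[OF W] in \<open>simp_all add: bd_map\<close>)
  qed
  also have "\<dots> = (\<Sum>W\<leftarrow>shuf (xb q) (xb p). ?\<theta> (map vV W)) + (\<Sum>W\<leftarrow>shuf (xb q) (xb p). ?\<theta> (map (\<lambda>w. right23 (vV w)) W))"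
  proof -
    have inv: "J23 ?\<theta> (map n W) = J23 ?\<theta> W" if "g \<in> carrier S4" "\<And>w. vV (n w) = g \<circ> vV w" for g n W
    proof -
      have "J23 ?\<theta> (map n W) = J23 (\<lambda>t. ?\<theta> (map (\<lambda>h. g \<circ> h) t)) W"
        by (rule J_map) (simp_all add: that(2) right23_def o_def)
      then show ?thesis
        by (simp only: theta_left_mult[OF that(1)])
    qed
    have nP: "normal (\<lambda>W. h (map (\<lambda>w. right23 (vV w)) W))" if "normal h" for h
      using that unfolding normal_def by (blast dest: distinct_adj_mapD)
    have v: "vV (map_prod Not id w) = vV (True, False) \<circ> vV w" "vV (map_prod id Not w) = vV (False, True) \<circ> vV w" for w
      by (cases w; simp add: vV_mult)+
    have "(\<Sum>W\<leftarrow>shuf (xb q) (xb p). bd (J23 ?\<theta>) W) = 0"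
      by (rule cross_bd[OF normal_J[OF nP _ normal_theta[OF u van]]])
         (simp_all only: inv[OF vV_in_S4 v(1)] inv[OF vV_in_S4 v(2)] J.simps)
    then show ?thesis
      by (simp only: sum_list_addf add_0_right)
  qed
  also have "(\<Sum>W\<leftarrow>shuf (xb q) (xb p). ?\<theta> (map (\<lambda>w. right23 (vV w)) W)) = (\<Sum>W\<leftarrow>shuf (xb p) (xb q). ?\<theta> (map vV W))"
  proof -
    \<comment> \<open>A further left multiplication by (23) leaves \<open>theta\<close> unchanged
      and turns right multiplication into conjugation, which exchanges the coordinates.\<close>
    have "p23 \<circ> right23 (vV w) = vV (prod.swap w)" for w
      using p23_vV[of "fst w" "snd w"] by (simp only: right23_def comp_assoc prod.swap_def prod.collapse)
    then have "map (\<lambda>h. p23 \<circ> h) (map (\<lambda>w. right23 (vV w)) W) = map vV (map prod.swap W)" for W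
      by (simp only: map_map comp_def)
    then have "?\<theta> (map (\<lambda>w. right23 (vV w)) W) = ?\<theta> (map vV (map prod.swap W))" for W
      using theta_left_mult[OF in_S4(4), of \<alpha> N u "[0..<Suc N]" "map (\<lambda>w. right23 (vV w)) W"] by (simp only:)
    then show ?thesis
      by (simp only: sum_shuf_swap[of _ "xb p" "xb q"])
  qed
  finally show ?thesis .
qed

text \<open>Table reduction of the product is the composite of 1212... and 3434... with i + 1
  switches. Dividing along it means dividing between the two blocks first, which is the outer cup
  product, and then dividing each part by its own letters.\<close>

lemma ez3_thetaD:
  assumes u: "u \<in> cells X N" and \<alpha>: "cocycle X \<alpha>"
  shows "ez3 (thetaD \<alpha> N u) (xb i) (xb j) (xb k) = cup X i (cup X j \<alpha> \<alpha>) (cup X k \<alpha> \<alpha>) N u"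
proof -
  have van: "vanishes X \<alpha>"
    using \<alpha> by (simp add: cocycle_def)
  let ?L = "[0..<Suc N]" and ?v = "val X N u \<alpha>"
  let ?f = "\<lambda>p. \<Prod>l\<in>{1..4::nat}. ?v (coll l p)"
  define G where "G w = (if set w \<subseteq> {1..4::nat} then \<Sum>p\<leftarrow>shuf w ?L. ?f p else 0)" for w
  let ?g34 = "\<lambda>t. if t then [4, 3] else [3, 4::nat]"
  let ?fs = "alt (1::nat) 2 (Suc (Suc j))" and ?os = "alt (3::nat) 4 (Suc (Suc k))"
  have nG: "normal G"
    unfolding normal_def G_def using word_eq_0[OF u van] by (auto intro!: sum_list_eq_0 simp del: upt_Suc)
  have "thetaD \<alpha> N u T = block_sum G row2 ?g34 T" for T
  proof -
    have S: "set (map vD T) \<subseteq> carrier S4"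
      using vD_in_S4 by auto
    have b: "map row4 (map vD T) = map (block_row row2 ?g34) T"
      by (simp add: row4_vD)
    have "thetaD \<alpha> N u T = (\<Sum>w\<leftarrow>tabs (map row4 (map vD T)). \<Sum>p\<leftarrow>shuf w ?L. ?f p)"
      unfolding thetaD_def theta_def if_P[OF S] by (simp only:)
    also have "\<dots> = (\<Sum>w\<leftarrow>tabs (map row4 (map vD T)). G w)"
    proof (rule sum_list_cong)
      fix w assume "w \<in> set (tabs (map row4 (map vD T)))"
      then show "(\<Sum>p\<leftarrow>shuf w ?L. ?f p) = G w"
        unfolding G_def by (simp only: set_tabs_row4[OF S] if_True)
    qed
    also have "\<dots> = block_sum G row2 ?g34 T"
      unfolding block_sum_def b by (rule refl)
    finally show ?thesis .
  qed
  then have "ez3 (thetaD \<alpha> N u) (xb i) (xb j) (xb k) = ez3 (block_sum G row2 ?g34) (xb i) (xb j) (xb k)"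
    by presburger
  also have "\<dots> = (\<Sum>w\<leftarrow>switch_words (Suc i) ?fs ?os. G w)"
  proof (rule block_sum_eq_switch_words)
    show "block_word row2 (xb j) ?fs"
      using row2_block_word[of False j] by simp
    have "?g34 = (\<lambda>t. if t = False then [3, 4] else [4, 3])"
      by auto
    then show "block_word ?g34 (xb k) ?os"
      using block_word.full[of 3 "4::nat" False k] by simp
    show "set ?fs \<inter> set ?os = {}"
      unfolding set_alt by simp
  qed (simp_all add: nG)
  also have "\<dots> = (\<Sum>w\<leftarrow>switch_words (Suc i) ?fs ?os. \<Sum>p\<leftarrow>shuf w ?L. ?f p)"
  proof (rule sum_list_cong)
    fix w assume "w \<in> set (switch_words (Suc i) ?fs ?os)"
    then have "set w \<subseteq> {1..4}"
      using set_switch_words[of w "Suc i" ?fs ?os] unfolding set_alt by auto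
    then show "G w = (\<Sum>p\<leftarrow>shuf w ?L. ?f p)"
      by (simp add: G_def del: upt_Suc)
  qed
  also have "\<dots> = (\<Sum>p\<leftarrow>shuf (alt (1::nat) 2 (Suc (Suc i))) ?L. \<Sum>r\<leftarrow>resume ?fs (coll 1 p). \<Sum>s\<leftarrow>resume ?os (coll 2 p).
      (?v (coll 1 r) * ?v (coll 2 r)) * (?v (coll 3 s) * ?v (coll 4 s)))"
  proof -
    \<comment> \<open>Letters 1 and 2 form the first block, 3 and 4 the second.\<close>
    let ?P = "\<lambda>l::nat. l \<le> 2"
    let ?g = "\<lambda>r s. (?v (coll 1 r) * ?v (coll 2 r)) * (?v (coll 3 s) * ?v (coll 4 s))"
    have "{1..4} = {1, 2, 3, 4::nat}"
      by auto
    then have "?f p = ?v (coll 1 p) * ?v (coll 2 p) * (?v (coll 3 p) * ?v (coll 4 p))" for p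
      by (simp add: mult.assoc)
    then have f: "?f p = ?g (filter (\<lambda>z. ?P (fst z)) p) (filter (\<lambda>z. \<not> ?P (fst z)) p)" for p
      using coll_filter[of ?P 1 p] coll_filter[of ?P 2 p] coll_filter[of "\<lambda>l. \<not> ?P l" 3 p] coll_filter[of "\<lambda>l. \<not> ?P l" 4 p] by simp
    show ?thesis
      unfolding f by (rule sum_switch_words_shuf) (simp_all only: set_alt, simp_all)
  qed
  also have "\<dots> = cupL i (cup X j \<alpha> \<alpha>) (cup X k \<alpha> \<alpha>) N u ?L"
    unfolding cupL_def[of i]
  proof (rule sum_list_cong)
    fix p assume p: "p \<in> set (shuf (alt (1::nat) 2 (Suc (Suc i))) ?L)"
    have c: "coll l p \<noteq> []" "sorted (coll l p)" "set (coll l p) \<subseteq> {..N}" if "l \<in> {1, 2}" for l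
      using shuf_alt_coll[OF p that] by (auto simp del: upt_Suc alt.simps)
    have v: "val X N u (cup X m \<alpha> \<alpha>) (coll l p) = cupL m \<alpha> \<alpha> N u (coll l p)" if "l \<in> {1, 2}" for l m
      by (rule val_natural[OF natural_cup[OF van van] u c(2,3)[OF that]])
    have "(\<Sum>r\<leftarrow>resume ?fs (coll 1 p). \<Sum>s\<leftarrow>resume ?os (coll 2 p). (?v (coll 1 r) * ?v (coll 2 r)) * (?v (coll 3 s) * ?v (coll 4 s))) =
      (\<Sum>r\<leftarrow>shuf ?fs (coll 1 p). ?v (coll 1 r) * ?v (coll 2 r)) * (\<Sum>s\<leftarrow>shuf ?os (coll 2 p). ?v (coll 3 s) * ?v (coll 4 s))"
      unfolding sum_list_prod using c(1) by (simp add: resume_def del: alt.simps)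
    also have "\<dots> = cupL j \<alpha> \<alpha> N u (coll 1 p) * cupL k \<alpha> \<alpha> N u (coll 2 p)"
      unfolding cupL_def sum_shuf_alt_34[of "\<lambda>a b. ?v a * ?v b"] ..
    finally show "(\<Sum>r\<leftarrow>resume ?fs (coll 1 p). \<Sum>s\<leftarrow>resume ?os (coll 2 p). (?v (coll 1 r) * ?v (coll 2 r)) * (?v (coll 3 s) * ?v (coll 4 s))) =
      val X N u (cup X j \<alpha> \<alpha>) (coll 1 p) * val X N u (cup X k \<alpha> \<alpha>) (coll 2 p)"
      using v by simp
  qed
  also have "\<dots> = cup X i (cup X j \<alpha> \<alpha>) (cup X k \<alpha> \<alpha>) N u"
    by (rule cup_eq[OF u vanishes_cup[OF van van] vanishes_cup[OF van van], symmetric])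
  finally show ?thesis .
qed

lemma phi_thetaD:
  assumes u: "u \<in> cells X N" and \<alpha>: "cocycle X \<alpha>"
  shows "phi (thetaD \<alpha> N u) (xb q) (xb p) = (\<Sum>i\<le>q. \<Sum>j\<le>p + (q - i).
    ch j (q - i) * ch (p + (q - i) - j) (q - i) * cup X i (cup X j \<alpha> \<alpha>) (cup X (p + (q - i) - j) \<alpha> \<alpha>) N u)"
proof -
  have "normal (thetaD \<alpha> N u)"
    using \<alpha> by (intro normal_thetaD[OF u]) (simp add: cocycle_def)
  then show ?thesis
    unfolding ez3_thetaD[OF u \<alpha>, symmetric] by (rule phi_alt) (simp_all only: thetaD_def theta_vD)
qed

end

section \<open>The relation\<close>

lemma sum_fold_middle:
  fixes g :: "nat \<Rightarrow> 'b :: comm_monoid_add"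
  shows "(\<Sum>j\<le>P. g j) = (\<Sum>j | 2 * j = P. g j) + (\<Sum>j | 2 * j < P. g j + g (P - j))"
proof -
  have s: "{..P} = {j. 2 * j = P} \<union> ({j. 2 * j < P} \<union> {j. j \<le> P \<and> P < 2 * j})"
    by auto
  have f: "finite {j. 2 * j = P}" "finite {j. 2 * j < P}" "finite {j. j \<le> P \<and> P < 2 * j}"
    by (rule finite_subset[of _ "{..P}"]; auto)+
  have "(\<Sum>j\<le>P. g j) = (\<Sum>j | 2 * j = P. g j) + ((\<Sum>j | 2 * j < P. g j) + (\<Sum>j | j \<le> P \<and> P < 2 * j. g j))"
    unfolding s using f by (subst sum.union_disjoint; (subst sum.union_disjoint)?) auto
  also have "(\<Sum>j | j \<le> P \<and> P < 2 * j. g j) = (\<Sum>j | 2 * j < P. g (P - j))"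
    by (rule sum.reindex_bij_witness[where i = "\<lambda>j. P - j" and j = "\<lambda>j. P - j"]) auto
  finally show ?thesis
    by (simp add: sum.distrib)
qed

lemma ch_eq_1: "ch n k = 1 \<Longrightarrow> k \<le> n"
  using ch_eq_0[of n k] by fastforce

lemma bin_int: "bin (int a) (int b) = ch a b"
  by (auto simp: bin_def ch_def binomial_eq_0)

lemma Sq_cup: "k = i - int m \<Longrightarrow> Sq X i k \<beta> = cup X m \<beta> \<beta>"
  by (simp add: Sq_def)

context simplicial_set begin

abbreviation sqsq :: "'a cochain \<Rightarrow> nat \<Rightarrow> nat \<Rightarrow> nat \<Rightarrow> nat \<Rightarrow> 'a \<Rightarrow> bit" where
  "sqsq \<alpha> i j k \<equiv> cup X i (cup X j \<alpha> \<alpha>) (cup X k \<alpha> \<alpha>)"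

text \<open>The substitution is j = p - l and i = q - p + 2l. The inner square then is the cup-j
  square and the outer one the cup-i square; l >= 0 becomes q - i <= j, and otherwise the binomial
  coefficient vanishes.\<close>

lemma adem_sum_eq:
  "adem_sum X (int p) (int q) (int n) \<alpha> N u =
    (\<Sum>i\<le>q. \<Sum>j | 2 * j = p + (q - i). ch j (q - i) * sqsq \<alpha> i j j N u)"
proof -
  let ?S = "{(i, j). i \<le> q \<and> 2 * j = p + (q - i) \<and> q - i \<le> j}"
  have "(\<Sum>i\<le>q. \<Sum>j | 2 * j = p + (q - i). ch j (q - i) * sqsq \<alpha> i j j N u) =
    (\<Sum>(i, j)\<in>Sigma {..q} (\<lambda>i. {j. 2 * j = p + (q - i)}). ch j (q - i) * sqsq \<alpha> i j j N u)"
    by (rule sum.Sigma) (auto intro: finite_subset[of _ "{..p + q}"])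
  also have "\<dots> = (\<Sum>(i, j)\<in>?S. ch j (q - i) * sqsq \<alpha> i j j N u)"
  proof (rule sum.mono_neutral_right)
    show "finite (Sigma {..q} (\<lambda>i. {j. 2 * j = p + (q - i)}))"
      by (rule finite_subset[of _ "{..q} \<times> {..p + q}"]) auto
  qed (auto dest: ch_eq_1)
  also have "\<dots> = (\<Sum>l\<in>{l. 0 \<le> l \<and> 2 * l \<le> int p \<and> int q - int p + 2 * l \<ge> 0}.
      bin (int p - l) (int p - 2 * l) *
        Sq X (2 * int n - int p + l) (2 * int n - int q - l) (Sq X (int n) (int n - int p + l) \<alpha>) N u)"
  proof (rule sum.reindex_bij_witness[where i = "\<lambda>l. (nat (int q - int p + 2 * l), nat (int p - l))"
        and j = "\<lambda>(i, j). int p - int j"]; clarify?)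
    fix i j assume a: "i \<le> q" "2 * j = p + (q - i)" "q - i \<le> j"
    have e: "int p - (int p - int j) = int j" "int p - 2 * (int p - int j) = int (q - i)"
      using a by auto
    have "Sq X (int n) (int n - int p + (int p - int j)) \<alpha> = cup X j \<alpha> \<alpha>"
      by (rule Sq_cup) simp
    moreover have "Sq X (2 * int n - int p + (int p - int j)) (2 * int n - int q - (int p - int j)) \<beta> = cup X i \<beta> \<beta>" for \<beta>
      using a by (intro Sq_cup) auto
    ultimately show "bin (int p - (int p - int j)) (int p - 2 * (int p - int j)) *
        Sq X (2 * int n - int p + (int p - int j)) (2 * int n - int q - (int p - int j))
          (Sq X (int n) (int n - int p + (int p - int j)) \<alpha>) N u = ch j (q - i) * sqsq \<alpha> i j j N u"
      unfolding e bin_int by simp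
  qed auto
  finally show ?thesis
    by (simp add: adem_sum_def sum_apply2 scale_def)
qed

text \<open>The substitution is i = q - p + L, j = p - (L + A)/2, k = p - (L - A)/2. Then A > 0 says
  j < k, and A <= L says q - i <= j. The cup-(i+1) product of two cocycles has as coboundary the two
  cup-i products.\<close>

lemma coboundary_N_cochain:
  assumes u: "u \<in> cells X N" and \<alpha>: "cocycle X \<alpha>"
  shows "coboundary X (N_cochain X (int q) (int p) (int n) \<alpha>) N u =
    (\<Sum>i\<le>q. \<Sum>j | 2 * j < p + (q - i). ch j (q - i) * ch (p + (q - i) - j) (q - i) *
      (sqsq \<alpha> i j (p + (q - i) - j) N u + sqsq \<alpha> i (p + (q - i) - j) j N u))"
    (is "_ = (\<Sum>i\<le>q. \<Sum>j | _ i j. ?t i j)")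
proof -
  let ?S = "{(i, j). i \<le> q \<and> 2 * j < p + (q - i) \<and> q - i \<le> j}"
  let ?T = "{(L, A). 0 < A \<and> A \<le> L \<and> L \<le> int p \<and> even (L - A) \<and> int q - int p + L \<ge> 0}"
  define c where "c = (\<lambda>(L, A). bin (int p - (L + A) div 2) (int p - L) * bin (int p - (L - A) div 2) (int p - L))"
  define b where "b = (\<lambda>(L, A). cup X (nat (int q - int p + L + 1))
          (Sq X (int n) (int n - int p + (L + A) div 2) \<alpha>) (Sq X (int n) (int n - int p + (L - A) div 2) \<alpha>))"
  \<comment> \<open>The half-integral indices: L and A are odd, but L + A is even, so the division
    is exact.\<close>
  have odd: "2 * nat (int p - (L + A) div 2) < p + q - nat (int q - int p + L)"
    if "0 < A" "A \<le> L" "L \<le> int p" "0 \<le> int q - int p + L" "odd L" "odd A" for L A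
  proof -
    have "even (L + A)"
      using that by simp
    then obtain D where D: "L + A = 2 * D" ..
    then have "(L + A) div 2 = D"
      by simp
    then show ?thesis
      using that D by simp
  qed
  have "N_cochain X (int q) (int p) (int n) \<alpha> = (\<Sum>x\<in>?T. scale (c x) (b x))"
    unfolding N_cochain_def c_def b_def by (rule sum.cong) auto
  then have "coboundary X (N_cochain X (int q) (int p) (int n) \<alpha>) N u = (\<Sum>x\<in>?T. c x * coboundary X (b x) N u)"
    by (simp only: coboundary_sum_scale)
  also have "\<dots> = (\<Sum>(i, j)\<in>?S. ?t i j)"
  proof (rule sum.reindex_bij_witness[where i = "\<lambda>(L, A). (nat (int q - int p + L), nat (int p - (L + A) div 2))"
        and j = "\<lambda>(i, j). (int p - int q + int i, int p + int q - int i - 2 * int j)", symmetric]; clarify?)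
    fix i j assume a: "i \<le> q" "2 * j < p + (q - i)" "q - i \<le> j"
    let ?L = "int p - int q + int i" and ?A = "int p + int q - int i - 2 * int j" and ?k = "p + (q - i) - j"
    have k: "int ?k = int p + int q - int i - int j"
      using a by simp
    have d: "(?L + ?A) div 2 = int p - int j" "(?L - ?A) div 2 = int p - int ?k"
      unfolding k by auto
    have m: "int p - ?L = int (q - i)" "nat (int q - int p + ?L + 1) = Suc i" "int p - (int p - int x) = int x" for x
      using a by auto
    have s: "Sq X (int n) (int n - int p + (int p - int x)) \<alpha> = cup X x \<alpha> \<alpha>" for x
      by (rule Sq_cup) simp
    show "c (?L, ?A) * coboundary X (b (?L, ?A)) N u = ?t i j"
      unfolding c_def b_def prod.case d m s bin_int coboundary_cup[OF u cocycle_cup[OF \<alpha>] cocycle_cup[OF \<alpha>]] by simp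
  qed (auto intro: odd)
  also have "\<dots> = (\<Sum>(i, j)\<in>Sigma {..q} (\<lambda>i. {j. 2 * j < p + (q - i)}). ?t i j)"
  proof (rule sum.mono_neutral_left)
    show "finite (Sigma {..q} (\<lambda>i. {j. 2 * j < p + (q - i)}))"
      by (rule finite_subset[of _ "{..q} \<times> {..p + q}"]) auto
  qed (auto dest: ch_eq_1)
  also have "\<dots> = (\<Sum>i\<le>q. \<Sum>j | 2 * j < p + (q - i). ?t i j)"
    by (rule sum.Sigma[symmetric]) (auto intro: finite_subset[of _ "{..p + q}"])
  finally show ?thesis .
qed

lemma phi_thetaD_adem:
  assumes u: "u \<in> cells X N" and \<alpha>: "cocycle X \<alpha>"
  shows "phi (thetaD \<alpha> N u) (xb q) (xb p) =
    adem_sum X (int p) (int q) (int n) \<alpha> N u + coboundary X (N_cochain X (int q) (int p) (int n) \<alpha>) N u"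
proof -
  \<comment> \<open>For j = k the two binomial factors coincide and reduce to one.\<close>
  have idem: "(c::bit) * c = c" for c
    by (cases c) simp_all
  show ?thesis
    unfolding phi_thetaD[OF assms] adem_sum_eq coboundary_N_cochain[OF assms] sum.distrib[symmetric]
  proof (rule sum.cong[OF refl])
    fix i
    let ?P = "p + (q - i)"
    let ?g = "\<lambda>j. ch j (q - i) * ch (?P - j) (q - i) * sqsq \<alpha> i j (?P - j) N u"
    have "(\<Sum>j\<le>?P. ?g j) = (\<Sum>j | 2 * j = ?P. ?g j) + (\<Sum>j | 2 * j < ?P. ?g j + ?g (?P - j))"
      by (rule sum_fold_middle)
    also have "(\<Sum>j | 2 * j = ?P. ?g j) = (\<Sum>j | 2 * j = ?P. ch j (q - i) * sqsq \<alpha> i j j N u)"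
    proof (rule sum.cong[OF refl])
      fix j assume "j \<in> {j. 2 * j = ?P}"
      then have "?P - j = j"
        by simp
      then show "?g j = ch j (q - i) * sqsq \<alpha> i j j N u"
        by (simp only: idem)
    qed
    also have "(\<Sum>j | 2 * j < ?P. ?g j + ?g (?P - j)) = (\<Sum>j | 2 * j < ?P. ch j (q - i) * ch (?P - j) (q - i) *
      (sqsq \<alpha> i j (?P - j) N u + sqsq \<alpha> i (?P - j) j N u))"
    proof (rule sum.cong[OF refl])
      fix j assume "j \<in> {j. 2 * j < ?P}"
      then have "?P - (?P - j) = j"
        by simp
      then show "?g j + ?g (?P - j) = ch j (q - i) * ch (?P - j) (q - i) *
          (sqsq \<alpha> i j (?P - j) N u + sqsq \<alpha> i (?P - j) j N u)"
        by (simp only: distrib_left mult.commute[of "ch (?P - j) (q - i)"])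
    qed
    finally show "(\<Sum>j\<le>?P. ?g j) = (\<Sum>j | 2 * j = ?P. ch j (q - i) * sqsq \<alpha> i j j N u) +
      (\<Sum>j | 2 * j < ?P. ch j (q - i) * ch (?P - j) (q - i) *
        (sqsq \<alpha> i j (?P - j) N u + sqsq \<alpha> i (?P - j) j N u))" .
  qed
qed

end

theorem theorem0p3:
  fixes X :: "'a sset" and q p n :: nat and \<alpha> :: "'a cochain"
  assumes "simplicial_set X"
    and "\<alpha> \<in> cocycles X n"
  shows "cochain_eq X
    (adem_sum X (int q) (int p) (int n) \<alpha> + adem_sum X (int p) (int q) (int n) \<alpha>)
    (coboundary X
      (BS4_act X (incl_BG S4 (J_Psi_bar (x_cross p q))) \<alpha>
        + N_cochain X (int p) (int q) (int n) \<alpha>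
        + BS4_act X (incl_BG S4 (J_Psi_bar (x_cross q p))) \<alpha>
        + N_cochain X (int q) (int p) (int n) \<alpha>
        + BS4_act X (J_23_bar (incl_BG S4 (x_cross q p))) \<alpha>))"
  unfolding cochain_eq_def
proof (intro allI ballI)
  interpret simplicial_set X
    by (rule assms(1))
  fix N u assume u: "u \<in> cells X N"
  have \<alpha>: "cocycle X \<alpha>"
    using assms(2) by (auto simp: cocycles_def cochains_def cocycle_def vanishes_def)
  show "(adem_sum X (int q) (int p) (int n) \<alpha> + adem_sum X (int p) (int q) (int n) \<alpha>) N u =
    coboundary X
      (BS4_act X (incl_BG S4 (J_Psi_bar (x_cross p q))) \<alpha>
        + N_cochain X (int p) (int q) (int n) \<alpha>
        + BS4_act X (incl_BG S4 (J_Psi_bar (x_cross q p))) \<alpha>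
        + N_cochain X (int q) (int p) (int n) \<alpha>
        + BS4_act X (J_23_bar (incl_BG S4 (x_cross q p))) \<alpha>) N u"
    unfolding coboundary_add coboundary_J_Psi[OF u \<alpha>] coboundary_J_23[OF u \<alpha>] phi_thetaD_adem[OF u \<alpha>, where n = n] plus_fun_apply
    \<comment> \<open>The sums of \<open>theta\<close> over both cross products occur twice, from
      the \<Psi> homotopies and from the (23) homotopy, and the coboundaries of the
      \<open>N_cochain\<close> terms meet those inside \<open>phi\<close>. Only the two Adem sums
      occur once.\<close>
    by (simp only: bit_cancel add_0_left add_0_right)
qed

end
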